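(* Let $\mathfrak t$ be a Lie algebroid over $M$ and $\mathfrak g\subset J^1\mathfrak t$ an infinitesimal geometric structure on $\mathfrak t$. If $\mathfrak g$ is transitive, then its prolongation $\mathfrak g^{(1)}$ is the joint isotropy of the tautological one-form $a$ and the torsion $da$, i.e. $$\mathfrak g^{(1)}=(J^1\mathfrak g)_a\cap(J^1\mathfrak g)_{da}\subset J^1\mathfrak g .$$
   Context: Everything is $C^\infty$. For a Lie algebroid $\mathfrak t$ over $M$ with anchor $\#$, $J^1\mathfrak t$ is the Lie algebroid of 1-jets of sections with anchor $J^1\mathfrak t\to\mathfrak t\xrightarrow{\#}TM$ and the unique bracket with $[J^1X,J^1Y]=J^1[X,Y]$. An infinitesimal geometric structure on $\mathfrak t$ is a subalgebroid (constant-rank subbundle closed under bracket) $\mathfrak g\subset J^1\mathfrak t$; it is itself a Lie algebroid, and is transitive if its anchor $\mathfrak g\to TM$ is surjective. The prolongation is $\mathfrak g^{(1)}:=J^1\mathfrak g\cap J^2\mathfrak t\subset J^1\mathfrak g$, where $J^1\mathfrak g$ and $J^2\mathfrak t$ are regarded as subsets of $J^1(J^1\mathfrak t)$, the latter via $J^2W(m)\mapsto J^1(J^1W)(m)$. For any Lie algebroid $\mathfrak k$ the adjoint representation of $J^1\mathfrak k$ on $\mathfrak k$ is determined by $\mathrm{ad}^{\mathfrak k}_{J^1X}Y=[X,Y]_{\mathfrak k}$. The tautological one-form is the restriction $a\colon\mathfrak g\to\mathfrak t$ of the projection $J^1\mathfrak t\to\mathfrak t$, regarded as a section of $\mathfrak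 g^*\otimes\mathfrak t$. The torsion is the section $da$ of $\Lambda^2(\mathfrak g^* )\otimes\mathfrak t$ given by $$da(X_1,X_2)=\mathrm{ad}^{\mathfrak t}_{X_1}(aX_2)-\mathrm{ad}^{\mathfrak t}_{X_2}(aX_1)-a[X_1,X_2].$$ Let $p\colon J^1\mathfrak g\to\mathfrak g$ be the projection. $J^1\mathfrak g$ acts on $\mathfrak g$ by $\mathrm{ad}^{\mathfrak g}$ and on $\mathfrak t$ by $\xi\cdot W=\mathrm{ad}^{\mathfrak t}_{p\xi}W$, hence on $\mathfrak g^*\otimes\mathfrak t$ and $\Lambda^2(\mathfrak g^* )\otimes\mathfrak t$. The isotropies are the (possibly variable-rank) subsets $(J^1\mathfrak g)_a=\{\xi\in J^1\mathfrak g:\xi\cdot a=0\}$ and $(J^1\mathfrak g)_{da}=\{\xi\in J^1\mathfrak g:\xi\cdot da=0\}$, conditions being imposed at the base point of $\xi$. *)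

theory Defs
  imports "HOL-Analysis.Analysis"
begin

section \<open>Smooth manifolds\<close>

primrec higher_differentiable_on ::
    "'a::real_normed_vector set \<Rightarrow> ('a \<Rightarrow> 'b::real_normed_vector) \<Rightarrow> nat \<Rightarrow> bool" where
  "higher_differentiable_on S f 0 \<longleftrightarrow> continuous_on S f"
| "higher_differentiable_on S f (Suc k) \<longleftrightarrow>
     (\<forall>x\<in>S. f differentiable (at x)) \<and>
     (\<forall>v. higher_differentiable_on S (\<lambda>x. frechet_derivative f (at x) v) k)"

text \<open>Used only for open \<open>S\<close> in a finite-dimensional space.\<close>

definition smooth_on :: "'a::real_normed_vector set \<Rightarrow> ('a \<Rightarrow> 'b::real_normed_vector) \<Rightarrow> bool" where
  "smooth_on S f \<longleftrightarrow> (\<forall>k. higher_differentiable_on S f k)"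

text \<open>
  Model spaces are types of class \<^class>\<open>real_normed_vector\<close> that are finite-dimensional in the
  following sense. Unlike \<^class>\<open>euclidean_space\<close> this allows dimension (or rank) zero.
\<close>

definition finite_dimensional :: "'a::real_vector itself \<Rightarrow> bool" where
  "finite_dimensional _ \<longleftrightarrow> (\<exists>B::'a set. finite B \<and> span B = UNIV)"

type_synonym ('m, 'e) chart = "'m set \<times> ('m \<Rightarrow> 'e)"

text \<open>The manifold is the whole type \<open>'m\<close>, with smooth structure generated by the atlas \<open>A\<close>.\<close>

definition smooth_manifold ::
    "('m::{t2_space,second_countable_topology}, 'e::real_normed_vector) chart set \<Rightarrow> bool" where
  "smooth_manifold A \<longleftrightarrow>
     finite_dimensional TYPE('e) \<and>
     \<Union>(fst ` A) = UNIV \<and>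
     (\<forall>(U, \<kappa>)\<in>A. open U \<and> open (\<kappa> ` U) \<and> homeomorphism U (\<kappa> ` U) \<kappa> (inv_into U \<kappa>)) \<and>
     (\<forall>(U, \<kappa>)\<in>A. \<forall>(V, \<psi>)\<in>A. smooth_on (\<kappa> ` (U \<inter> V)) (\<lambda>x. \<psi> (inv_into U \<kappa> x)))"

definition smooth_map ::
    "('m, 'e::real_normed_vector) chart set \<Rightarrow> 'm set \<Rightarrow> ('m \<Rightarrow> 'b::real_normed_vector) \<Rightarrow> bool" where
  "smooth_map A W f \<longleftrightarrow> (\<forall>(V, \<kappa>)\<in>A. smooth_on (\<kappa> ` (V \<inter> W)) (\<lambda>x. f (inv_into V \<kappa> x)))"


section \<open>Vector bundles\<close>

text \<open>
  A bundle over \<open>'m\<close> with model fibre \<open>'r\<close>. The fibres need not be disjoint: a point of the total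
  space is a pair \<open>(m, x)\<close> with \<open>x\<close> in the fibre over \<open>m\<close>. The elements of \<open>triv\<close> are local
  trivializations \<open>(U, \<phi>)\<close>, where \<open>\<phi> m\<close> maps the fibre over \<open>m \<in> U\<close> to the model fibre.
\<close>

record ('m, 'v, 'r) vbundle =
  fibre :: "'m \<Rightarrow> 'v set"
  vzero :: "'m \<Rightarrow> 'v"
  vplus :: "'m \<Rightarrow> 'v \<Rightarrow> 'v \<Rightarrow> 'v"
  vscale :: "'m \<Rightarrow> real \<Rightarrow> 'v \<Rightarrow> 'v"
  triv :: "('m set \<times> ('m \<Rightarrow> 'v \<Rightarrow> 'r)) set"

definition vminus :: "('m, 'v, 'r, 'z) vbundle_scheme \<Rightarrow> 'm \<Rightarrow> 'v \<Rightarrow> 'v \<Rightarrow> 'v" where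
  "vminus E m x y = vplus E m x (vscale E m (- 1) y)"

text \<open>
  The vector space axioms for the fibres are not listed since they are transported from the model
  fibre by the bijections \<open>\<phi> m\<close>.
\<close>

definition vector_bundle ::
    "('m::topological_space, 'e::real_normed_vector) chart set \<Rightarrow>
     ('m, 'v, 'r::real_normed_vector, 'z) vbundle_scheme \<Rightarrow> bool" where
  "vector_bundle A E \<longleftrightarrow>
     finite_dimensional TYPE('r) \<and>
     (\<forall>m. vzero E m \<in> fibre E m) \<and>
     (\<forall>m. \<forall>x\<in>fibre E m. \<forall>y\<in>fibre E m. vplus E m x y \<in> fibre E m) \<and>
     (\<forall>m c. \<forall>x\<in>fibre E m. vscale E m c x \<in> fibre E m) \<and>
     \<Union>(fst ` triv E) = UNIV \<and>
     (\<forall>(U, \<phi>)\<in>triv E. open U \<and>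
        (\<forall>m\<in>U. bij_betw (\<phi> m) (fibre E m) UNIV \<and>
           \<phi> m (vzero E m) = 0 \<and>
           (\<forall>x\<in>fibre E m. \<forall>y\<in>fibre E m. \<phi> m (vplus E m x y) = \<phi> m x + \<phi> m y) \<and>
           (\<forall>c. \<forall>x\<in>fibre E m. \<phi> m (vscale E m c x) = c *\<^sub>R \<phi> m x))) \<and>
     (\<forall>(U, \<phi>)\<in>triv E. \<forall>(V, \<psi>)\<in>triv E. \<forall>w.
        smooth_map A (U \<inter> V) (\<lambda>m. \<psi> m (inv_into (fibre E m) (\<phi> m) w)))"

definition sections ::
    "('m, 'e::real_normed_vector) chart set \<Rightarrow>
     ('m, 'v, 'r::real_normed_vector, 'z) vbundle_scheme \<Rightarrow> ('m \<Rightarrow> 'v) set" where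
  "sections A E = {X. (\<forall>m. X m \<in> fibre E m) \<and>
     (\<forall>(U, \<phi>)\<in>triv E. smooth_map A U (\<lambda>m. \<phi> m (X m)))}"

definition bundle_map ::
    "('m, 'e::real_normed_vector) chart set \<Rightarrow>
     ('m, 'v, 'r::real_normed_vector, 'y) vbundle_scheme \<Rightarrow>
     ('m, 'w, 's::real_normed_vector, 'z) vbundle_scheme \<Rightarrow> ('m \<Rightarrow> 'v \<Rightarrow> 'w) \<Rightarrow> bool" where
  "bundle_map A E F h \<longleftrightarrow>
     (\<forall>m. \<forall>x\<in>fibre E m. h m x \<in> fibre F m) \<and>
     (\<forall>m. \<forall>x\<in>fibre E m. \<forall>y\<in>fibre E m. h m (vplus E m x y) = vplus F m (h m x) (h m y)) \<and>
     (\<forall>m c. \<forall>x\<in>fibre E m. h m (vscale E m c x) = vscale F m c (h m x)) \<and>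
     (\<forall>(U, \<phi>)\<in>triv E. \<forall>(V, \<psi>)\<in>triv F. \<forall>w.
        smooth_map A (U \<inter> V) (\<lambda>m. \<psi> m (h m (inv_into (fibre E m) (\<phi> m) w))))"

definition sec_plus ::
    "('m, 'v, 'r, 'z) vbundle_scheme \<Rightarrow> ('m \<Rightarrow> 'v) \<Rightarrow> ('m \<Rightarrow> 'v) \<Rightarrow> 'm \<Rightarrow> 'v" where
  "sec_plus E X Y = (\<lambda>m. vplus E m (X m) (Y m))"

definition sec_scale ::
    "('m, 'v, 'r, 'z) vbundle_scheme \<Rightarrow> ('m \<Rightarrow> real) \<Rightarrow> ('m \<Rightarrow> 'v) \<Rightarrow> 'm \<Rightarrow> 'v" where
  "sec_scale E f X = (\<lambda>m. vscale E m (f m) (X m))"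


section \<open>Tangent bundle\<close>

text \<open>
  Tangent vectors at \<open>m\<close> are the operators \<open>f \<mapsto> d(f \<circ> \<kappa>\<inverse>)(\<kappa> m) v\<close> on smooth functions, extended by
  \<open>0\<close> to non-smooth \<open>f\<close> so that equality of tangent vectors is equality of HOL functions.
\<close>

definition dir_deriv ::
    "('m, 'e::real_normed_vector) chart set \<Rightarrow> ('m, 'e) chart \<Rightarrow> 'm \<Rightarrow> 'e \<Rightarrow> ('m \<Rightarrow> real) \<Rightarrow> real" where
  "dir_deriv A = (\<lambda>(U, \<kappa>) m v f. if smooth_map A UNIV f
     then frechet_derivative (\<lambda>x. f (inv_into U \<kappa> x)) (at (\<kappa> m)) v else 0)"

definition tangent_bundle ::
    "('m, 'e::real_normed_vector) chart set \<Rightarrow> ('m, ('m \<Rightarrow> real) \<Rightarrow> real, 'e) vbundle" where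
  "tangent_bundle A =
     \<lparr>fibre = (\<lambda>m. {dir_deriv A (U, \<kappa>) m v | U \<kappa> v. (U, \<kappa>) \<in> A \<and> m \<in> U}),
      vzero = (\<lambda>m f. 0),
      vplus = (\<lambda>m D D' f. D f + D' f),
      vscale = (\<lambda>m c D f. c * D f),
      triv = {(U, \<lambda>m D. THE v. D = dir_deriv A (U, \<kappa>) m v) | U \<kappa>. (U, \<kappa>) \<in> A}\<rparr>"


section \<open>Lie algebroids\<close>

text \<open>The bracket is meaningful only on smooth sections.\<close>

record ('m, 'v, 'r) lie_algebroid = "('m, 'v, 'r) vbundle" +
  anchor :: "'m \<Rightarrow> 'v \<Rightarrow> ('m \<Rightarrow> real) \<Rightarrow> real"
  bracket :: "('m \<Rightarrow> 'v) \<Rightarrow> ('m \<Rightarrow> 'v) \<Rightarrow> 'm \<Rightarrow> 'v"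

definition lie_derivative ::
    "('m, 'v, 'r, 'z) lie_algebroid_scheme \<Rightarrow> ('m \<Rightarrow> 'v) \<Rightarrow> ('m \<Rightarrow> real) \<Rightarrow> 'm \<Rightarrow> real" where
  "lie_derivative L X f = (\<lambda>m. anchor L m (X m) f)"

definition lie_algebroid ::
    "('m::topological_space, 'e::real_normed_vector) chart set \<Rightarrow>
     ('m, 'v, 'r::real_normed_vector, 'z) lie_algebroid_scheme \<Rightarrow> bool" where
  "lie_algebroid A L \<longleftrightarrow>
     vector_bundle A L \<and>
     bundle_map A L (tangent_bundle A) (anchor L) \<and>
     (\<forall>X\<in>sections A L. \<forall>Y\<in>sections A L. bracket L X Y \<in> sections A L) \<and>
     (\<forall>X\<in>sections A L. \<forall>Y\<in>sections A L. \<forall>Z\<in>sections A L.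
        bracket L X (sec_plus L Y Z) = sec_plus L (bracket L X Y) (bracket L X Z)) \<and>
     (\<forall>X\<in>sections A L. \<forall>Y\<in>sections A L.
        bracket L Y X = sec_scale L (\<lambda>_. - 1) (bracket L X Y)) \<and>
     (\<forall>X\<in>sections A L. \<forall>Y\<in>sections A L. \<forall>Z\<in>sections A L.
        bracket L X (bracket L Y Z) =
          sec_plus L (bracket L (bracket L X Y) Z) (bracket L Y (bracket L X Z))) \<and>
     (\<forall>X\<in>sections A L. \<forall>Y\<in>sections A L. \<forall>f. smooth_map A UNIV f \<longrightarrow>
        bracket L X (sec_scale L f Y) =
          sec_plus L (sec_scale L f (bracket L X Y)) (sec_scale L (lie_derivative L X f) Y)) \<and>
     (\<forall>X\<in>sections A L. \<forall>Y\<in>sections A L. \<forall>f. smooth_map A UNIV f \<longrightarrow>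
        lie_derivative L (bracket L X Y) f =
          (\<lambda>m. lie_derivative L X (lie_derivative L Y f) m -
               lie_derivative L Y (lie_derivative L X f) m))"

definition transitive ::
    "('m, 'e::real_normed_vector) chart set \<Rightarrow> ('m, 'v, 'r, 'z) lie_algebroid_scheme \<Rightarrow> bool" where
  "transitive A L \<longleftrightarrow> (\<forall>m. anchor L m ` fibre L m = fibre (tangent_bundle A) m)"

text \<open>
  A subalgebroid \<open>K\<close> of \<open>L\<close> is a vector bundle whose fibres are linear subspaces of those of \<open>L\<close>
  with smooth inclusion (hence a subbundle of constant rank), whose sections are closed under the
  bracket of \<open>L\<close>; its anchor and bracket are the restrictions of those of \<open>L\<close>.
\<close>

definition subalgebroid ::
    "('m::topological_space, 'e::real_normed_vector) chart set \<Rightarrow>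
     ('m, 'v, 'k::real_normed_vector, 'y) lie_algebroid_scheme \<Rightarrow>
     ('m, 'v, 'r::real_normed_vector, 'z) lie_algebroid_scheme \<Rightarrow> bool" where
  "subalgebroid A K L \<longleftrightarrow>
     vector_bundle A K \<and>
     bundle_map A K L (\<lambda>m x. x) \<and>
     (\<forall>X\<in>sections A K. \<forall>Y\<in>sections A K. bracket L X Y \<in> sections A K) \<and>
     (\<forall>X\<in>sections A K. \<forall>Y\<in>sections A K. bracket K X Y = bracket L X Y) \<and>
     (\<forall>m. \<forall>x\<in>fibre K m. anchor K m x = anchor L m x)"


section \<open>Jets\<close>

definition local_rep ::
    "('m, 'e) chart \<Rightarrow> ('m \<Rightarrow> 'v \<Rightarrow> 'r) \<Rightarrow> ('m \<Rightarrow> 'v) \<Rightarrow> 'e \<Rightarrow> 'r" where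
  "local_rep = (\<lambda>(V, \<kappa>) \<phi> X x. \<phi> (inv_into V \<kappa> x) (X (inv_into V \<kappa> x)))"

definition same_jet ::
    "('m, 'e::real_normed_vector) chart set \<Rightarrow>
     ('m, 'v, 'r::real_normed_vector, 'z) vbundle_scheme \<Rightarrow> 'm \<Rightarrow> ('m \<Rightarrow> 'v) \<Rightarrow> ('m \<Rightarrow> 'v) \<Rightarrow> bool" where
  "same_jet A E m X Y \<longleftrightarrow> X m = Y m \<and>
     (\<forall>(U, \<phi>)\<in>triv E. \<forall>(V, \<kappa>)\<in>A. m \<in> U \<inter> V \<longrightarrow>
        frechet_derivative (local_rep (V, \<kappa>) \<phi> X) (at (\<kappa> m)) =
        frechet_derivative (local_rep (V, \<kappa>) \<phi> Y) (at (\<kappa> m)))"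

text \<open>A 1-jet at \<open>m\<close> is an equivalence class of global sections.\<close>

definition jet ::
    "('m, 'e::real_normed_vector) chart set \<Rightarrow>
     ('m, 'v, 'r::real_normed_vector, 'z) vbundle_scheme \<Rightarrow> ('m \<Rightarrow> 'v) \<Rightarrow> 'm \<Rightarrow> ('m \<Rightarrow> 'v) set" where
  "jet A E X m = {Y \<in> sections A E. same_jet A E m X Y}"

definition jet_rep :: "('m \<Rightarrow> 'v) set \<Rightarrow> 'm \<Rightarrow> 'v" where
  "jet_rep \<xi> = (SOME X. X \<in> \<xi>)"

definition jet_proj :: "'m \<Rightarrow> ('m \<Rightarrow> 'v) set \<Rightarrow> 'v" where
  "jet_proj m \<xi> = jet_rep \<xi> m"

definition jet_fibre ::
    "('m, 'e::real_normed_vector) chart set \<Rightarrow>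
     ('m, 'v, 'r::real_normed_vector, 'z) vbundle_scheme \<Rightarrow> 'm \<Rightarrow> ('m \<Rightarrow> 'v) set set" where
  "jet_fibre A E m = {jet A E X m | X. X \<in> sections A E}"

text \<open>
  A chart \<open>(V, \<kappa>)\<close> and a trivialization \<open>(U, \<phi>)\<close> of \<open>T\<close> induce the trivialization of \<open>J\<^sup>1T\<close> that
  sends a jet to the value and the derivative of the coordinate expression of a representative.
  The bracket \<open>B\<close> on sections of \<open>J\<^sup>1T\<close> is a parameter; the predicate \<open>is_jet_bracket\<close> below
  determines it uniquely on smooth sections.
\<close>

definition jet_algebroid ::
    "('m, 'e::real_normed_vector) chart set \<Rightarrow>
     ('m, 'v, 'r::real_normed_vector, 'z) lie_algebroid_scheme \<Rightarrow>
     (('m \<Rightarrow> ('m \<Rightarrow> 'v) set) \<Rightarrow> ('m \<Rightarrow> ('m \<Rightarrow> 'v) set) \<Rightarrow> 'm \<Rightarrow> ('m \<Rightarrow> 'v) set) \<Rightarrow>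
     ('m, ('m \<Rightarrow> 'v) set, 'r \<times> ('e \<Rightarrow>\<^sub>L 'r)) lie_algebroid" where
  "jet_algebroid A T B =
     \<lparr>fibre = jet_fibre A T,
      vzero = jet A T (vzero T),
      vplus = (\<lambda>m \<xi> \<eta>. \<Union>X\<in>\<xi>. \<Union>Y\<in>\<eta>. jet A T (sec_plus T X Y) m),
      vscale = (\<lambda>m c \<xi>. \<Union>X\<in>\<xi>. jet A T (sec_scale T (\<lambda>_. c) X) m),
      triv = {(U \<inter> V, \<lambda>m \<xi>. (\<phi> m (jet_proj m \<xi>),
                 Blinfun (frechet_derivative (local_rep (V, \<kappa>) \<phi> (jet_rep \<xi>)) (at (\<kappa> m)))))
              | U \<phi> V \<kappa>. (U, \<phi>) \<in> triv T \<and> (V, \<kappa>) \<in> A},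
      anchor = (\<lambda>m \<xi>. anchor T m (jet_proj m \<xi>)),
      bracket = B\<rparr>"

definition is_jet_bracket ::
    "('m::topological_space, 'e::real_normed_vector) chart set \<Rightarrow>
     ('m, 'v, 'r::real_normed_vector, 'z) lie_algebroid_scheme \<Rightarrow>
     (('m \<Rightarrow> ('m \<Rightarrow> 'v) set) \<Rightarrow> ('m \<Rightarrow> ('m \<Rightarrow> 'v) set) \<Rightarrow> 'm \<Rightarrow> ('m \<Rightarrow> 'v) set) \<Rightarrow> bool" where
  "is_jet_bracket A T B \<longleftrightarrow>
     lie_algebroid A (jet_algebroid A T B) \<and>
     (\<forall>X\<in>sections A T. \<forall>Y\<in>sections A T. B (jet A T X) (jet A T Y) = jet A T (bracket T X Y))"

text \<open>\<open>ad L m \<xi> Y\<close> is \<open>[X, Y](m)\<close> for any \<open>X\<close> with 1-jet \<open>\<xi>\<close> at \<open>m\<close>.\<close>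

definition ad ::
    "('m, 'v, 'r, 'z) lie_algebroid_scheme \<Rightarrow> 'm \<Rightarrow> ('m \<Rightarrow> 'v) set \<Rightarrow> ('m \<Rightarrow> 'v) \<Rightarrow> 'v" where
  "ad L m \<xi> Y = bracket L (jet_rep \<xi>) Y m"


section \<open>Prolongation, torsion and isotropy\<close>

text \<open>
  Throughout, \<open>G\<close> is a subalgebroid of \<open>J\<^sup>1T\<close>. Subsets of \<open>J\<^sup>1G\<close> are represented as sets of pairs
  of a base point and a jet at that point.
\<close>

definition jet_space ::
    "('m, 'e::real_normed_vector) chart set \<Rightarrow>
     ('m, 'v, 'r::real_normed_vector, 'z) vbundle_scheme \<Rightarrow> ('m \<times> ('m \<Rightarrow> 'v) set) set" where
  "jet_space A E = (SIGMA m:UNIV. jet_fibre A E m)"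

text \<open>\<open>J\<^sup>2T\<close> as a subset of \<open>J\<^sup>1(J\<^sup>1T)\<close>.\<close>

definition jet2_space ::
    "('m, 'e::real_normed_vector) chart set \<Rightarrow>
     ('m, 'v, 'r::real_normed_vector, 'z) lie_algebroid_scheme \<Rightarrow>
     (('m \<Rightarrow> ('m \<Rightarrow> 'v) set) \<Rightarrow> ('m \<Rightarrow> ('m \<Rightarrow> 'v) set) \<Rightarrow> 'm \<Rightarrow> ('m \<Rightarrow> 'v) set) \<Rightarrow>
     ('m \<times> ('m \<Rightarrow> ('m \<Rightarrow> 'v) set) set) set" where
  "jet2_space A T B =
     {(m, jet A (jet_algebroid A T B) (jet A T W) m) | m W. W \<in> sections A T}"

text \<open>
  The inclusion of \<open>J\<^sup>1G\<close> into \<open>J\<^sup>1(J\<^sup>1T)\<close> enlarges the equivalence class of a section of \<open>G\<close> to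
  its class among all sections of \<open>J\<^sup>1T\<close>.
\<close>

definition prolongation ::
    "('m, 'e::real_normed_vector) chart set \<Rightarrow>
     ('m, 'v, 'r::real_normed_vector, 'y) lie_algebroid_scheme \<Rightarrow>
     (('m \<Rightarrow> ('m \<Rightarrow> 'v) set) \<Rightarrow> ('m \<Rightarrow> ('m \<Rightarrow> 'v) set) \<Rightarrow> 'm \<Rightarrow> ('m \<Rightarrow> 'v) set) \<Rightarrow>
     ('m, ('m \<Rightarrow> 'v) set, 'k::real_normed_vector, 'z) lie_algebroid_scheme \<Rightarrow>
     ('m \<times> ('m \<Rightarrow> ('m \<Rightarrow> 'v) set) set) set" where
  "prolongation A T B G =
     {(m, \<xi>) \<in> jet_space A G.
        (m, jet A (jet_algebroid A T B) (jet_rep \<xi>) m) \<in> jet2_space A T B}"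

definition tautological_form :: "'m \<Rightarrow> ('m \<Rightarrow> 'v) set \<Rightarrow> 'v" where
  "tautological_form m x = jet_proj m x"

text \<open>
  The torsion on sections is tensorial, so at a point it may be evaluated on arbitrary sections of
  \<open>G\<close> through the given vectors.
\<close>

definition torsion_sec ::
    "('m, 'v, 'r, 'y) lie_algebroid_scheme \<Rightarrow>
     ('m, ('m \<Rightarrow> 'v) set, 'k, 'z) lie_algebroid_scheme \<Rightarrow>
     ('m \<Rightarrow> ('m \<Rightarrow> 'v) set) \<Rightarrow> ('m \<Rightarrow> ('m \<Rightarrow> 'v) set) \<Rightarrow> 'm \<Rightarrow> 'v" where
  "torsion_sec T G X1 X2 m =
     vminus T m
       (vminus T m (ad T m (X1 m) (\<lambda>p. tautological_form p (X2 p)))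
                   (ad T m (X2 m) (\<lambda>p. tautological_form p (X1 p))))
       (tautological_form m (bracket G X1 X2 m))"

definition section_through ::
    "('m, 'e::real_normed_vector) chart set \<Rightarrow>
     ('m, 'v, 'r::real_normed_vector, 'z) vbundle_scheme \<Rightarrow> 'm \<Rightarrow> 'v \<Rightarrow> 'm \<Rightarrow> 'v" where
  "section_through A E m x = (SOME X. X \<in> sections A E \<and> X m = x)"

definition torsion ::
    "('m, 'e::real_normed_vector) chart set \<Rightarrow>
     ('m, 'v, 'r, 'y) lie_algebroid_scheme \<Rightarrow>
     ('m, ('m \<Rightarrow> 'v) set, 'k::real_normed_vector, 'z) lie_algebroid_scheme \<Rightarrow>
     'm \<Rightarrow> ('m \<Rightarrow> 'v) set \<Rightarrow> ('m \<Rightarrow> 'v) set \<Rightarrow> 'v" where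
  "torsion A T G m x1 x2 =
     torsion_sec T G (section_through A G m x1) (section_through A G m x2) m"

text \<open>
  For \<open>\<xi>\<close> a jet at \<open>m\<close> and \<open>c\<close> a field of linear (bilinear alternating) maps from \<open>G\<close> to \<open>T\<close>, these
  are the values at \<open>m\<close> of \<open>\<xi> \<cdot> c\<close> on sections of \<open>G\<close>, given by the product rule
  \<open>\<xi> \<cdot> (c Y) = (\<xi> \<cdot> c) Y + c (\<xi> \<cdot> Y)\<close>; they depend only on the values of the sections at \<open>m\<close>.
\<close>

definition act_one_form ::
    "('m, 'v, 'r, 'y) lie_algebroid_scheme \<Rightarrow>
     ('m, ('m \<Rightarrow> 'v) set, 'k, 'z) lie_algebroid_scheme \<Rightarrow> 'm \<Rightarrow>
     ('m \<Rightarrow> ('m \<Rightarrow> 'v) set) set \<Rightarrow> ('m \<Rightarrow> ('m \<Rightarrow> 'v) set \<Rightarrow> 'v) \<Rightarrow>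
     ('m \<Rightarrow> ('m \<Rightarrow> 'v) set) \<Rightarrow> 'v" where
  "act_one_form T G m \<xi> c Y =
     vminus T m (ad T m (jet_proj m \<xi>) (\<lambda>p. c p (Y p))) (c m (ad G m \<xi> Y))"

definition act_two_form ::
    "('m, 'v, 'r, 'y) lie_algebroid_scheme \<Rightarrow>
     ('m, ('m \<Rightarrow> 'v) set, 'k, 'z) lie_algebroid_scheme \<Rightarrow> 'm \<Rightarrow>
     ('m \<Rightarrow> ('m \<Rightarrow> 'v) set) set \<Rightarrow> ('m \<Rightarrow> ('m \<Rightarrow> 'v) set \<Rightarrow> ('m \<Rightarrow> 'v) set \<Rightarrow> 'v) \<Rightarrow>
     ('m \<Rightarrow> ('m \<Rightarrow> 'v) set) \<Rightarrow> ('m \<Rightarrow> ('m \<Rightarrow> 'v) set) \<Rightarrow> 'v" where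
  "act_two_form T G m \<xi> c Y1 Y2 =
     vminus T m
       (vminus T m (ad T m (jet_proj m \<xi>) (\<lambda>p. c p (Y1 p) (Y2 p)))
                   (c m (ad G m \<xi> Y1) (Y2 m)))
       (c m (Y1 m) (ad G m \<xi> Y2))"

definition isotropy_one_form ::
    "('m, 'e::real_normed_vector) chart set \<Rightarrow>
     ('m, 'v, 'r, 'y) lie_algebroid_scheme \<Rightarrow>
     ('m, ('m \<Rightarrow> 'v) set, 'k::real_normed_vector, 'z) lie_algebroid_scheme \<Rightarrow>
     ('m \<Rightarrow> ('m \<Rightarrow> 'v) set \<Rightarrow> 'v) \<Rightarrow> ('m \<times> ('m \<Rightarrow> ('m \<Rightarrow> 'v) set) set) set" where
  "isotropy_one_form A T G c =
     {(m, \<xi>) \<in> jet_space A G. \<forall>Y\<in>sections A G. act_one_form T G m \<xi> c Y = vzero T m}"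

definition isotropy_two_form ::
    "('m, 'e::real_normed_vector) chart set \<Rightarrow>
     ('m, 'v, 'r, 'y) lie_algebroid_scheme \<Rightarrow>
     ('m, ('m \<Rightarrow> 'v) set, 'k::real_normed_vector, 'z) lie_algebroid_scheme \<Rightarrow>
     ('m \<Rightarrow> ('m \<Rightarrow> 'v) set \<Rightarrow> ('m \<Rightarrow> 'v) set \<Rightarrow> 'v) \<Rightarrow>
     ('m \<times> ('m \<Rightarrow> ('m \<Rightarrow> 'v) set) set) set" where
  "isotropy_two_form A T G c =
     {(m, \<xi>) \<in> jet_space A G. \<forall>Y1\<in>sections A G. \<forall>Y2\<in>sections A G.
        act_two_form T G m \<xi> c Y1 Y2 = vzero T m}"

end

theory Submission
  imports Defs
begin

text \<open>
  A section \<open>X\<close> of \<open>J\<^sup>1T\<close> with underlying section \<open>aX\<close> of \<open>T\<close> acts on sections \<open>V\<close> of \<open>T\<close> by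
  \<open>\<nabla>\<^sub>X V = ad X V\<close>, and \<open>S\<^sub>X V = \<nabla>\<^sub>X V - [aX, V]\<close> is the pairing of the anchor of \<open>V\<close> with the Spencer
  operator of \<open>X\<close>, that is, with the failure of \<open>X\<close> to equal the jet of \<open>aX\<close>. Let \<open>\<xi>\<close> be the 1-jet of
  \<open>X\<close> at \<open>m\<close>. Then \<open>(\<xi> \<cdot> a) Y = S\<^sub>X (aY)\<close> at \<open>m\<close>, so by transitivity \<open>\<xi> \<cdot> a = 0\<close> means that the
  Spencer operator of \<open>X\<close> vanishes at \<open>m\<close>. Flatness of \<open>\<nabla>\<close> and the Jacobi identity give
  \<open>(\<xi> \<cdot> da)(Y, Z) = \<nabla>\<^sub>Y S\<^sub>X (aZ) - \<nabla>\<^sub>Z S\<^sub>X (aY) - S\<^sub>X [aY, aZ]\<close>; when \<open>\<xi> \<cdot> a = 0\<close> this is the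
  antisymmetric part of the derivative of the Spencer operator at \<open>m\<close>. It vanishes exactly when the
  derivative part of \<open>X\<close> agrees to first order with that of the jet of a section of \<open>T\<close>, which may
  then be taken to be a quadratic Taylor polynomial.
\<close>

section \<open>Smooth maps between normed spaces\<close>

text \<open>Beyond the Lie algebroid axioms, the bracket of \<open>jet_algebroid\<close> is
  prescribed on holonomic sections \<open>jet A T W\<close> only. Identities that involve it, such
  as flatness and compatibility with \<open>taut\<close>, are therefore put as the vanishing of a
  defect that is linear over smooth functions, which reduces them to the holonomic case. Two
  obstacles account for most of the length. Sections, functions and brackets are global while
  coordinates are local, which is what the cutoffs and extensions are for. And \<open>ad\<close>
  acts through \<open>jet_rep\<close>, a choice made separately at each point, so even the
  smoothness of \<nabla> requires a formula free of that choice. Transitivity enters twice: the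
  anchors of sections of \<open>G\<close> at \<open>m\<close> fill the model space, so vanishing on
  them is vanishing of a linear map, and symmetry on them is symmetry of a bilinear one. Symmetry is
  the exact second condition because the value component of \<open>X\<close> contributes a second
  derivative, symmetric in any case, so that only the derivative component is constrained.\<close>

lemma frechet_derivative_eqI:
  "(f has_derivative f') (at x) \<Longrightarrow> frechet_derivative f (at x) = f'"
  by (metis frechet_derivative_at)

lemma frechet_derivative_cong_open:
  assumes "open S" "x \<in> S" "\<And>y. y \<in> S \<Longrightarrow> f y = g y"
  shows "frechet_derivative f (at x) = frechet_derivative g (at x)"
proof -
  have "(f has_derivative f') (at x) \<longleftrightarrow> (g has_derivative f') (at x)" for f'
    using assms has_derivative_transform_within_open[of f f' x UNIV S g]
      has_derivative_transform_within_open[of g f' x UNIV S f] by auto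
  then show ?thesis
    unfolding frechet_derivative_def by simp
qed

lemma differentiable_cong_open:
  assumes "open S" "x \<in> S" "\<And>y. y \<in> S \<Longrightarrow> f y = g y" "f differentiable (at x)"
  shows "g differentiable (at x)"
  using assms has_derivative_transform_within_open[of f _ x UNIV S g]
  unfolding differentiable_def by auto

lemma higher_differentiable_on_cong:
  assumes "open S" "\<And>y. y \<in> S \<Longrightarrow> f y = g y" "higher_differentiable_on S f k"
  shows "higher_differentiable_on S g k"
  using assms(2,3)
proof (induction k arbitrary: f g)
  case 0
  then show ?case using continuous_on_cong[of S S f g] by auto
next
  case (Suc k)
  then have "g differentiable (at x)" if "x \<in> S" for x
    using differentiable_cong_open[OF assms(1) that, of f g] that by auto
  moreover have "higher_differentiable_on S (\<lambda>x. frechet_derivative g (at x) v) k" for v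
  proof (rule Suc.IH)
    show "higher_differentiable_on S (\<lambda>x. frechet_derivative f (at x) v) k"
      using Suc.prems by auto
    show "frechet_derivative f (at y) v = frechet_derivative g (at y) v" if "y \<in> S" for y
      using frechet_derivative_cong_open[OF assms(1) that, of f g] Suc.prems by auto
  qed
  ultimately show ?case by auto
qed

lemma higher_differentiable_on_continuous: "higher_differentiable_on S f k \<Longrightarrow> continuous_on S f"
  by (cases k) (simp_all add: continuous_at_imp_continuous_on differentiable_imp_continuous_within)

lemma higher_differentiable_on_Suc_imp: "higher_differentiable_on S f (Suc k) \<Longrightarrow> higher_differentiable_on S f k"
proof (induction k arbitrary: f)
  case 0
  then show ?case using higher_differentiable_on_continuous[of S f "Suc 0"] by simp
next
  case (Suc k)
  then show ?case by (metis higher_differentiable_on.simps(2))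
qed

lemma higher_differentiable_on_subset: "higher_differentiable_on S f k \<Longrightarrow> R \<subseteq> S \<Longrightarrow> higher_differentiable_on R f k"
  by (induction k arbitrary: f) (auto intro: continuous_on_subset)

lemma higher_differentiable_on_local:
  assumes "\<And>x. x \<in> S \<Longrightarrow> \<exists>R. open R \<and> x \<in> R \<and> higher_differentiable_on R f k"
  shows "higher_differentiable_on S f k"
  using assms
proof (induction k arbitrary: f)
  case 0
  have "continuous (at x) f" if "x \<in> S" for x
    using 0[OF that] by (auto simp: continuous_on_eq_continuous_at)
  then show ?case by (simp add: continuous_at_imp_continuous_on)
next
  case (Suc k)
  have "f differentiable (at x)" if "x \<in> S" for x
    using Suc.prems[OF that] by auto
  moreover have "higher_differentiable_on S (\<lambda>x. frechet_derivative f (at x) v) k" for v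
    by (rule Suc.IH) (use Suc.prems in fastforce)
  ultimately show ?case by simp
qed

lemma higher_differentiable_on_const: "higher_differentiable_on S (\<lambda>x. c) k"
  by (induction k arbitrary: c) (simp_all add: frechet_derivative_const)

lemma higher_differentiable_on_add:
  assumes "open S" "higher_differentiable_on S f k" "higher_differentiable_on S g k"
  shows "higher_differentiable_on S (\<lambda>x. f x + g x) k"
  using assms(2,3)
proof (induction k arbitrary: f g)
  case 0
  then show ?case by (auto intro: continuous_on_add)
next
  case (Suc k)
  have D: "((\<lambda>x. f x + g x) has_derivative
      (\<lambda>v. frechet_derivative f (at x) v + frechet_derivative g (at x) v)) (at x)" if "x \<in> S" for x
    using Suc.prems that by (auto intro!: has_derivative_add simp: frechet_derivative_works)
  have "higher_differentiable_on S (\<lambda>x. frechet_derivative (\<lambda>x. f x + g x) (at x) v) k" for v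
    by (rule higher_differentiable_on_cong[OF assms(1) _ Suc.IH[of "\<lambda>x. frechet_derivative f (at x) v" "\<lambda>x. frechet_derivative g (at x) v"]])
      (use Suc.prems frechet_derivative_eqI[OF D] in auto)
  then show ?case using D by (auto simp: differentiable_def)
qed

lemma higher_differentiable_on_bounded_linear:
  assumes "open S" "bounded_linear h" "higher_differentiable_on S f k"
  shows "higher_differentiable_on S (\<lambda>x. h (f x)) k"
  using assms(3)
proof (induction k arbitrary: f)
  case 0
  then show ?case using bounded_linear.continuous_on[OF assms(2)] by auto
next
  case (Suc k)
  have D: "((\<lambda>x. h (f x)) has_derivative (\<lambda>v. h (frechet_derivative f (at x) v))) (at x)"
    if "x \<in> S" for x
    using Suc.prems that
    by (auto intro!: bounded_linear.has_derivative[OF assms(2)] simp: frechet_derivative_works)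
  have "higher_differentiable_on S (\<lambda>x. frechet_derivative (\<lambda>x. h (f x)) (at x) v) k" for v
    by (rule higher_differentiable_on_cong[OF assms(1) _ Suc.IH[of "\<lambda>x. frechet_derivative f (at x) v"]])
      (use Suc.prems frechet_derivative_eqI[OF D] in auto)
  then show ?case using D by (auto simp: differentiable_def)
qed

lemma higher_differentiable_on_bilinear:
  assumes "open S" "bounded_bilinear pr" "higher_differentiable_on S f k" "higher_differentiable_on S g k"
  shows "higher_differentiable_on S (\<lambda>x. pr (f x) (g x)) k"
  using assms(3,4)
proof (induction k arbitrary: f g)
  case 0
  then show ?case using bounded_bilinear.continuous_on[OF assms(2)] by auto
next
  case (Suc k)
  have D: "((\<lambda>x. pr (f x) (g x)) has_derivative
      (\<lambda>v. pr (f x) (frechet_derivative g (at x) v) + pr (frechet_derivative f (at x) v) (g x))) (at x)"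
    if "x \<in> S" for x
    using Suc.prems that
    by (auto intro!: bounded_bilinear.FDERIV[OF assms(2)] simp: frechet_derivative_works)
  have "higher_differentiable_on S (\<lambda>x. frechet_derivative (\<lambda>x. pr (f x) (g x)) (at x) v) k" for v
    by (rule higher_differentiable_on_cong[OF assms(1) _ higher_differentiable_on_add[OF assms(1) Suc.IH[of f "\<lambda>x. frechet_derivative g (at x) v"]
            Suc.IH[of "\<lambda>x. frechet_derivative f (at x) v" g]]])
      (use Suc.prems frechet_derivative_eqI[OF D] higher_differentiable_on_Suc_imp[of S f k] higher_differentiable_on_Suc_imp[of S g k] in auto)
  then show ?case using D by (auto simp: differentiable_def)
qed

lemma higher_differentiable_on_sum:
  assumes "open S" "\<And>i. i \<in> I \<Longrightarrow> higher_differentiable_on S (f i) k"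
  shows "higher_differentiable_on S (\<lambda>x. \<Sum>i\<in>I. f i x) k"
  using assms(2)
proof (induction I rule: infinite_finite_induct)
  case (insert i I)
  then show ?case using higher_differentiable_on_add[OF assms(1), of "f i" k "\<lambda>x. \<Sum>i\<in>I. f i x"] by auto
qed (auto intro: higher_differentiable_on_const)

text \<open>The model fibre of \<open>J\<^sup>1T\<close> carries no inner product, so continuity of the coordinates \<open>l\<close> is
  recorded explicitly.\<close>

definition frame :: "nat \<Rightarrow> (nat \<Rightarrow> 'a::real_normed_vector) \<Rightarrow> (nat \<Rightarrow> 'a \<Rightarrow> real) \<Rightarrow> bool" where
  "frame n b l \<longleftrightarrow> (\<forall>i<n. bounded_linear (l i)) \<and> (\<forall>x. (\<Sum>i<n. l i x *\<^sub>R b i) = x)"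

definition framed :: "'a::real_normed_vector itself \<Rightarrow> bool" where
  "framed _ \<longleftrightarrow> (\<exists>n (b::nat \<Rightarrow> 'a) l. frame n b l)"

lemma frame_bl: "frame n b l \<Longrightarrow> i < n \<Longrightarrow> bounded_linear (l i)"
  by (simp add: frame_def)

lemma frame_sum: "frame n b l \<Longrightarrow> (\<Sum>i<n. l i x *\<^sub>R b i) = x"
  by (simp add: frame_def)

text \<open>Frames are indexed by an initial segment of the naturals so that \<open>framed\<close>
  need not quantify over an index type; a bijection brings any finite index set to that
  form.\<close>

lemma framedI:
  assumes "finite I" "\<And>i. i \<in> I \<Longrightarrow> bounded_linear (l i)"
    and "\<And>x::'a::real_normed_vector. (\<Sum>i\<in>I. l i x *\<^sub>R b i) = x"
  shows "framed TYPE('a)"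
proof -
  obtain h where h: "bij_betw h {..<card I} I"
    using ex_bij_betw_nat_finite[OF assms(1)] by (auto simp: atLeast0LessThan)
  have "(\<Sum>i<card I. l (h i) x *\<^sub>R b (h i)) = x" for x
    using sum.reindex_bij_betw[OF h, of "\<lambda>i. l i x *\<^sub>R b i"] assms(3) by simp
  moreover have "bounded_linear (l (h i))" if "i < card I" for i
    using assms(2) bij_betwE[OF h] that by auto
  ultimately have "frame (card I) (\<lambda>i. b (h i)) (\<lambda>i. l (h i))"
    by (simp add: frame_def)
  then show ?thesis by (auto simp: framed_def)
qed

lemma frame_linear_expand:
  assumes "frame n b l" "linear h"
  shows "h x = (\<Sum>i<n. l i x *\<^sub>R h (b i))"
proof -
  have "h x = h (\<Sum>i<n. l i x *\<^sub>R b i)" by (simp add: frame_sum[OF assms(1)])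
  then show ?thesis
    by (simp only: linear_sum[OF assms(2)] linear_scale[OF assms(2)])
qed

text \<open>Gram-Schmidt gives a finite orthogonal spanning set. Its Fourier coefficients recover
  \<open>x\<close>, since the remainder is orthogonal to the span, which is everything, and hence to
  itself.\<close>

lemma framed_inner:
  assumes "finite_dimensional TYPE('a::real_inner)"
  shows "framed TYPE('a)"
proof -
  obtain B0 :: "'a set" where B0: "finite B0" "span B0 = UNIV"
    using assms by (auto simp: finite_dimensional_def)
  obtain C :: "'a set" where C: "finite C" "span C = UNIV" "pairwise orthogonal C"
    using basis_orthogonal[OF B0(1)] unfolding B0(2) by blast
  have eq: "(\<Sum>i\<in>C. ((x \<bullet> i) / (i \<bullet> i)) *\<^sub>R i) = x" for x
  proof -
    let ?y = "x - (\<Sum>i\<in>C. ((x \<bullet> i) / (i \<bullet> i)) *\<^sub>R i)"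
    have "orthogonal ?y c" if "c \<in> C" for c
    proof -
      \<comment> \<open>The set may contain \<open>0\<close>. For \<open>c = 0\<close> the division
        by zero gives the coefficient \<open>0\<close>, and \<open>x \<bullet> c\<close> is
        \<open>0\<close> as well.\<close>
      have "(\<Sum>i\<in>C. ((x \<bullet> i) / (i \<bullet> i)) *\<^sub>R i) \<bullet> c = (\<Sum>i\<in>C. if i = c then x \<bullet> c else 0)"
        unfolding inner_sum_left
        by (rule sum.cong) (use C(3) that in \<open>auto simp: pairwise_def orthogonal_def\<close>)
      then show ?thesis
        using C(1) that by (simp add: orthogonal_def inner_diff_left)
    qed
    moreover have "?y \<in> span C" using C(2) by simp
    ultimately have "orthogonal ?y ?y"
      using orthogonal_to_span by blast
    then show ?thesis by (simp add: orthogonal_def)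
  qed
  show ?thesis
    by (rule framedI[OF C(1) _ eq]) (rule bounded_linear_compose[OF bounded_linear_divide bounded_linear_inner_left])
qed

text \<open>Matrix units: \<open>Inl j\<close> stands for the vector \<open>(c j, 0)\<close>,
  \<open>Inr (i, j)\<close> for the rank-one operator sending \<open>v\<close> to
  \<open>l i v *\<^sub>R c j\<close>. The coordinates of an operator are its matrix entries, bounded
  because evaluation at \<open>b i\<close> is.\<close>

lemma framed_prod_blinfun:
  assumes "framed TYPE('e::real_normed_vector)" "framed TYPE('r::real_normed_vector)"
  shows "framed TYPE('r \<times> ('e \<Rightarrow>\<^sub>L 'r))"
proof -
  obtain n and b :: "nat \<Rightarrow> 'e" and l where e: "frame n b l"
    using assms(1) by (auto simp: framed_def)
  obtain m and c :: "nat \<Rightarrow> 'r" and k where r: "frame m c k"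
    using assms(2) by (auto simp: framed_def)
  define I where "I = Inl ` {..<m} \<union> Inr ` ({..<n} \<times> {..<m})"
  define L where "L = (\<lambda>z (x::'r \<times> ('e \<Rightarrow>\<^sub>L 'r)). case z of Inl j \<Rightarrow> k j (fst x)
    | Inr (i, j) \<Rightarrow> k j (blinfun_apply (snd x) (b i)))"
  define V where "V = (\<lambda>z. case z of Inl j \<Rightarrow> (c j, 0 :: 'e \<Rightarrow>\<^sub>L 'r)
    | Inr (i, j) \<Rightarrow> (0, Blinfun (\<lambda>v. l i v *\<^sub>R c j)))"
  show ?thesis
  proof (rule framedI[where I=I and l=L and b=V])
    show "finite I" by (simp add: I_def)
    show "bounded_linear (L z)" if "z \<in> I" for z
    proof (cases z)
      case (Inl j)
      then have "bounded_linear (k j)" using that r by (auto simp: I_def frame_bl)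
      from bounded_linear_compose[OF this bounded_linear_fst] show ?thesis
        using Inl by (simp add: L_def)
    next
      case (Inr ij)
      then obtain i j where ij: "z = Inr (i, j)" by (cases ij) auto
      then have "bounded_linear (k j)" using that r by (auto simp: I_def frame_bl)
      from bounded_linear_compose[OF this bounded_linear_compose[OF
            blinfun.bounded_linear_left[of "b i"] bounded_linear_snd]] show ?thesis
        using ij by (simp add: L_def)
    qed
    show "(\<Sum>z\<in>I. L z x *\<^sub>R V z) = x" for x
    proof -
      have "(\<Sum>z\<in>I. L z x *\<^sub>R V z) = (\<Sum>j<m. L (Inl j) x *\<^sub>R V (Inl j))
        + (\<Sum>ij\<in>{..<n}\<times>{..<m}. L (Inr ij) x *\<^sub>R V (Inr ij))"
        unfolding I_def by (subst sum.union_disjoint) (auto simp: sum.reindex inj_on_def)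
      moreover have "(\<Sum>j<m. L (Inl j) x *\<^sub>R V (Inl j)) = (fst x, 0)"
        using frame_sum[OF r, of "fst x"] by (auto simp: L_def V_def prod_eq_iff fst_sum snd_sum)
      moreover have "(\<Sum>ij\<in>{..<n}\<times>{..<m}. L (Inr ij) x *\<^sub>R V (Inr ij)) = (0, snd x)"
      proof (rule prod_eqI)
        show "fst (\<Sum>ij\<in>{..<n}\<times>{..<m}. L (Inr ij) x *\<^sub>R V (Inr ij)) = fst (0, snd x)"
          by (auto simp: fst_sum V_def split: prod.splits intro!: sum.neutral)
        show "snd (\<Sum>ij\<in>{..<n}\<times>{..<m}. L (Inr ij) x *\<^sub>R V (Inr ij)) = snd (0, snd x)"
        proof (rule blinfun_eqI)
          fix v
          have ap: "blinfun_apply (snd (V (Inr ij))) v = l (fst ij) v *\<^sub>R c (snd ij)"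
            if "ij \<in> {..<n}\<times>{..<m}" for ij
            using that by (auto simp: V_def bounded_linear_Blinfun_apply[OF bounded_linear_scaleR_const] frame_bl[OF e])
          have "blinfun_apply (snd (\<Sum>ij\<in>{..<n}\<times>{..<m}. L (Inr ij) x *\<^sub>R V (Inr ij))) v
            = (\<Sum>ij\<in>{..<n}\<times>{..<m}. L (Inr ij) x *\<^sub>R l (fst ij) v *\<^sub>R c (snd ij))"
            by (simp add: snd_sum blinfun.sum_left blinfun.scaleR_left ap cong: sum.cong)
          also have "\<dots> = (\<Sum>i<n. l i v *\<^sub>R (\<Sum>j<m. k j (blinfun_apply (snd x) (b i)) *\<^sub>R c j))"
            unfolding scaleR_sum_right sum.cartesian_product
            by (rule sum.cong) (auto simp: L_def mult.commute)
          also have "\<dots> = blinfun_apply (snd x) v"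
            unfolding frame_sum[OF r]
            using frame_linear_expand[OF e bounded_linear.linear[OF blinfun.bounded_linear_right], of "snd x" v] by simp
          finally show "blinfun_apply (snd (\<Sum>ij\<in>{..<n}\<times>{..<m}. L (Inr ij) x *\<^sub>R V (Inr ij))) v
            = blinfun_apply (snd (0, snd x)) v" by simp
        qed
      qed
      ultimately show ?thesis by (simp add: prod_eq_iff)
    qed
  qed
qed

section \<open>Composition and calculus of smooth maps\<close>

text \<open>Higher derivatives are controlled in fixed directions, whereas the chain rule evaluates
  the derivative of \<open>g\<close> in the moving direction
  \<open>frechet_derivative f (at x) v\<close>. Expanding that direction in a frame of the
  intermediate space leaves finitely many products to which the induction applies.\<close>

lemma higher_differentiable_on_compose:
  fixes f :: "'a::real_normed_vector \<Rightarrow> 'b::real_normed_vector"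
  assumes fr: "framed TYPE('b)" and S: "open S" and R: "open R" and sub: "f ` S \<subseteq> R"
    and "higher_differentiable_on R g k" "higher_differentiable_on S f k"
  shows "higher_differentiable_on S (\<lambda>x. g (f x)) k"
  using assms(5,6)
proof (induction k arbitrary: g)
  case 0
  then show ?case using continuous_on_compose2[of R g S f] sub by auto
next
  case (Suc k)
  obtain n and b :: "nat \<Rightarrow> 'b" and l where e: "frame n b l"
    using fr by (auto simp: framed_def)
  have D: "((\<lambda>x. g (f x)) has_derivative
      (\<lambda>v. frechet_derivative g (at (f x)) (frechet_derivative f (at x) v))) (at x)" if "x \<in> S" for x
  proof -
    have "(g has_derivative frechet_derivative g (at (f x))) (at (f x))"
      "(f has_derivative frechet_derivative f (at x)) (at x)"
      using Suc.prems that sub by (auto simp: frechet_derivative_works)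
    from diff_chain_at[OF this(2,1)] show ?thesis by (simp add: o_def)
  qed
  have "higher_differentiable_on S (\<lambda>x. frechet_derivative (\<lambda>x. g (f x)) (at x) v) k" for v
  proof (rule higher_differentiable_on_cong[OF S])
    show "higher_differentiable_on S
      (\<lambda>x. \<Sum>i<n. l i (frechet_derivative f (at x) v) *\<^sub>R frechet_derivative g (at (f x)) (b i)) k"
    proof (intro higher_differentiable_on_sum[OF S] higher_differentiable_on_bilinear[OF S bounded_bilinear_scaleR])
      fix i assume "i \<in> {..<n}"
      then show "higher_differentiable_on S (\<lambda>x. l i (frechet_derivative f (at x) v)) k"
        using higher_differentiable_on_bounded_linear[OF S, of "l i" "\<lambda>x. frechet_derivative f (at x) v" k]
          frame_bl[OF e] Suc.prems by auto
      show "higher_differentiable_on S (\<lambda>x. frechet_derivative g (at (f x)) (b i)) k"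
        using Suc.IH[of "\<lambda>x. frechet_derivative g (at x) (b i)"] Suc.prems(1)
          higher_differentiable_on_Suc_imp[OF Suc.prems(2)] by auto
    qed
    fix x assume x: "x \<in> S"
    have "linear (frechet_derivative g (at (f x)))"
      using Suc.prems x sub linear_frechet_derivative by auto
    from frame_linear_expand[OF e this, of "frechet_derivative f (at x) v"] show
      "(\<Sum>i<n. l i (frechet_derivative f (at x) v) *\<^sub>R frechet_derivative g (at (f x)) (b i))
        = frechet_derivative (\<lambda>x. g (f x)) (at x) v"
      unfolding frechet_derivative_eqI[OF D[OF x]] by (rule sym)
  qed
  then show ?case using D by (auto simp: differentiable_def)
qed

lemma smooth_on_cong: "open S \<Longrightarrow> (\<And>y. y \<in> S \<Longrightarrow> f y = g y) \<Longrightarrow> smooth_on S f \<Longrightarrow> smooth_on S g"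
  unfolding smooth_on_def using higher_differentiable_on_cong by blast

lemma smooth_on_subset: "smooth_on S f \<Longrightarrow> R \<subseteq> S \<Longrightarrow> smooth_on R f"
  unfolding smooth_on_def using higher_differentiable_on_subset by blast

lemma smooth_on_local:
  assumes "\<And>x. x \<in> S \<Longrightarrow> \<exists>R. open R \<and> x \<in> R \<and> smooth_on R f"
  shows "smooth_on S f"
  unfolding smooth_on_def
proof
  fix k
  show "higher_differentiable_on S f k"
    by (rule higher_differentiable_on_local) (use assms in \<open>auto simp: smooth_on_def\<close>)
qed

lemma smooth_on_const: "smooth_on S (\<lambda>x. c)"
  unfolding smooth_on_def using higher_differentiable_on_const by blast

lemma smooth_on_bounded_linear:
  "open S \<Longrightarrow> bounded_linear h \<Longrightarrow> smooth_on S f \<Longrightarrow> smooth_on S (\<lambda>x. h (f x))"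
  unfolding smooth_on_def using higher_differentiable_on_bounded_linear by blast

lemma smooth_on_bilinear:
  "open S \<Longrightarrow> bounded_bilinear pr \<Longrightarrow> smooth_on S f \<Longrightarrow> smooth_on S g \<Longrightarrow> smooth_on S (\<lambda>x. pr (f x) (g x))"
  unfolding smooth_on_def using higher_differentiable_on_bilinear by blast

lemma smooth_on_add: "open S \<Longrightarrow> smooth_on S f \<Longrightarrow> smooth_on S g \<Longrightarrow> smooth_on S (\<lambda>x. f x + g x)"
  unfolding smooth_on_def using higher_differentiable_on_add by blast

lemma smooth_on_compose:
  fixes f :: "'a::real_normed_vector \<Rightarrow> 'b::real_normed_vector"
  assumes "framed TYPE('b)" "open S" "open R" "f ` S \<subseteq> R" "smooth_on R g" "smooth_on S f"
  shows "smooth_on S (\<lambda>x. g (f x))"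
  using assms higher_differentiable_on_compose unfolding smooth_on_def by blast

lemma smooth_on_differentiable: "smooth_on S f \<Longrightarrow> x \<in> S \<Longrightarrow> f differentiable (at x)"
  unfolding smooth_on_def by (metis higher_differentiable_on.simps(2))

lemma smooth_on_frechet: "smooth_on S f \<Longrightarrow> smooth_on S (\<lambda>x. frechet_derivative f (at x) v)"
  unfolding smooth_on_def by (metis higher_differentiable_on.simps(2))

lemma smooth_on_has_derivative:
  "smooth_on S f \<Longrightarrow> x \<in> S \<Longrightarrow> (f has_derivative frechet_derivative f (at x)) (at x)"
  using smooth_on_differentiable frechet_derivative_works by blast

lemma smooth_on_continuous: "smooth_on S f \<Longrightarrow> continuous_on S f"
  unfolding smooth_on_def by (metis higher_differentiable_on.simps(1))

lemma smooth_on_id: "open S \<Longrightarrow> smooth_on S (\<lambda>x. x)"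
proof -
  assume S: "open S"
  have "higher_differentiable_on S (\<lambda>x. x) k" for k
    by (cases k) (auto simp: frechet_derivative_eqI[OF has_derivative_ident] higher_differentiable_on_const)
  then show ?thesis by (simp add: smooth_on_def)
qed

section \<open>Symmetry of second derivatives\<close>

text \<open>The second difference is the increment over \<open>[0, h]\<close> of
  \<open>\<phi>\<close>, the difference of \<open>f\<close> along two parallel segments in direction
  \<open>a\<close>. One use of the mean value theorem for \<open>\<phi>\<close> and one for the
  derivative along \<open>b\<close> produce \<open>p\<close>; the bound on \<open>h\<close> keeps
  the parallelogram in the ball.\<close>

lemma mvt_double_difference:
  fixes f :: "'a::real_normed_vector \<Rightarrow> real"
  assumes f: "smooth_on S f" and sub: "ball x \<delta> \<subseteq> S" and h: "0 < h" "h * (norm a + norm b) < \<delta>"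
  shows "\<exists>p\<in>ball x \<delta>. f (x + h *\<^sub>R a + h *\<^sub>R b) - f (x + h *\<^sub>R a) - f (x + h *\<^sub>R b) + f x
    = h * (h * frechet_derivative (\<lambda>y. frechet_derivative f (at y) a) (at p) b)"
proof -
  have inball: "x + s *\<^sub>R a + t *\<^sub>R b \<in> ball x \<delta>" if "0 \<le> s" "s \<le> h" "0 \<le> t" "t \<le> h" for s t
  proof -
    have "norm (s *\<^sub>R a + t *\<^sub>R b) \<le> s * norm a + t * norm b"
      using norm_triangle_ineq[of "s *\<^sub>R a" "t *\<^sub>R b"] that by simp
    also have "\<dots> \<le> h * norm a + h * norm b"
      using that by (intro add_mono mult_right_mono) auto
    finally have "norm (s *\<^sub>R a + t *\<^sub>R b) < \<delta>" using h(2) by (simp add: algebra_simps)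
    moreover have "dist x (x + s *\<^sub>R a + t *\<^sub>R b) = norm (s *\<^sub>R a + t *\<^sub>R b)"
      by (metis add.assoc add_diff_cancel_left' dist_commute dist_norm)
    ultimately show ?thesis by simp
  qed
  have line: "((\<lambda>s. g (y + s *\<^sub>R v)) has_real_derivative frechet_derivative g (at (y + s *\<^sub>R v)) v) (at s)"
    if g: "smooth_on S g" and "y + s *\<^sub>R v \<in> S" for g :: "'a \<Rightarrow> real" and y v s
  proof -
    have "((\<lambda>s. y + s *\<^sub>R v) has_derivative (\<lambda>u. u *\<^sub>R v)) (at s)"
      by (auto intro!: derivative_eq_intros)
    from diff_chain_at[OF this smooth_on_has_derivative[OF that]]
    have "((\<lambda>s. g (y + s *\<^sub>R v)) has_derivative (\<lambda>u. frechet_derivative g (at (y + s *\<^sub>R v)) (u *\<^sub>R v))) (at s)"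
      by (simp add: o_def)
    moreover have "frechet_derivative g (at (y + s *\<^sub>R v)) (u *\<^sub>R v) = u * frechet_derivative g (at (y + s *\<^sub>R v)) v" for u
      using linear_scale[OF linear_frechet_derivative[OF smooth_on_differentiable[OF that]]] by simp
    ultimately show ?thesis by (simp add: has_field_derivative_def mult_commute_abs)
  qed
  define \<phi> where "\<phi> s = f ((x + h *\<^sub>R b) + s *\<^sub>R a) - f (x + s *\<^sub>R a)" for s
  have "(\<phi> has_real_derivative frechet_derivative f (at ((x + h *\<^sub>R b) + s *\<^sub>R a)) a
      - frechet_derivative f (at (x + s *\<^sub>R a)) a) (at s)" if "0 \<le> s" "s \<le> h" for s
    unfolding \<phi>_def using inball[of s h] inball[of s 0] that sub h(1)
    by (intro DERIV_diff line[OF f]) (auto simp: add_ac)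
  from MVT2[OF h(1) this] obtain \<sigma> where \<sigma>: "0 < \<sigma>" "\<sigma> < h"
    "\<phi> h - \<phi> 0 = h * (frechet_derivative f (at ((x + h *\<^sub>R b) + \<sigma> *\<^sub>R a)) a
      - frechet_derivative f (at (x + \<sigma> *\<^sub>R a)) a)" by auto
  define \<psi> where "\<psi> t = frechet_derivative f (at ((x + \<sigma> *\<^sub>R a) + t *\<^sub>R b)) a" for t
  have "(\<psi> has_real_derivative frechet_derivative (\<lambda>y. frechet_derivative f (at y) a)
      (at ((x + \<sigma> *\<^sub>R a) + t *\<^sub>R b)) b) (at t)" if "0 \<le> t" "t \<le> h" for t
    unfolding \<psi>_def using inball[of \<sigma> t] that sub \<sigma>
    by (intro line[OF smooth_on_frechet[OF f]]) auto
  from MVT2[OF h(1) this] obtain \<tau> where \<tau>: "0 < \<tau>" "\<tau> < h"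
    "\<psi> h - \<psi> 0 = h * frechet_derivative (\<lambda>y. frechet_derivative f (at y) a)
      (at ((x + \<sigma> *\<^sub>R a) + \<tau> *\<^sub>R b)) b" by auto
  have "f (x + h *\<^sub>R a + h *\<^sub>R b) - f (x + h *\<^sub>R a) - f (x + h *\<^sub>R b) + f x = \<phi> h - \<phi> 0"
    by (simp add: \<phi>_def add_ac)
  also have "\<dots> = h * (\<psi> h - \<psi> 0)" using \<sigma>(3) by (simp add: \<psi>_def add_ac)
  finally show ?thesis using \<tau>(3) inball[of \<sigma> \<tau>] \<sigma> \<tau> by auto
qed

text \<open>The second difference does not change when \<open>a\<close> and \<open>b\<close> are
  swapped, so it is \<open>h * h\<close> times either mixed derivative at suitable points near
  \<open>x\<close>. Continuity of both carries the equality to \<open>x\<close>.\<close>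

lemma frechet_derivative_symmetric_real:
  fixes f :: "'a::real_normed_vector \<Rightarrow> real"
  assumes S: "open S" "x \<in> S" and f: "smooth_on S f"
  shows "frechet_derivative (\<lambda>y. frechet_derivative f (at y) a) (at x) b
    = frechet_derivative (\<lambda>y. frechet_derivative f (at y) b) (at x) a"
proof (rule ccontr)
  define P where "P a b = (\<lambda>x. frechet_derivative (\<lambda>y. frechet_derivative f (at y) a) (at x) b)" for a b
  assume "\<not> ?thesis"
  then have ne: "P a b x \<noteq> P b a x" by (simp add: P_def)
  \<comment> \<open>Half the gap: two errors below \<open>\<epsilon>\<close> cannot bridge
    it.\<close>
  define \<epsilon> where "\<epsilon> = \<bar>P a b x - P b a x\<bar> / 2"
  have \<epsilon>: "\<epsilon> > 0" using ne by (simp add: \<epsilon>_def)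
  have c: "isCont (P a b) x" for a b
    using smooth_on_continuous[OF smooth_on_frechet[OF smooth_on_frechet[OF f, of a], of b]] S
    by (simp add: P_def continuous_on_eq_continuous_at)
  have "\<exists>\<delta>>0. \<forall>y. dist y x < \<delta> \<longrightarrow> dist (P a b y) (P a b x) < \<epsilon>" for a b
    using c[of a b] \<epsilon> unfolding continuous_at dist_norm LIM_eq isCont_def
    by (metis (no_types, lifting) diff_self norm_zero)
  then obtain \<delta>1 \<delta>2 where \<delta>: "\<delta>1 > 0" "\<And>y. dist y x < \<delta>1 \<Longrightarrow> dist (P a b y) (P a b x) < \<epsilon>"
    "\<delta>2 > 0" "\<And>y. dist y x < \<delta>2 \<Longrightarrow> dist (P b a y) (P b a x) < \<epsilon>" by metis
  obtain \<delta>3 where \<delta>3: "\<delta>3 > 0" "ball x \<delta>3 \<subseteq> S" using S open_contains_ball by blast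
  define d where "d = min \<delta>1 (min \<delta>2 \<delta>3)"
  have d: "d > 0" "ball x d \<subseteq> S" using \<delta> \<delta>3 by (auto simp: d_def)
  \<comment> \<open>The \<open>+ 1\<close> keeps the denominator positive even if \<open>a\<close>
    and \<open>b\<close> are both \<open>0\<close>.\<close>
  define h where "h = d / (2 * (norm a + norm b + 1))"
  have pos: "norm a + norm b + 1 > 0" by (simp add: add_nonneg_pos)
  have h: "h > 0" using d pos by (simp add: h_def)
  have "h * (norm a + norm b + 1) = d / 2" using pos by (simp add: h_def field_simps)
  then have h2: "h * (norm a + norm b) < d" using h d(1) by (simp add: algebra_simps)
  obtain p where p: "p \<in> ball x d" "f (x + h *\<^sub>R a + h *\<^sub>R b) - f (x + h *\<^sub>R a) - f (x + h *\<^sub>R b) + f x = h * (h * P a b p)"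
    using mvt_double_difference[OF f d(2) h h2] by (auto simp: P_def)
  have "h * (norm b + norm a) < d" using h2 by (simp add: add.commute)
  then obtain q where q: "q \<in> ball x d" "f (x + h *\<^sub>R b + h *\<^sub>R a) - f (x + h *\<^sub>R b) - f (x + h *\<^sub>R a) + f x = h * (h * P b a q)"
    using mvt_double_difference[OF f d(2) h, of b a] by (auto simp: P_def)
  have e: "x + h *\<^sub>R b + h *\<^sub>R a = x + h *\<^sub>R a + h *\<^sub>R b" by (simp add: add_ac)
  have "h * (h * P a b p) = h * (h * P b a q)" using p(2) q(2) unfolding e by linarith
  then have "P a b p = P b a q" using h by simp
  moreover have "dist (P a b p) (P a b x) < \<epsilon>" "dist (P b a q) (P b a x) < \<epsilon>"
    using \<delta> p(1) q(1) by (auto simp: d_def dist_commute)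
  ultimately have "dist (P a b x) (P b a x) < \<epsilon> + \<epsilon>"
    using dist_triangle2[of "P a b x" "P b a x" "P a b p"] by (simp add: dist_commute)
  then show False using \<epsilon>_def by (simp add: dist_real_def)
qed

lemma frechet_derivative_bounded_linear:
  assumes "bounded_linear h" "f differentiable (at x)"
  shows "frechet_derivative (\<lambda>x. h (f x)) (at x) = (\<lambda>v. h (frechet_derivative f (at x) v))"
  using assms
  by (intro frechet_derivative_eqI bounded_linear.has_derivative[OF assms(1), of f])
    (simp add: frechet_derivative_works)

text \<open>The real case applies to each coordinate \<open>l i (f z)\<close> in a frame of the
  target; coordinates are bounded linear and so commute with differentiation.\<close>

lemma frechet_derivative_symmetric:
  fixes f :: "'a::real_normed_vector \<Rightarrow> 'b::real_normed_vector"
  assumes fr: "framed TYPE('b)" and S: "open S" "x \<in> S" and f: "smooth_on S f"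
  shows "frechet_derivative (\<lambda>y. frechet_derivative f (at y) a) (at x) b
    = frechet_derivative (\<lambda>y. frechet_derivative f (at y) b) (at x) a"
proof -
  obtain n and c :: "nat \<Rightarrow> 'b" and l where e: "frame n c l"
    using fr by (auto simp: framed_def)
  have lf: "l i (frechet_derivative (\<lambda>y. frechet_derivative f (at y) a) (at x) b)
     = frechet_derivative (\<lambda>y. frechet_derivative (\<lambda>z. l i (f z)) (at y) a) (at x) b" if "i < n" for i a b
  proof -
    have bl: "bounded_linear (l i)" using frame_bl[OF e that] .
    have "frechet_derivative (\<lambda>y. frechet_derivative (\<lambda>z. l i (f z)) (at y) a) (at x)
      = frechet_derivative (\<lambda>y. l i (frechet_derivative f (at y) a)) (at x)"
      by (rule frechet_derivative_cong_open[OF S])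
        (simp add: frechet_derivative_bounded_linear[OF bl] smooth_on_differentiable[OF f])
    then show ?thesis
      using frechet_derivative_bounded_linear[OF bl smooth_on_differentiable[OF smooth_on_frechet[OF f] S(2)]]
      by simp
  qed
  have "l i (frechet_derivative (\<lambda>y. frechet_derivative f (at y) a) (at x) b)
    = l i (frechet_derivative (\<lambda>y. frechet_derivative f (at y) b) (at x) a)" if "i < n" for i
    unfolding lf[OF that]
    by (rule frechet_derivative_symmetric_real[OF S smooth_on_bounded_linear[OF S(1) frame_bl[OF e that] f]])
  then have "(\<Sum>i<n. l i (frechet_derivative (\<lambda>y. frechet_derivative f (at y) a) (at x) b) *\<^sub>R c i)
    = (\<Sum>i<n. l i (frechet_derivative (\<lambda>y. frechet_derivative f (at y) b) (at x) a) *\<^sub>R c i)" by simp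
  then show ?thesis unfolding frame_sum[OF e] .
qed

section \<open>Smooth cutoff functions and compact balls\<close>

text \<open>\<open>flat 0\<close> is the classical flat function. The powers of
  \<open>inverse t\<close> are what differentiation produces; with them the family is closed under
  derivatives up to linear combinations.\<close>

definition flat :: "nat \<Rightarrow> real \<Rightarrow> real" where
  "flat n t = (if t > 0 then inverse t ^ n * exp (- inverse t) else 0)"

text \<open>On the right, substituting \<open>inverse t\<close> reduces the limit to the decay of
  \<open>x ^ n / exp x\<close> at infinity; on the left the function is \<open>0\<close>.\<close>

lemma flat_tendsto_0: "(flat n \<longlongrightarrow> 0) (at 0)"
proof -
  have "((\<lambda>x::real. x ^ n / exp x) \<longlongrightarrow> 0) at_top" by (rule tendsto_power_div_exp_0)
  from filterlim_compose[OF this filterlim_inverse_at_top_right]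
  have "((\<lambda>t::real. inverse t ^ n / exp (inverse t)) \<longlongrightarrow> 0) (at_right 0)" .
  then have "(flat n \<longlongrightarrow> 0) (at_right 0)"
    by (rule tendsto_cong[THEN iffD1, rotated])
      (auto simp: flat_def eventually_at_right_field exp_minus field_simps intro!: exI[of _ 1])
  moreover have "(flat n \<longlongrightarrow> 0) (at_left 0)"
    by (rule tendsto_eventually) (auto simp: flat_def eventually_at_left_field intro!: exI[of _ "-1"])
  ultimately show ?thesis by (simp add: filterlim_at_split)
qed

lemma flat_deriv:
  "(flat n has_real_derivative flat (n + 2) t - real n * flat (n + 1) t) (at t)"
proof -
  consider "t > 0" | "t < 0" | "t = 0" by linarith
  then show ?thesis
  proof cases
    case 1
    have "((\<lambda>t. inverse t ^ n * exp (- inverse t)) has_real_derivative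
        flat (n + 2) t - real n * flat (n + 1) t) (at t)"
    proof (cases n)
      case 0
      then show ?thesis using 1
        by (auto intro!: derivative_eq_intros simp: flat_def power2_eq_square)
    next
      case (Suc k)
      then show ?thesis using 1
        by (auto intro!: derivative_eq_intros simp: flat_def power2_eq_square algebra_simps split: nat.splits)
          (cases k; simp)
    qed
    then show ?thesis
      by (rule has_field_derivative_transform_within_open[where S="{0<..}"]) (use 1 in \<open>auto simp: flat_def\<close>)
  next
    case 2
    have "((\<lambda>t. 0) has_real_derivative flat (n + 2) t - real n * flat (n + 1) t) (at t)"
      using 2 by (simp add: flat_def)
    then show ?thesis
      by (rule has_field_derivative_transform_within_open[where S="{..<0}"]) (use 2 in \<open>auto simp: flat_def\<close>)
  next
    case 3
    \<comment> \<open>At \<open>0\<close> the difference quotient of \<open>flat n\<close> is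
      exactly \<open>flat (n + 1)\<close>, whose limit is known.\<close>
    have "((\<lambda>h. (flat n (0 + h) - flat n 0) / h) \<longlongrightarrow> 0) (at 0)"
    proof (rule Lim_transform_eventually[OF flat_tendsto_0[of "n + 1"]])
      show "\<forall>\<^sub>F h in at 0. flat (n + 1) h = (flat n (0 + h) - flat n 0) / h"
        by (rule always_eventually) (auto simp: flat_def field_simps)
    qed
    then show ?thesis using 3 by (simp add: DERIV_def flat_def)
  qed
qed

lemma smooth_flat: "smooth_on UNIV (flat n)"
proof -
  have D: "(flat n has_derivative (\<lambda>v. v * (flat (n + 2) t + (- real n) * flat (n + 1) t))) (at t)" for n t
    using flat_deriv[of n t] by (simp add: has_field_derivative_def mult_commute_abs)
  have "higher_differentiable_on UNIV (flat n) k" for k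
  proof (induction k arbitrary: n)
    case 0
    have "continuous_on UNIV (flat n)"
      using flat_deriv DERIV_isCont by (intro continuous_at_imp_continuous_on) blast
    then show ?case by simp
  next
    case (Suc k)
    have "higher_differentiable_on UNIV (\<lambda>x. v * (flat (n + 2) x + (- real n) * flat (n + 1) x)) k" for v
      by (intro higher_differentiable_on_add higher_differentiable_on_bounded_linear[OF _ bounded_linear_mult_right]) (use Suc in auto)
    then show ?case
      using D[of n] by (auto simp: frechet_derivative_eqI[OF D] differentiable_def)
  qed
  then show ?thesis by (simp add: smooth_on_def)
qed

lemma framed_real: "framed TYPE(real)"
  by (rule framedI[of "{()}" "\<lambda>_ x. x" "\<lambda>_. 1"]) (auto intro: bounded_linear_ident)

text \<open>With \<open>c = flat 0 1\<close> and \<open>s\<close> equal to the squared distance over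
  the square of \<open>r\<close>, minus \<open>1\<close>, \<open>\<theta>\<close> is
  \<open>flat 0 (c - flat 0 s) / flat 0 c\<close>. Up to radius \<open>r\<close>,
  \<open>s \<le> 0\<close> makes the inner value \<open>0\<close>; from radius \<open>2 * r\<close>
  on, \<open>s \<ge> 1\<close> makes it at least \<open>c\<close>, so the outer argument is not
  positive. The squared distance is smooth since it comes from an inner product.\<close>

lemma smooth_cutoff:
  fixes x0 :: "'a::real_inner"
  assumes r: "r > 0"
  obtains \<theta> :: "'a \<Rightarrow> real" where "smooth_on UNIV \<theta>"
    and "\<And>x. dist x0 x \<le> r \<Longrightarrow> \<theta> x = 1" and "\<And>x. dist x0 x \<ge> 2 * r \<Longrightarrow> \<theta> x = 0"
proof -
  let ?c = "flat 0 1"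
  have c: "?c > 0" "flat 0 ?c > 0" by (auto simp: flat_def)
  define \<theta> :: "'a \<Rightarrow> real" where
    "\<theta> x = flat 0 (?c + (- 1) *\<^sub>R flat 0 ((1 / r\<^sup>2) *\<^sub>R ((x + - x0) \<bullet> (x + - x0)) + - 1)) / flat 0 ?c" for x
  have comp: "smooth_on UNIV (\<lambda>x. flat 0 (g x))" if "smooth_on UNIV g" for g :: "'a \<Rightarrow> real"
    using smooth_on_compose[OF framed_real open_UNIV open_UNIV _ smooth_flat that] by simp
  have sc: "smooth_on UNIV (\<lambda>x. k *\<^sub>R g x)" if "smooth_on UNIV g" for g :: "'a \<Rightarrow> real" and k
    by (rule smooth_on_bounded_linear[OF open_UNIV bounded_linear_scaleR_right that])
  have tr: "smooth_on UNIV (\<lambda>x::'a. x + - x0)"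
    by (rule smooth_on_add[OF open_UNIV smooth_on_id[OF open_UNIV] smooth_on_const])
  have "smooth_on UNIV (\<lambda>x. (1 / r\<^sup>2) *\<^sub>R ((x + - x0) \<bullet> (x + - x0)) + - 1)"
    by (rule smooth_on_add[OF open_UNIV sc[OF smooth_on_bilinear[OF open_UNIV bounded_bilinear_inner tr tr]]
          smooth_on_const])
  from smooth_on_bounded_linear[OF open_UNIV bounded_linear_divide
      comp[OF smooth_on_add[OF open_UNIV smooth_on_const sc[OF comp[OF this]]]]]
  have "smooth_on UNIV \<theta>" unfolding \<theta>_def .
  moreover have "\<theta> x = 1" if "dist x0 x \<le> r" for x
  proof -
    have "(x - x0) \<bullet> (x - x0) \<le> r\<^sup>2"
      using that by (simp add: dist_norm norm_minus_commute power2_norm_eq_inner[symmetric] power_mono)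
    then have "(1 / r\<^sup>2) * ((x - x0) \<bullet> (x - x0)) - 1 \<le> 0" using r by (simp add: field_simps)
    then have "flat 0 ((1 / r\<^sup>2) * ((x - x0) \<bullet> (x - x0)) - 1) = 0" by (simp add: flat_def)
    then show ?thesis using c by (simp add: \<theta>_def)
  qed
  moreover have "\<theta> x = 0" if "dist x0 x \<ge> 2 * r" for x
  proof -
    have "(2 * r)\<^sup>2 \<le> (dist x0 x)\<^sup>2" using that r by (intro power_mono) auto
    then have "4 * r\<^sup>2 \<le> (x - x0) \<bullet> (x - x0)"
      by (simp add: dist_norm norm_minus_commute power2_norm_eq_inner[symmetric] power_mult_distrib)
    then have "4 \<le> ((x - x0) \<bullet> (x - x0)) / r\<^sup>2" using r by (simp add: pos_le_divide_eq)
    then have s: "(1 / r\<^sup>2) * ((x - x0) \<bullet> (x - x0)) - 1 \<ge> 1" by simp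
    have "flat 0 s \<ge> ?c" if "s \<ge> 1" for s
      using that by (auto simp: flat_def inverse_le_1_iff)
    from this[OF s] show ?thesis by (simp add: \<theta>_def flat_def[of 0 "_ - _"])
  qed
  ultimately show ?thesis using that by blast
qed

text \<open>Bounded coordinates confine the ball to a box \<open>C K n\<close>. The box is built up
  as a sum of compact segments, so it is compact, and the ball is a closed subset of it.\<close>

lemma compact_cball_framed:
  fixes x0 :: "'a::real_normed_vector"
  assumes "framed TYPE('a)"
  shows "compact (cball x0 r)"
proof -
  obtain n and b :: "nat \<Rightarrow> 'a" and l where e: "frame n b l"
    using assms by (auto simp: framed_def)
  define C where "C K m = {\<Sum>i<m. c i *\<^sub>R b i | c. \<forall>i<m. \<bar>c i\<bar> \<le> (K i::real)}" for K :: "nat \<Rightarrow> real" and m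
  have compact_C: "compact (C K m)" for K m
  proof (induction m)
    case 0
    have "C K 0 = {0}" by (auto simp: C_def)
    then show ?case by simp
  next
    case (Suc m)
    have "C K (Suc m) = {x + y | x y. x \<in> C K m \<and> y \<in> (\<lambda>t. t *\<^sub>R b m) ` {- K m..K m}}" (is "_ = ?R")
    proof
      show "C K (Suc m) \<subseteq> ?R"
      proof
        fix z assume "z \<in> C K (Suc m)"
        then obtain c where c: "\<forall>i<Suc m. \<bar>c i\<bar> \<le> K i" "z = (\<Sum>i<m. c i *\<^sub>R b i) + c m *\<^sub>R b m"
          by (auto simp: C_def)
        then have "(\<Sum>i<m. c i *\<^sub>R b i) \<in> C K m" "- K m \<le> c m" "c m \<le> K m"
          by (auto simp: C_def abs_le_iff minus_le_iff)
        then show "z \<in> ?R" unfolding c(2)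
          by (intro CollectI exI[of _ "\<Sum>i<m. c i *\<^sub>R b i"] exI[of _ "c m *\<^sub>R b m"]) auto
      qed
      show "?R \<subseteq> C K (Suc m)"
      proof
        fix z assume "z \<in> ?R"
        then obtain c t where ct: "\<forall>i<m. \<bar>c i\<bar> \<le> K i" "- K m \<le> t" "t \<le> K m"
          "z = (\<Sum>i<m. c i *\<^sub>R b i) + t *\<^sub>R b m" by (auto simp: C_def)
        then have "z = (\<Sum>i<Suc m. (c(m := t)) i *\<^sub>R b i)" by simp
        moreover have "\<forall>i<Suc m. \<bar>(c(m := t)) i\<bar> \<le> K i"
          using ct by (auto simp: less_Suc_eq abs_le_iff)
        ultimately show "z \<in> C K (Suc m)" unfolding C_def by blast
      qed
    qed
    moreover have "compact ((\<lambda>t. t *\<^sub>R b m) ` {- K m..K m})"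
      by (intro compact_continuous_image continuous_intros compact_Icc)
    ultimately show ?case using compact_sums[OF Suc] by simp
  qed
  define K where "K i = onorm (l i) * r + \<bar>l i x0\<bar>" for i
  have "cball x0 r \<subseteq> C K n"
  proof
    fix x assume x: "x \<in> cball x0 r"
    have "\<bar>l i x\<bar> \<le> K i" if "i < n" for i
    proof -
      interpret bounded_linear "l i" using frame_bl[OF e that] .
      have "\<bar>l i (x - x0)\<bar> \<le> onorm (l i) * norm (x - x0)"
        using onorm[OF bounded_linear_axioms, of "x - x0"] by simp
      also have "\<dots> \<le> onorm (l i) * r"
        using x by (intro mult_left_mono onorm_pos_le bounded_linear_axioms)
          (auto simp: dist_norm norm_minus_commute)
      finally show ?thesis by (simp add: K_def diff)
    qed
    then show "x \<in> C K n" unfolding C_def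
      using frame_sum[OF e, of x] by (auto intro!: exI[of _ "\<lambda>i. l i x"])
  qed
  then have "cball x0 r = C K n \<inter> cball x0 r" by auto
  then show ?thesis using compact_Int_closed[OF compact_C closed_cball] by metis
qed

section \<open>Smooth maps on manifolds\<close>

text \<open>Counterpart of \<open>dir_deriv\<close> for vector-valued functions that need be smooth
  only near \<open>p\<close>; tangent vectors enter through their coordinates in the model
  space.\<close>

definition chart_deriv ::
    "('m, 'e::real_normed_vector) chart \<Rightarrow> ('m \<Rightarrow> 'b::real_normed_vector) \<Rightarrow> 'm \<Rightarrow> 'e \<Rightarrow> 'b" where
  "chart_deriv c f p = frechet_derivative (\<lambda>x. f (inv_into (fst c) (snd c) x)) (at (snd c p))"

lemma dir_deriv_eq: "dir_deriv A c p v f = (if smooth_map A UNIV f then chart_deriv c f p v else 0)"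
  by (simp add: dir_deriv_def chart_deriv_def split_beta)

locale manifold =
  fixes A :: "('m::{t2_space,second_countable_topology}, 'e::real_inner) chart set"
  assumes mfd: "smooth_manifold A"
begin

lemma framed_e: "framed TYPE('e)"
  using mfd framed_inner by (auto simp: smooth_manifold_def)

lemma chart_at: obtains V \<kappa> where "(V, \<kappa>) \<in> A" "p \<in> V"
proof -
  have "p \<in> \<Union>(fst ` A)" using mfd by (simp add: smooth_manifold_def)
  then show ?thesis using that by auto
qed

lemma chart_facts:
  assumes "(V, \<kappa>) \<in> A"
  shows "open V" and "open (\<kappa> ` V)" and "homeomorphism V (\<kappa> ` V) \<kappa> (inv_into V \<kappa>)"
  using assms mfd unfolding smooth_manifold_def by auto

lemma chart_inv: "(V, \<kappa>) \<in> A \<Longrightarrow> p \<in> V \<Longrightarrow> inv_into V \<kappa> (\<kappa> p) = p"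
  using chart_facts(3) by (auto simp: homeomorphism_def)

lemma chart_inv_in: "x \<in> \<kappa> ` (V \<inter> W) \<Longrightarrow> (V, \<kappa>) \<in> A \<Longrightarrow>
   inv_into V \<kappa> x \<in> V \<and> inv_into V \<kappa> x \<in> W \<and> \<kappa> (inv_into V \<kappa> x) = x"
  using chart_inv by auto

lemma chart_cont: "(V, \<kappa>) \<in> A \<Longrightarrow> continuous_on V \<kappa>"
  using chart_facts(3) by (auto simp: homeomorphism_def)

lemma chart_open:
  assumes c: "(V, \<kappa>) \<in> A" and "open W"
  shows "open (\<kappa> ` (V \<inter> W))"
proof -
  have "openin (top_of_set V) (V \<inter> W)" using assms chart_facts(1)[OF c] by (simp add: openin_open_eq open_Int)
  then have "openin (top_of_set (\<kappa> ` V)) (\<kappa> ` (V \<inter> W))"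
    using homeomorphism_imp_open_map[OF chart_facts(3)[OF c]] by blast
  then show ?thesis using chart_facts(2)[OF c] openin_open_eq by blast
qed

lemma smooth_mapD: "smooth_map A W f \<Longrightarrow> (V, \<kappa>) \<in> A \<Longrightarrow> smooth_on (\<kappa> ` (V \<inter> W)) (\<lambda>x. f (inv_into V \<kappa> x))"
  by (auto simp: smooth_map_def)

lemma smooth_map_const: "smooth_map A W (\<lambda>_. c)"
  by (auto simp: smooth_map_def intro: smooth_on_const)

lemma smooth_map_add: "open W \<Longrightarrow> smooth_map A W f \<Longrightarrow> smooth_map A W g \<Longrightarrow> smooth_map A W (\<lambda>p. f p + g p)"
  unfolding smooth_map_def by (auto intro!: smooth_on_add chart_open)

lemma smooth_map_bl: "open W \<Longrightarrow> bounded_linear h \<Longrightarrow> smooth_map A W f \<Longrightarrow> smooth_map A W (\<lambda>p. h (f p))"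
  unfolding smooth_map_def using smooth_on_bounded_linear[OF chart_open] by fastforce

lemma smooth_map_bilinear: "open W \<Longrightarrow> bounded_bilinear pr \<Longrightarrow> smooth_map A W f \<Longrightarrow> smooth_map A W g \<Longrightarrow>
    smooth_map A W (\<lambda>p. pr (f p) (g p))"
  unfolding smooth_map_def using smooth_on_bilinear[OF chart_open] by fastforce

lemmas smooth_map_scaleR = smooth_map_bilinear[OF _ bounded_bilinear_scaleR]
lemmas smooth_map_mult = smooth_map_bilinear[OF _ bounded_bilinear_mult]

lemma smooth_map_minus: "open W \<Longrightarrow> smooth_map A W f \<Longrightarrow> smooth_map A W g \<Longrightarrow> smooth_map A W (\<lambda>p. f p - g p)"
  unfolding diff_conv_add_uminus
  by (rule smooth_map_add[OF _ _ smooth_map_bl[OF _ bounded_linear_minus[OF bounded_linear_ident]]])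

lemma smooth_map_sum: "open W \<Longrightarrow> (\<And>i. i \<in> I \<Longrightarrow> smooth_map A W (f i)) \<Longrightarrow> smooth_map A W (\<lambda>p. \<Sum>i\<in>I. f i p)"
proof (induction I rule: infinite_finite_induct)
  case (insert i I)
  then show ?case using smooth_map_add[of W "f i" "\<lambda>p. \<Sum>i\<in>I. f i p"] by simp
qed (auto intro: smooth_map_const)

lemma smooth_map_cong: "open W \<Longrightarrow> (\<And>p. p \<in> W \<Longrightarrow> f p = g p) \<Longrightarrow> smooth_map A W f \<Longrightarrow> smooth_map A W g"
  unfolding smooth_map_def
proof clarify
  fix V \<kappa>
  assume a: "open W" "\<And>p. p \<in> W \<Longrightarrow> f p = g p" and c: "(V, \<kappa>) \<in> A"
    and f: "\<forall>(V, \<kappa>)\<in>A. smooth_on (\<kappa> ` (V \<inter> W)) (\<lambda>x. f (inv_into V \<kappa> x))"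
  have "smooth_on (\<kappa> ` (V \<inter> W)) (\<lambda>x. f (inv_into V \<kappa> x))" using f c by blast
  then show "smooth_on (\<kappa> ` (V \<inter> W)) (\<lambda>x. g (inv_into V \<kappa> x))"
    by (rule smooth_on_cong[OF chart_open[OF c a(1)], rotated]) (auto simp: chart_inv[OF c] a(2))
qed

lemma smooth_map_subset: "smooth_map A W f \<Longrightarrow> W' \<subseteq> W \<Longrightarrow> smooth_map A W' f"
  unfolding smooth_map_def
  by (clarify, rule smooth_on_subset[of "_ ` (_ \<inter> W)"]) auto

lemma smooth_map_local:
  assumes "\<And>p. p \<in> W \<Longrightarrow> \<exists>N. open N \<and> p \<in> N \<and> smooth_map A N f"
  shows "smooth_map A W f"
  unfolding smooth_map_def
proof (clarify, rule smooth_on_local)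
  fix V \<kappa> x assume c: "(V, \<kappa>) \<in> A" and "x \<in> \<kappa> ` (V \<inter> W)"
  then obtain p where p: "p \<in> V" "p \<in> W" "x = \<kappa> p" by auto
  obtain N where "open N" "p \<in> N" "smooth_map A N f" using assms[OF p(2)] by auto
  then show "\<exists>R. open R \<and> x \<in> R \<and> smooth_on R (\<lambda>x. f (inv_into V \<kappa> x))"
    using chart_open[OF c, of N] smooth_mapD[of N f, OF _ c] p by blast
qed

text \<open>Another chart sees \<open>F\<close> composed with a transition map of the atlas.\<close>

lemma smooth_map_chart:
  assumes c: "(V, \<kappa>) \<in> A" and W: "open W" and F: "smooth_on (\<kappa> ` (V \<inter> W)) F"
  shows "smooth_map A (V \<inter> W) (\<lambda>p. F (\<kappa> p))"
  unfolding smooth_map_def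
proof clarify
  fix V' \<kappa>' assume c': "(V', \<kappa>') \<in> A"
  have "smooth_on (\<kappa>' ` (V' \<inter> V)) (\<lambda>x. \<kappa> (inv_into V' \<kappa>' x))"
    using mfd c c' unfolding smooth_manifold_def by fast
  then have "smooth_on (\<kappa>' ` (V' \<inter> (V \<inter> W))) (\<lambda>x. \<kappa> (inv_into V' \<kappa>' x))"
    by (rule smooth_on_subset) auto
  moreover have "open (V \<inter> W)" using W chart_facts[OF c] by auto
  ultimately show "smooth_on (\<kappa>' ` (V' \<inter> (V \<inter> W))) (\<lambda>x. F (\<kappa> (inv_into V' \<kappa>' x)))"
    by (intro smooth_on_compose[OF framed_e chart_open[OF c'] chart_open[OF c W] _ F])
      (auto simp: chart_inv[OF c'])
qed

lemma smooth_map_coord: "(V, \<kappa>) \<in> A \<Longrightarrow> smooth_map A V \<kappa>"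
  using smooth_map_chart[of V \<kappa> UNIV "\<lambda>x. x"] smooth_on_id[of "\<kappa> ` V"] chart_facts by simp

section \<open>Cutoffs and extension of local functions\<close>

text \<open>A cutoff in a chart is transported to the manifold. Its extension by \<open>0\<close> is
  smooth because \<open>K\<close> corresponds to a closed ball, so it is compact and, the space
  being Hausdorff, closed; \<open>\<theta>\<close> is \<open>0\<close> on the open
  complement.\<close>

lemma smooth_map_cutoff:
  assumes N: "open N" and p: "p \<in> N"
  obtains \<theta> :: "'m \<Rightarrow> real" and K O' where "smooth_map A UNIV \<theta>" "closed K" "K \<subseteq> N"
    "\<And>q. q \<notin> K \<Longrightarrow> \<theta> q = 0" "open O'" "p \<in> O'" "O' \<subseteq> N" "\<And>q. q \<in> O' \<Longrightarrow> \<theta> q = 1"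
proof -
  obtain V \<kappa> where c: "(V, \<kappa>) \<in> A" "p \<in> V" using chart_at .
  have op: "open (\<kappa> ` (V \<inter> N))" using chart_open[OF c(1) N] .
  then obtain s where s: "s > 0" "ball (\<kappa> p) s \<subseteq> \<kappa> ` (V \<inter> N)"
    using open_contains_ball[of "\<kappa> ` (V \<inter> N)"] c p by blast
  \<comment> \<open>A third of \<open>s\<close>, so that the closed ball of radius
    \<open>2 * r\<close> still fits.\<close>
  define r where "r = s / 3"
  have r: "r > 0" "cball (\<kappa> p) (2 * r) \<subseteq> \<kappa> ` (V \<inter> N)" "ball (\<kappa> p) r \<subseteq> \<kappa> ` (V \<inter> N)"
    using s by (auto simp: r_def subset_iff)
  obtain h :: "'e \<Rightarrow> real" where h: "smooth_on UNIV h" "\<And>x. dist (\<kappa> p) x \<le> r \<Longrightarrow> h x = 1"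
    "\<And>x. dist (\<kappa> p) x \<ge> 2 * r \<Longrightarrow> h x = 0"
    using smooth_cutoff[OF r(1), of "\<kappa> p"] by blast
  define K where "K = inv_into V \<kappa> ` cball (\<kappa> p) (2 * r)"
  have KN: "K \<subseteq> N" "K \<subseteq> V" using r(2) chart_inv_in[OF _ c(1), of _ N] by (auto simp: K_def)
  have "continuous_on (cball (\<kappa> p) (2 * r)) (inv_into V \<kappa>)"
    using chart_facts(3)[OF c(1)] r(2) by (auto simp: homeomorphism_def intro: continuous_on_subset)
  then have "compact K" unfolding K_def
    by (rule compact_continuous_image) (rule compact_cball_framed[OF framed_e])
  then have K: "closed K" by (rule compact_imp_closed)
  define \<theta> where "\<theta> q = (if q \<in> V then h (\<kappa> q) else 0)" for q
  have off: "\<theta> q = 0" if "q \<notin> K" for q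
  proof (cases "q \<in> V")
    case True
    then have "\<kappa> q \<notin> cball (\<kappa> p) (2 * r)"
      using that chart_inv[OF c(1) True] unfolding K_def by (metis imageI)
    then show ?thesis using h(3) True by (simp add: \<theta>_def)
  qed (simp add: \<theta>_def)
  have V: "open V" using chart_facts[OF c(1)] by simp
  have "smooth_map A UNIV \<theta>"
  proof (rule smooth_map_local)
    fix q
    show "\<exists>N. open N \<and> q \<in> N \<and> smooth_map A N \<theta>"
    proof (cases "q \<in> K")
      case True
      have "smooth_map A V (\<lambda>q. h (\<kappa> q))"
        using smooth_map_chart[OF c(1) open_UNIV, of h] smooth_on_subset[OF h(1)] by auto
      then have "smooth_map A V \<theta>" by (rule smooth_map_cong[OF V, rotated]) (simp add: \<theta>_def)
      then show ?thesis using True KN V by blast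
    next
      case False
      have "smooth_map A (- K) \<theta>"
        by (rule smooth_map_cong[OF _ _ smooth_map_const[of _ 0]]) (use K off in auto)
      then show ?thesis using False K by blast
    qed
  qed
  moreover have "open (V \<inter> \<kappa> -` ball (\<kappa> p) r)"
    using continuous_open_preimage[OF chart_cont[OF c(1)] V open_ball] by simp
  moreover have "V \<inter> \<kappa> -` ball (\<kappa> p) r \<subseteq> N"
  proof
    fix q assume q: "q \<in> V \<inter> \<kappa> -` ball (\<kappa> p) r"
    then have "\<kappa> q \<in> \<kappa> ` (V \<inter> N)" using r(3) by auto
    from chart_inv_in[OF this c(1)] show "q \<in> N" using q chart_inv[OF c(1)] by auto
  qed
  moreover have "\<theta> q = 1" if "q \<in> V \<inter> \<kappa> -` ball (\<kappa> p) r" for q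
    using that h(2) by (simp add: \<theta>_def)
  moreover have "p \<in> V \<inter> \<kappa> -` ball (\<kappa> p) r" using c r by simp
  ultimately show ?thesis using that K KN off by blast
qed

lemma smooth_map_zero_extension:
  assumes \<theta>: "smooth_map A UNIV \<theta>" "\<And>q. q \<notin> K \<Longrightarrow> \<theta> q = 0" and K: "closed K" "K \<subseteq> N"
    and N: "open N" and f: "smooth_map A N f"
  shows "smooth_map A UNIV (\<lambda>q. if q \<in> N then \<theta> q *\<^sub>R f q else 0)" (is "smooth_map A UNIV ?g")
proof (rule smooth_map_local)
  fix q
  show "\<exists>N. open N \<and> q \<in> N \<and> smooth_map A N ?g"
  proof (cases "q \<in> K")
    case True
    have "smooth_map A N ?g"
      by (rule smooth_map_cong[OF N _ smooth_map_scaleR[OF N smooth_map_subset[OF \<theta>(1)] f]]) auto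
    then show ?thesis using True K N by blast
  next
    case False
    have "smooth_map A (- K) ?g"
      by (rule smooth_map_cong[OF _ _ smooth_map_const[of _ 0]]) (use K \<theta> in auto)
    then show ?thesis using False K by blast
  qed
qed

text \<open>Local functions must be made global because \<open>dir_deriv\<close> returns
  \<open>0\<close> on anything not globally smooth and the Leibniz rule of
  \<open>lie_algebroid\<close> is stated for global functions.\<close>

lemma smooth_map_extend:
  assumes N: "open N" "p \<in> N" and f: "smooth_map A N f"
  obtains g O' where "smooth_map A UNIV g" "open O'" "p \<in> O'" "O' \<subseteq> N" "\<And>q. q \<in> O' \<Longrightarrow> g q = f q"
proof -
  obtain \<theta> :: "'m \<Rightarrow> real" and K O' where 1: "smooth_map A UNIV \<theta>" "closed K" "K \<subseteq> N"
    "\<And>q. q \<notin> K \<Longrightarrow> \<theta> q = 0" "open O'" "p \<in> O'" "O' \<subseteq> N" "\<And>q. q \<in> O' \<Longrightarrow> \<theta> q = 1"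
    using smooth_map_cutoff[OF N] by metis
  show ?thesis
    by (rule that[OF smooth_map_zero_extension[OF 1(1,4,2,3) N(1) f] 1(5,6,7)]) (use 1 in auto)
qed

section \<open>Derivatives in a chart and tangent vectors\<close>

lemma chart_deriv_has_derivative:
  assumes "(V, \<kappa>) \<in> A" "open W" "p \<in> V" "p \<in> W" "smooth_map A W f"
  shows "((\<lambda>x. f (inv_into V \<kappa> x)) has_derivative chart_deriv (V, \<kappa>) f p) (at (\<kappa> p))"
  using smooth_on_has_derivative[OF smooth_mapD[OF assms(5,1)], of "\<kappa> p"] assms
  by (auto simp: chart_deriv_def)

lemma chart_derivI:
  assumes "((\<lambda>x. f (inv_into V \<kappa> x)) has_derivative f') (at (\<kappa> p))"
  shows "chart_deriv (V, \<kappa>) f p = f'"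
  using frechet_derivative_eqI[OF assms] by (simp add: chart_deriv_def)

lemma chart_deriv_linear:
  assumes "(V, \<kappa>) \<in> A" "open W" "p \<in> V" "p \<in> W" "smooth_map A W f"
  shows "bounded_linear (chart_deriv (V, \<kappa>) f p)"
  using chart_deriv_has_derivative[OF assms] has_derivative_bounded_linear by blast

lemma chart_deriv_const: "chart_deriv (V, \<kappa>) (\<lambda>_. c) p v = 0"
  by (subst chart_derivI[OF has_derivative_const]) simp

lemma chart_deriv_add:
  assumes "(V, \<kappa>) \<in> A" "open W" "p \<in> V" "p \<in> W" "smooth_map A W f" "smooth_map A W g"
  shows "chart_deriv (V, \<kappa>) (\<lambda>q. f q + g q) p v = chart_deriv (V, \<kappa>) f p v + chart_deriv (V, \<kappa>) g p v"
  by (subst chart_derivI[OF has_derivative_add[OF chart_deriv_has_derivative[OF assms(1-5)]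
          chart_deriv_has_derivative[OF assms(1-4,6)]]]) simp

lemma chart_deriv_bl:
  assumes "(V, \<kappa>) \<in> A" "open W" "p \<in> V" "p \<in> W" "smooth_map A W f" "bounded_linear h"
  shows "chart_deriv (V, \<kappa>) (\<lambda>q. h (f q)) p v = h (chart_deriv (V, \<kappa>) f p v)"
  by (subst chart_derivI[OF bounded_linear.has_derivative[OF assms(6) chart_deriv_has_derivative[OF assms(1-5)]]]) simp

lemma chart_deriv_bilinear:
  assumes "(V, \<kappa>) \<in> A" "open W" "p \<in> V" "p \<in> W" "smooth_map A W f" "smooth_map A W g" "bounded_bilinear pr"
  shows "chart_deriv (V, \<kappa>) (\<lambda>q. pr (f q) (g q)) p v =
    pr (f p) (chart_deriv (V, \<kappa>) g p v) + pr (chart_deriv (V, \<kappa>) f p v) (g p)"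
  by (subst chart_derivI[OF bounded_bilinear.FDERIV[OF assms(7) chart_deriv_has_derivative[OF assms(1-5)]
          chart_deriv_has_derivative[OF assms(1-4,6)]]]) (simp add: chart_inv[OF assms(1,3)])

lemma chart_deriv_cong:
  assumes "(V, \<kappa>) \<in> A" "open W" "p \<in> V" "p \<in> W" "\<And>q. q \<in> W \<Longrightarrow> f q = g q"
  shows "chart_deriv (V, \<kappa>) f p = chart_deriv (V, \<kappa>) g p"
  unfolding chart_deriv_def fst_conv snd_conv
  by (rule frechet_derivative_cong_open[OF chart_open[OF assms(1,2)]])
    (use assms chart_inv_in[OF _ assms(1)] in auto)

lemma smooth_map_chart_deriv:
  assumes c: "(V, \<kappa>) \<in> A" and W: "open W" and f: "smooth_map A W f"
  shows "smooth_map A (V \<inter> W) (\<lambda>p. chart_deriv (V, \<kappa>) f p v)"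
  unfolding chart_deriv_def fst_conv snd_conv
  by (rule smooth_map_chart[OF c W smooth_on_frechet[OF smooth_mapD[OF f c]]])

text \<open>\<open>smooth_on\<close> yields smoothness of directional derivatives. A frame of
  \<open>'e\<close> assembles the operator-valued derivative from finitely many of them as a sum of
  rank-one operators.\<close>

lemma smooth_map_Blinfun_chart_deriv:
  fixes f :: "'m \<Rightarrow> 'b::real_normed_vector"
  assumes c: "(V, \<kappa>) \<in> A" and W: "open W" "W \<subseteq> V" and f: "smooth_map A W f"
  shows "smooth_map A W (\<lambda>p. Blinfun (chart_deriv (V, \<kappa>) f p))"
proof -
  obtain n and b :: "nat \<Rightarrow> 'e" and l where e: "frame n b l"
    using framed_e by (auto simp: framed_def)
  have "V \<inter> W = W" using W by auto
  then have s: "smooth_map A W (\<lambda>p. chart_deriv (V, \<kappa>) f p v)" for v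
    using smooth_map_chart_deriv[OF c W(1) f, of v] by simp
  have bl: "bounded_linear (\<lambda>r::'b. blinfun_scaleR_left r o\<^sub>L Blinfun (l i))" for i
    by (rule bounded_linear_compose[OF bounded_bilinear.bounded_linear_left[OF bounded_bilinear_blinfun_compose]
          bounded_linear_blinfun_scaleR_left])
  have "smooth_map A W (\<lambda>p. \<Sum>i<n. blinfun_scaleR_left (chart_deriv (V, \<kappa>) f p (b i)) o\<^sub>L Blinfun (l i))"
    by (rule smooth_map_sum[OF W(1) smooth_map_bl[OF W(1) bl s]])
  then show ?thesis
  proof (rule smooth_map_cong[OF W(1), rotated])
    fix p assume p: "p \<in> W"
    then have D: "bounded_linear (chart_deriv (V, \<kappa>) f p)"
      using chart_deriv_linear[OF c W(1) _ _ f] W by auto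
    show "(\<Sum>i<n. blinfun_scaleR_left (chart_deriv (V, \<kappa>) f p (b i)) o\<^sub>L Blinfun (l i)) = Blinfun (chart_deriv (V, \<kappa>) f p)"
    proof (rule blinfun_eqI)
      fix v
      show "blinfun_apply (\<Sum>i<n. blinfun_scaleR_left (chart_deriv (V, \<kappa>) f p (b i)) o\<^sub>L Blinfun (l i)) v
        = blinfun_apply (Blinfun (chart_deriv (V, \<kappa>) f p)) v"
        unfolding bounded_linear_Blinfun_apply[OF D]
        by (subst frame_linear_expand[OF e bounded_linear.linear[OF D], of v])
          (simp add: blinfun.sum_left bounded_linear_Blinfun_apply frame_bl[OF e])
    qed
  qed
qed

lemma chart_deriv_change:
  assumes c: "(V, \<kappa>) \<in> A" "p \<in> V" and c': "(V', \<kappa>') \<in> A" "p \<in> V'"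
    and f: "open W" "p \<in> W" "smooth_map A W f"
  shows "chart_deriv (V', \<kappa>') f p v = chart_deriv (V, \<kappa>) f p (chart_deriv (V', \<kappa>') \<kappa> p v)"
proof -
  have 1: "((\<lambda>x. \<kappa> (inv_into V' \<kappa>' x)) has_derivative chart_deriv (V', \<kappa>') \<kappa> p) (at (\<kappa>' p))"
    using chart_deriv_has_derivative[OF c'(1) chart_facts(1)[OF c(1)] c'(2) c(2) smooth_map_coord[OF c(1)]] .
  have 2: "((\<lambda>x. f (inv_into V \<kappa> x)) has_derivative chart_deriv (V, \<kappa>) f p) (at (\<kappa> (inv_into V' \<kappa>' (\<kappa>' p))))"
    using chart_deriv_has_derivative[OF c(1) f(1) c(2) f(2,3)] by (simp add: chart_inv[OF c'])
  have "((\<lambda>x. f (inv_into V \<kappa> (\<kappa> (inv_into V' \<kappa>' x)))) has_derivative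
      (\<lambda>v. chart_deriv (V, \<kappa>) f p (chart_deriv (V', \<kappa>') \<kappa> p v))) (at (\<kappa>' p))"
    using diff_chain_at[OF 1 2] by (simp add: o_def)
  then have "((\<lambda>x. f (inv_into V' \<kappa>' x)) has_derivative
      (\<lambda>v. chart_deriv (V, \<kappa>) f p (chart_deriv (V', \<kappa>') \<kappa> p v))) (at (\<kappa>' p))"
    by (rule has_derivative_transform_within_open[where s="\<kappa>' ` (V' \<inter> V)"])
      (use chart_open[OF c'(1) chart_facts(1)[OF c(1)]] c c' chart_inv in auto)
  then show ?thesis by (simp add: chart_derivI)
qed

text \<open>A change of chart acts on the coordinates of a tangent vector by
  \<open>chart_deriv (V', \<kappa>') \<kappa> p\<close>, so a single chart around \<open>p\<close>
  already produces every tangent vector.\<close>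

lemma tangent_fibre:
  assumes c: "(V, \<kappa>) \<in> A" "p \<in> V"
  shows "fibre (tangent_bundle A) p = range (dir_deriv A (V, \<kappa>) p)"
proof -
  have "dir_deriv A (V', \<kappa>') p v \<in> range (dir_deriv A (V, \<kappa>) p)"
    if c': "(V', \<kappa>') \<in> A" "p \<in> V'" for V' \<kappa>' v
  proof -
    have "dir_deriv A (V', \<kappa>') p v = dir_deriv A (V, \<kappa>) p (chart_deriv (V', \<kappa>') \<kappa> p v)"
      by (rule ext) (auto simp: dir_deriv_eq intro!: chart_deriv_change[OF c c' open_UNIV])
    then show ?thesis by auto
  qed
  then show ?thesis using c by (auto simp: tangent_bundle_def)
qed

text \<open>Global test functions for anchors: on them a Lie derivative returns the coordinate
  \<open>l\<close> of the anchor, at all points near \<open>p\<close>.\<close>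

lemma coordinate_functions:
  assumes c: "(V, \<kappa>) \<in> A" "p \<in> V" and l: "bounded_linear l"
  obtains x :: "'m \<Rightarrow> real" and N where "smooth_map A UNIV x" "open N" "p \<in> N" "N \<subseteq> V"
    "\<And>q. q \<in> N \<Longrightarrow> x q = l (\<kappa> q)" "\<And>q v. q \<in> N \<Longrightarrow> chart_deriv (V, \<kappa>) x q v = l v"
proof -
  have V: "open V" using chart_facts[OF c(1)] by simp
  obtain x N where x: "smooth_map A UNIV x" "open N" "p \<in> N" "N \<subseteq> V" "\<And>q. q \<in> N \<Longrightarrow> x q = l (\<kappa> q)"
    using smooth_map_extend[OF V c(2) smooth_map_bl[OF V l smooth_map_coord[OF c(1)]]] by blast
  have "chart_deriv (V, \<kappa>) x q v = l v" if q: "q \<in> N" for q v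
  proof -
    have "(l has_derivative l) (at (\<kappa> q))" using l by (rule bounded_linear_imp_has_derivative)
    then have "((\<lambda>y. x (inv_into V \<kappa> y)) has_derivative l) (at (\<kappa> q))"
      by (rule has_derivative_transform_within_open[where s="\<kappa> ` (V \<inter> N)"])
        (use chart_open[OF c(1) x(2)] q x(4,5) chart_inv_in[OF _ c(1)] in auto)
    then show ?thesis by (simp add: chart_derivI)
  qed
  then show ?thesis using that x by blast
qed

lemma dir_deriv_inj:
  assumes c: "(V, \<kappa>) \<in> A" "p \<in> V" and eq: "dir_deriv A (V, \<kappa>) p v = dir_deriv A (V, \<kappa>) p w"
  shows "v = w"
proof -
  obtain n and b :: "nat \<Rightarrow> 'e" and l where e: "frame n b l"
    using framed_e by (auto simp: framed_def)
  have "l i v = l i w" if i: "i < n" for i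
  proof -
    obtain x N where "smooth_map A UNIV x" "p \<in> N" "\<And>q v. q \<in> N \<Longrightarrow> chart_deriv (V, \<kappa>) x q v = l i v"
      using coordinate_functions[OF c frame_bl[OF e i]] by metis
    then show ?thesis using fun_cong[OF eq, of x] by (simp add: dir_deriv_eq)
  qed
  then have "(\<Sum>i<n. l i v *\<^sub>R b i) = (\<Sum>i<n. l i w *\<^sub>R b i)" by simp
  then show ?thesis unfolding frame_sum[OF e] .
qed

end

section \<open>Sections of vector bundles\<close>

definition sec_minus ::
    "('m, 'v, 'r, 'z) vbundle_scheme \<Rightarrow> ('m \<Rightarrow> 'v) \<Rightarrow> ('m \<Rightarrow> 'v) \<Rightarrow> 'm \<Rightarrow> 'v" where
  "sec_minus E X Y = (\<lambda>m. vminus E m (X m) (Y m))"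

lemma frechet_local_rep:
  "frechet_derivative (local_rep (V, \<kappa>) \<phi> X) (at (\<kappa> m)) = chart_deriv (V, \<kappa>) (\<lambda>p. \<phi> p (X p)) m"
  by (simp add: local_rep_def chart_deriv_def)

locale vec_bundle = manifold A for A :: "('m::{t2_space,second_countable_topology}, 'e::real_inner) chart set" +
  fixes E :: "('m, 'v, 'r::real_normed_vector, 'z) vbundle_scheme"
  assumes vb: "vector_bundle A E" and framed_r: "framed TYPE('r)"
begin

lemma triv_at: obtains U \<phi> where "(U, \<phi>) \<in> triv E" "p \<in> U"
proof -
  have "p \<in> \<Union>(fst ` triv E)" using vb by (simp add: vector_bundle_def)
  then show ?thesis using that by auto
qed

lemma zero_in [simp]: "vzero E m \<in> fibre E m"
  and plus_in [simp]: "x \<in> fibre E m \<Longrightarrow> y \<in> fibre E m \<Longrightarrow> vplus E m x y \<in> fibre E m"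
  and scale_in [simp]: "x \<in> fibre E m \<Longrightarrow> vscale E m c x \<in> fibre E m"
  using vb by (auto simp: vector_bundle_def)

lemma minus_in [simp]: "x \<in> fibre E m \<Longrightarrow> y \<in> fibre E m \<Longrightarrow> vminus E m x y \<in> fibre E m"
  by (simp add: vminus_def)

context
  fixes U \<phi> m assumes t: "(U, \<phi>) \<in> triv E" and m: "m \<in> U"
begin

lemma triv_facts:
  shows "bij_betw (\<phi> m) (fibre E m) UNIV" and "\<phi> m (vzero E m) = 0"
    and "x \<in> fibre E m \<Longrightarrow> y \<in> fibre E m \<Longrightarrow> \<phi> m (vplus E m x y) = \<phi> m x + \<phi> m y"
    and "x \<in> fibre E m \<Longrightarrow> \<phi> m (vscale E m c x) = c *\<^sub>R \<phi> m x"
proof -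
  have "\<forall>(U, \<phi>)\<in>triv E. open U \<and> (\<forall>m\<in>U. bij_betw (\<phi> m) (fibre E m) UNIV \<and> \<phi> m (vzero E m) = 0 \<and>
    (\<forall>x\<in>fibre E m. \<forall>y\<in>fibre E m. \<phi> m (vplus E m x y) = \<phi> m x + \<phi> m y) \<and>
    (\<forall>c. \<forall>x\<in>fibre E m. \<phi> m (vscale E m c x) = c *\<^sub>R \<phi> m x))"
    using vb unfolding vector_bundle_def by (elim conjE) assumption
  from bspec[OF this t] show "bij_betw (\<phi> m) (fibre E m) UNIV" and "\<phi> m (vzero E m) = 0"
    and "x \<in> fibre E m \<Longrightarrow> y \<in> fibre E m \<Longrightarrow> \<phi> m (vplus E m x y) = \<phi> m x + \<phi> m y"
    and "x \<in> fibre E m \<Longrightarrow> \<phi> m (vscale E m c x) = c *\<^sub>R \<phi> m x"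
    using m by simp_all
qed

lemma triv_minus:
  "x \<in> fibre E m \<Longrightarrow> y \<in> fibre E m \<Longrightarrow> \<phi> m (vminus E m x y) = \<phi> m x - \<phi> m y"
  by (simp add: vminus_def triv_facts)

lemma triv_inj: "x \<in> fibre E m \<Longrightarrow> y \<in> fibre E m \<Longrightarrow> \<phi> m x = \<phi> m y \<longleftrightarrow> x = y"
  using triv_facts(1) by (auto simp: bij_betw_def inj_on_def)

lemma triv_inv_in: "inv_into (fibre E m) (\<phi> m) w \<in> fibre E m"
  and triv_inv: "\<phi> m (inv_into (fibre E m) (\<phi> m) w) = w"
  using triv_facts(1) by (auto simp: bij_betw_def intro: inv_into_into f_inv_into_f)

lemma triv_inv_left: "x \<in> fibre E m \<Longrightarrow> inv_into (fibre E m) (\<phi> m) (\<phi> m x) = x"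
  using triv_facts(1) by (simp add: bij_betw_inv_into_left)

end

lemma triv_open: "(U, \<phi>) \<in> triv E \<Longrightarrow> open U"
proof -
  assume t: "(U, \<phi>) \<in> triv E"
  have "\<forall>(U, \<phi>)\<in>triv E. open U \<and> (\<forall>m\<in>U. bij_betw (\<phi> m) (fibre E m) UNIV \<and> \<phi> m (vzero E m) = 0 \<and>
    (\<forall>x\<in>fibre E m. \<forall>y\<in>fibre E m. \<phi> m (vplus E m x y) = \<phi> m x + \<phi> m y) \<and>
    (\<forall>c. \<forall>x\<in>fibre E m. \<phi> m (vscale E m c x) = c *\<^sub>R \<phi> m x))"
    using vb unfolding vector_bundle_def by (elim conjE) assumption
  from bspec[OF this t] show "open U" by simp
qed

lemma vscale_zero: "x \<in> fibre E m \<Longrightarrow> vscale E m 0 x = vzero E m"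
proof -
  assume x: "x \<in> fibre E m"
  obtain U \<phi> where t: "(U, \<phi>) \<in> triv E" "m \<in> U" using triv_at .
  have "\<phi> m (vscale E m 0 x) = \<phi> m (vzero E m)" using triv_facts(2,4)[OF t] x by simp
  then show ?thesis using triv_inj[OF t scale_in[OF x] zero_in] by blast
qed

lemma vminus_zero_iff: "x \<in> fibre E m \<Longrightarrow> y \<in> fibre E m \<Longrightarrow> vminus E m x y = vzero E m \<longleftrightarrow> x = y"
proof -
  assume x: "x \<in> fibre E m" "y \<in> fibre E m"
  obtain U \<phi> where t: "(U, \<phi>) \<in> triv E" "m \<in> U" using triv_at .
  show ?thesis
    using triv_inj[OF t minus_in[OF x] zero_in] triv_inj[OF t x] triv_facts(2)[OF t] triv_minus[OF t x] by simp
qed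

lemma transition_linear:
  assumes t: "(U, \<phi>) \<in> triv E" "m \<in> U" and t': "(U', \<psi>) \<in> triv E" "m \<in> U'"
  shows "linear (\<lambda>w. \<psi> m (inv_into (fibre E m) (\<phi> m) w))"
proof (rule linearI)
  fix w w' c
  have "inv_into (fibre E m) (\<phi> m) (w + w') =
      vplus E m (inv_into (fibre E m) (\<phi> m) w) (inv_into (fibre E m) (\<phi> m) w')"
    by (subst triv_inj[OF t, symmetric]) (auto simp: triv_facts[OF t] triv_inv[OF t] triv_inv_in[OF t])
  then show "\<psi> m (inv_into (fibre E m) (\<phi> m) (w + w')) =
      \<psi> m (inv_into (fibre E m) (\<phi> m) w) + \<psi> m (inv_into (fibre E m) (\<phi> m) w')"
    by (simp add: triv_facts[OF t'] triv_inv_in[OF t])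
  have "inv_into (fibre E m) (\<phi> m) (c *\<^sub>R w) = vscale E m c (inv_into (fibre E m) (\<phi> m) w)"
    by (subst triv_inj[OF t, symmetric]) (auto simp: triv_facts[OF t] triv_inv[OF t] triv_inv_in[OF t])
  then show "\<psi> m (inv_into (fibre E m) (\<phi> m) (c *\<^sub>R w)) = c *\<^sub>R \<psi> m (inv_into (fibre E m) (\<phi> m) w)"
    by (simp add: triv_facts[OF t'] triv_inv_in[OF t])
qed

text \<open>\<open>vector_bundle\<close> asks for smooth transitions on constant vectors
  \<open>w\<close>. Fibrewise linearity and a frame of the model fibre extend this to moving vectors
  \<open>u\<close>.\<close>

lemma transition_smooth:
  assumes t: "(U, \<phi>) \<in> triv E" and t': "(U', \<psi>) \<in> triv E"
    and N: "open N" "N \<subseteq> U \<inter> U'" and u: "smooth_map A N u"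
  shows "smooth_map A N (\<lambda>m. \<psi> m (inv_into (fibre E m) (\<phi> m) (u m)))"
proof -
  obtain n and b :: "nat \<Rightarrow> 'r" and l where e: "frame n b l"
    using framed_r by (auto simp: framed_def)
  have "\<forall>(U, \<phi>)\<in>triv E. \<forall>(V, \<psi>)\<in>triv E. \<forall>w. smooth_map A (U \<inter> V) (\<lambda>m. \<psi> m (inv_into (fibre E m) (\<phi> m) w))"
    using vb unfolding vector_bundle_def by (elim conjE) assumption
  from spec[OF bspec[OF bspec[OF this t, unfolded split_conv] t', unfolded split_conv]]
  have tr: "smooth_map A N (\<lambda>m. \<psi> m (inv_into (fibre E m) (\<phi> m) w))" for w
    by (rule smooth_map_subset) (rule N(2))
  have "smooth_map A N (\<lambda>m. \<Sum>i<n. l i (u m) *\<^sub>R \<psi> m (inv_into (fibre E m) (\<phi> m) (b i)))"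
    by (rule smooth_map_sum[OF N(1) smooth_map_scaleR[OF N(1) smooth_map_bl[OF N(1) frame_bl[OF e] u] tr]]) simp
  then show ?thesis
  proof (rule smooth_map_cong[OF N(1), rotated])
    fix p assume "p \<in> N"
    then have p: "p \<in> U" "p \<in> U'" using N by auto
    show "(\<Sum>i<n. l i (u p) *\<^sub>R \<psi> p (inv_into (fibre E p) (\<phi> p) (b i))) =
      \<psi> p (inv_into (fibre E p) (\<phi> p) (u p))"
      by (rule frame_linear_expand[OF e transition_linear[OF t p(1) t' p(2)], symmetric])
  qed
qed

lemma sec_in: "X \<in> sections A E \<Longrightarrow> X m \<in> fibre E m"
  by (simp add: sections_def)

lemma sec_smooth: "X \<in> sections A E \<Longrightarrow> (U, \<phi>) \<in> triv E \<Longrightarrow> smooth_map A U (\<lambda>m. \<phi> m (X m))"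
  by (auto simp: sections_def)

text \<open>Any other trivialization differs from the given one by a smooth transition, so
  smoothness need be verified in only one of them near each point.\<close>

lemma sections_localI:
  assumes "\<And>p. X p \<in> fibre E p"
    and "\<And>p. \<exists>U \<phi> N. (U, \<phi>) \<in> triv E \<and> open N \<and> p \<in> N \<and> N \<subseteq> U \<and> smooth_map A N (\<lambda>q. \<phi> q (X q))"
  shows "X \<in> sections A E"
proof -
  have "smooth_map A U' (\<lambda>q. \<psi> q (X q))" if t': "(U', \<psi>) \<in> triv E" for U' \<psi>
  proof (rule smooth_map_local)
    fix p assume p: "p \<in> U'"
    obtain U \<phi> N where t: "(U, \<phi>) \<in> triv E" and N: "open N" "p \<in> N" "N \<subseteq> U"
      and s: "smooth_map A N (\<lambda>q. \<phi> q (X q))" using assms(2)[of p] by (elim exE conjE)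
    have o: "open (N \<inter> U')" using N triv_open[OF t'] by auto
    have "smooth_map A (N \<inter> U') (\<lambda>q. \<psi> q (inv_into (fibre E q) (\<phi> q) (\<phi> q (X q))))"
      by (rule transition_smooth[OF t t' o]) (use N smooth_map_subset[OF s] in auto)
    then have "smooth_map A (N \<inter> U') (\<lambda>q. \<psi> q (X q))"
      by (rule smooth_map_cong[OF o, rotated]) (use N triv_inv_left[OF t] assms(1) in auto)
    then show "\<exists>N. open N \<and> p \<in> N \<and> smooth_map A N (\<lambda>q. \<psi> q (X q))" using o p N by blast
  qed
  then show ?thesis using assms(1) by (auto simp: sections_def)
qed

lemma sections_globalI:
  assumes "\<And>p. X p \<in> fibre E p" "\<And>U \<phi>. (U, \<phi>) \<in> triv E \<Longrightarrow> smooth_map A U (\<lambda>q. \<phi> q (X q))"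
  shows "X \<in> sections A E"
  using assms by (auto simp: sections_def)

lemma sec_plus_sec: "X \<in> sections A E \<Longrightarrow> Y \<in> sections A E \<Longrightarrow> sec_plus E X Y \<in> sections A E"
  unfolding sec_plus_def
  by (rule sections_globalI)
    (auto simp: sec_in triv_facts intro!: smooth_map_cong[OF triv_open _ smooth_map_add[OF triv_open sec_smooth sec_smooth]])

lemma sec_scale_sec: "X \<in> sections A E \<Longrightarrow> smooth_map A UNIV f \<Longrightarrow> sec_scale E f X \<in> sections A E"
  unfolding sec_scale_def
  by (rule sections_globalI)
    (auto simp: sec_in triv_facts
      intro!: smooth_map_cong[OF triv_open _ smooth_map_scaleR[OF triv_open smooth_map_subset[of UNIV f] sec_smooth]])

lemma sec_zero_sec: "vzero E \<in> sections A E"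
  by (rule sections_globalI) (auto simp: triv_facts intro!: smooth_map_cong[OF triv_open _ smooth_map_const[of _ 0]])

lemma sec_minus_eq: "sec_minus E X Y = sec_plus E X (sec_scale E (\<lambda>_. - 1) Y)"
  by (simp add: sec_minus_def vminus_def sec_plus_def sec_scale_def)

lemma sec_minus_sec: "X \<in> sections A E \<Longrightarrow> Y \<in> sections A E \<Longrightarrow> sec_minus E X Y \<in> sections A E"
  unfolding sec_minus_eq by (intro sec_plus_sec sec_scale_sec smooth_map_const)

section \<open>Global sections from local data, and tensoriality\<close>

text \<open>Off the closed set \<open>K\<close> the section is \<open>vzero\<close>, inside
  \<open>U\<close> and outside. Near a point outside \<open>U\<close> it can thus be read in any
  trivialization with \<open>K\<close> removed.\<close>

lemma sec_cutoff:
  assumes t: "(U, \<phi>) \<in> triv E" and \<theta>: "smooth_map A UNIV \<theta>" "\<And>q. q \<notin> K \<Longrightarrow> \<theta> q = 0"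
    and K: "closed K" "K \<subseteq> U" and u: "smooth_map A U u"
  shows "(\<lambda>p. if p \<in> U then inv_into (fibre E p) (\<phi> p) (\<theta> p *\<^sub>R u p) else vzero E p) \<in> sections A E"
    (is "?s \<in> _")
proof (rule sections_localI)
  have U: "open U" using triv_open[OF t] .
  show "?s p \<in> fibre E p" for p by (simp add: triv_inv_in[OF t])
  fix p
  show "\<exists>U \<phi> N. (U, \<phi>) \<in> triv E \<and> open N \<and> p \<in> N \<and> N \<subseteq> U \<and> smooth_map A N (\<lambda>q. \<phi> q (?s q))"
  proof (cases "p \<in> U")
    case True
    have "smooth_map A U (\<lambda>q. \<phi> q (?s q))"
      by (rule smooth_map_cong[OF U _ smooth_map_scaleR[OF U smooth_map_subset[OF \<theta>(1)] u]]) (auto simp: triv_inv[OF t])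
    then show ?thesis using t U True by blast
  next
    case False
    obtain U' \<psi> where t': "(U', \<psi>) \<in> triv E" "p \<in> U'" using triv_at .
    have o: "open (U' - K)" using triv_open[OF t'(1)] K by auto
    have z: "inv_into (fibre E q) (\<phi> q) 0 = vzero E q" if "q \<in> U" for q
      using triv_inv_left[OF t that, of "vzero E q"] triv_facts[OF t that] by simp
    have "smooth_map A (U' - K) (\<lambda>q. \<psi> q (?s q))"
      by (rule smooth_map_cong[OF o _ smooth_map_const[of _ 0]])
        (use \<theta>(2) z triv_facts[OF t'(1)] in auto)
    then show ?thesis using t' o False K by blast
  qed
qed

text \<open>Two nested cutoffs: one makes \<open>u\<close> a global function, the other makes the
  section global. The prescribed values survive on the smaller neighbourhood.\<close>

lemma sec_extend:
  assumes t: "(U, \<phi>) \<in> triv E" and N: "open N" "p \<in> N" "N \<subseteq> U" and u: "smooth_map A N u"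
  obtains s O' where "s \<in> sections A E" "open O'" "p \<in> O'" "O' \<subseteq> N" "\<And>q. q \<in> O' \<Longrightarrow> \<phi> q (s q) = u q"
proof -
  obtain u' N' where u': "smooth_map A UNIV u'" "open N'" "p \<in> N'" "N' \<subseteq> N" "\<And>q. q \<in> N' \<Longrightarrow> u' q = u q"
    using smooth_map_extend[OF N(1,2) u] by metis
  obtain \<theta> :: "'m \<Rightarrow> real" and K O' where 1: "smooth_map A UNIV \<theta>" "closed K" "K \<subseteq> N'"
    "\<And>q. q \<notin> K \<Longrightarrow> \<theta> q = 0" "open O'" "p \<in> O'" "O' \<subseteq> N'" "\<And>q. q \<in> O' \<Longrightarrow> \<theta> q = 1"
    using smooth_map_cutoff[OF u'(2,3)] by metis
  have KU: "K \<subseteq> U" using 1 u' N by auto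
  show ?thesis
  proof (rule that[OF sec_cutoff[OF t 1(1,4,2) KU smooth_map_subset[OF u'(1)]] 1(5,6)])
    show "O' \<subseteq> N" using 1 u' by auto
    fix q assume q: "q \<in> O'"
    then have "q \<in> U" "q \<in> N'" "\<theta> q = 1" using 1 u' N by auto
    then show "\<phi> q (if q \<in> U then inv_into (fibre E q) (\<phi> q) (\<theta> q *\<^sub>R u' q) else vzero E q) = u q"
      using u'(5) triv_inv[OF t] by simp
  qed auto
qed

lemma sec_through:
  assumes "x \<in> fibre E m"
  obtains X where "X \<in> sections A E" "X m = x"
proof -
  obtain U \<phi> where t: "(U, \<phi>) \<in> triv E" "m \<in> U" using triv_at .
  obtain s O' where "s \<in> sections A E" "m \<in> O'" "\<And>q. q \<in> O' \<Longrightarrow> \<phi> q (s q) = \<phi> m x"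
    using sec_extend[OF t(1) triv_open[OF t(1)] t(2) order_refl smooth_map_const[of _ "\<phi> m x"]] by metis
  then show ?thesis using that triv_inj[OF t sec_in assms] by blast
qed

text \<open>Near \<open>m\<close>, a section \<open>Q\<close> with \<open>Q m = 0\<close> is a combination of sections with coefficients
  vanishing at \<open>m\<close>; multiplying by the square of a cutoff makes this a global identity.\<close>

lemma tensorial_zero:
  fixes \<Phi> :: "('m \<Rightarrow> 'v) \<Rightarrow> 'w::real_vector"
  assumes add: "\<And>X Y. X \<in> sections A E \<Longrightarrow> Y \<in> sections A E \<Longrightarrow> \<Phi> (sec_plus E X Y) = \<Phi> X + \<Phi> Y"
    and scale: "\<And>f X. smooth_map A UNIV f \<Longrightarrow> X \<in> sections A E \<Longrightarrow> \<Phi> (sec_scale E f X) = f m *\<^sub>R \<Phi> X"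
    and Q: "Q \<in> sections A E" "Q m = vzero E m"
  shows "\<Phi> Q = 0"
proof -
  obtain n and b :: "nat \<Rightarrow> 'r" and l where e: "frame n b l"
    using framed_r by (auto simp: framed_def)
  obtain U \<phi> where t: "(U, \<phi>) \<in> triv E" and mU: "m \<in> U" using triv_at .
  have U: "open U" using triv_open[OF t] .
  obtain \<theta> :: "'m \<Rightarrow> real" and K O' where 1: "smooth_map A UNIV \<theta>" "closed K" "K \<subseteq> U"
    "\<And>q. q \<notin> K \<Longrightarrow> \<theta> q = 0" "m \<in> O'" "\<And>q. q \<in> O' \<Longrightarrow> \<theta> q = 1"
    using smooth_map_cutoff[OF U mU] by metis
  have "\<exists>Z\<in>sections A E. \<Phi> Z = 0 \<and> (\<forall>p\<in>U. \<phi> p (Z p) = (\<Sum>i<k. (\<theta> p * \<theta> p * l i (\<phi> p (Q p))) *\<^sub>R b i)) \<and>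
    (\<forall>p. p \<notin> U \<longrightarrow> Z p = vzero E p)" if "k \<le> n" for k
    using that
  proof (induction k)
    case 0
    have "vzero E = sec_scale E (\<lambda>_. 0) (vzero E)" by (auto simp: sec_scale_def vscale_zero)
    then have "\<Phi> (vzero E) = 0" using scale[OF smooth_map_const sec_zero_sec, of 0] by simp
    then show ?case using sec_zero_sec triv_facts(2)[OF t] by auto
  next
    case (Suc k)
    then obtain Z where Z: "Z \<in> sections A E" "\<Phi> Z = 0"
      "\<And>p. p \<in> U \<Longrightarrow> \<phi> p (Z p) = (\<Sum>i<k. (\<theta> p * \<theta> p * l i (\<phi> p (Q p))) *\<^sub>R b i)"
      "\<And>p. p \<notin> U \<Longrightarrow> Z p = vzero E p" by auto
    have bl: "bounded_linear (l k)" using frame_bl[OF e] Suc by auto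
    define f where "f q = (if q \<in> U then \<theta> q *\<^sub>R l k (\<phi> q (Q q)) else 0)" for q
    have f: "smooth_map A UNIV f" unfolding f_def
      by (rule smooth_map_zero_extension[OF 1(1,4,2,3) U smooth_map_bl[OF U bl sec_smooth[OF Q(1) t]]])
    define Y where "Y p = (if p \<in> U then inv_into (fibre E p) (\<phi> p) (\<theta> p *\<^sub>R b k) else vzero E p)" for p
    have Y: "Y \<in> sections A E" unfolding Y_def by (rule sec_cutoff[OF t 1(1,4,2,3) smooth_map_const])
    have f0: "f m = 0" using Q(2) triv_facts(2)[OF t] mU linear_0[OF bounded_linear.linear[OF bl]]
      by (simp add: f_def)
    \<comment> \<open>One cutoff factor sits in the coefficient \<open>f\<close>, the other in the
      section \<open>Y\<close>, whence the square.\<close>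
    let ?Z = "sec_plus E (sec_scale E f Y) Z"
    have "\<Phi> ?Z = 0" using add[OF sec_scale_sec[OF Y f] Z(1)] scale[OF f Y] f0 Z(2) by simp
    moreover have "\<phi> p (?Z p) = (\<Sum>i<Suc k. (\<theta> p * \<theta> p * l i (\<phi> p (Q p))) *\<^sub>R b i)" if "p \<in> U" for p
      using that Z(3)[OF that] sec_in[OF Y, of p] sec_in[OF Z(1), of p]
      by (simp add: sec_plus_def sec_scale_def triv_facts[OF t that])
        (simp add: Y_def f_def triv_inv[OF t that] mult_ac)
    moreover have "?Z p = vzero E p" if "p \<notin> U" for p
    proof -
      obtain U' \<psi> where t': "(U', \<psi>) \<in> triv E" "p \<in> U'" using triv_at .
      show ?thesis
        using that Z(4)[OF that] triv_inj[OF t' plus_in[OF zero_in zero_in] zero_in] triv_facts(2,3)[OF t']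
        by (simp add: sec_plus_def sec_scale_def Y_def f_def vscale_zero)
    qed
    ultimately show ?case using sec_plus_sec[OF sec_scale_sec[OF Y f] Z(1)] by blast
  qed
  from this[OF order_refl] obtain Z where Z: "Z \<in> sections A E" "\<Phi> Z = 0"
      "\<And>p. p \<in> U \<Longrightarrow> \<phi> p (Z p) = (\<Sum>i<n. (\<theta> p * \<theta> p * l i (\<phi> p (Q p))) *\<^sub>R b i)"
      "\<And>p. p \<notin> U \<Longrightarrow> Z p = vzero E p" by auto
  have "sec_scale E (\<lambda>p. \<theta> p * \<theta> p) Q = Z"
  proof
    fix p
    show "sec_scale E (\<lambda>p. \<theta> p * \<theta> p) Q p = Z p"
    proof (cases "p \<in> U")
      case True
      have "\<phi> p (Z p) = (\<theta> p * \<theta> p) *\<^sub>R (\<Sum>i<n. l i (\<phi> p (Q p)) *\<^sub>R b i)"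
        by (simp add: Z(3)[OF True] scaleR_sum_right)
      also have "\<dots> = \<phi> p (sec_scale E (\<lambda>p. \<theta> p * \<theta> p) Q p)"
        unfolding frame_sum[OF e] using sec_in[OF Q(1)] by (simp add: sec_scale_def triv_facts[OF t True])
      finally show ?thesis using triv_inj[OF t True sec_in[OF Z(1)]] sec_in[OF Q(1)]
        by (simp add: sec_scale_def)
    next
      case False
      then have "\<theta> p = 0" using 1 by auto
      then show ?thesis using Z(4)[OF False] sec_in[OF Q(1)] by (simp add: sec_scale_def vscale_zero)
    qed
  qed
  moreover have "smooth_map A UNIV (\<lambda>p. \<theta> p * \<theta> p)" by (rule smooth_map_mult[OF open_UNIV 1(1,1)])
  ultimately have "(\<theta> m * \<theta> m) *\<^sub>R \<Phi> Q = 0" using scale[OF _ Q(1)] Z(2) by metis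
  then show ?thesis using 1 by simp
qed

lemma tensorial_eq:
  fixes \<Phi> :: "('m \<Rightarrow> 'v) \<Rightarrow> 'w::real_vector"
  assumes add: "\<And>X Y. X \<in> sections A E \<Longrightarrow> Y \<in> sections A E \<Longrightarrow> \<Phi> (sec_plus E X Y) = \<Phi> X + \<Phi> Y"
    and scale: "\<And>f X. smooth_map A UNIV f \<Longrightarrow> X \<in> sections A E \<Longrightarrow> \<Phi> (sec_scale E f X) = f m *\<^sub>R \<Phi> X"
    and X: "X \<in> sections A E" and Y: "Y \<in> sections A E" and eq: "X m = Y m"
  shows "\<Phi> X = \<Phi> Y"
proof -
  have "\<Phi> (sec_minus E X Y) = 0"
    by (rule tensorial_zero[OF add scale sec_minus_sec[OF X Y]])
      (use eq vminus_zero_iff sec_in X Y in \<open>auto simp: sec_minus_def\<close>)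
  moreover have "\<Phi> (sec_minus E X Y) = \<Phi> X + (- 1) *\<^sub>R \<Phi> Y"
    unfolding sec_minus_eq using add[OF X sec_scale_sec[OF Y smooth_map_const]] scale[OF smooth_map_const Y] by simp
  ultimately show ?thesis by simp
qed

section \<open>First-order jets of sections in coordinates\<close>

lemma chart_deriv_sec_add:
  assumes t: "(U, \<phi>) \<in> triv E" "m \<in> U" and c: "(V, \<kappa>) \<in> A" "m \<in> V"
    and X: "X \<in> sections A E" and Y: "Y \<in> sections A E"
  shows "chart_deriv (V, \<kappa>) (\<lambda>p. \<phi> p (sec_plus E X Y p)) m v =
    chart_deriv (V, \<kappa>) (\<lambda>p. \<phi> p (X p)) m v + chart_deriv (V, \<kappa>) (\<lambda>p. \<phi> p (Y p)) m v"
proof -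
  have U: "open U" using triv_open[OF t(1)] .
  have "chart_deriv (V, \<kappa>) (\<lambda>p. \<phi> p (sec_plus E X Y p)) m = chart_deriv (V, \<kappa>) (\<lambda>p. \<phi> p (X p) + \<phi> p (Y p)) m"
    by (rule chart_deriv_cong[OF c(1) U c(2) t(2)])
      (auto simp: sec_plus_def triv_facts[OF t(1)] sec_in X Y)
  then show ?thesis
    using chart_deriv_add[OF c(1) U c(2) t(2) sec_smooth[OF X t(1)] sec_smooth[OF Y t(1)]] by simp
qed

lemma chart_deriv_sec_scale:
  assumes t: "(U, \<phi>) \<in> triv E" "m \<in> U" and c: "(V, \<kappa>) \<in> A" "m \<in> V"
    and X: "X \<in> sections A E" and f: "smooth_map A UNIV f"
  shows "chart_deriv (V, \<kappa>) (\<lambda>p. \<phi> p (sec_scale E f X p)) m v =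
    f m *\<^sub>R chart_deriv (V, \<kappa>) (\<lambda>p. \<phi> p (X p)) m v + chart_deriv (V, \<kappa>) f m v *\<^sub>R \<phi> m (X m)"
proof -
  have U: "open U" using triv_open[OF t(1)] .
  have "chart_deriv (V, \<kappa>) (\<lambda>p. \<phi> p (sec_scale E f X p)) m = chart_deriv (V, \<kappa>) (\<lambda>p. f p *\<^sub>R \<phi> p (X p)) m"
    by (rule chart_deriv_cong[OF c(1) U c(2) t(2)])
      (auto simp: sec_scale_def triv_facts[OF t(1)] sec_in X)
  then show ?thesis
    using chart_deriv_bilinear[OF c(1) U c(2) t(2) smooth_map_subset[OF f] sec_smooth[OF X t(1)] bounded_bilinear_scaleR] by simp
qed

lemma chart_deriv_sec_minus:
  assumes t: "(U, \<phi>) \<in> triv E" "m \<in> U" and c: "(V, \<kappa>) \<in> A" "m \<in> V"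
    and X: "X \<in> sections A E" and Y: "Y \<in> sections A E"
  shows "chart_deriv (V, \<kappa>) (\<lambda>p. \<phi> p (sec_minus E X Y p)) m v =
    chart_deriv (V, \<kappa>) (\<lambda>p. \<phi> p (X p)) m v - chart_deriv (V, \<kappa>) (\<lambda>p. \<phi> p (Y p)) m v"
  unfolding sec_minus_eq
  using chart_deriv_sec_add[OF t c X sec_scale_sec[OF Y smooth_map_const]]
    chart_deriv_sec_scale[OF t c Y smooth_map_const] by (simp add: chart_deriv_const)

text \<open>Let \<open>\<Phi>\<close> be the discrepancy between the derivative in another chart and
  trivialization and the transformed given one. It is tensorial, because scaling by \<open>f\<close>
  adds the same term with the derivative of \<open>f\<close> to both. Sections with equal values at
  \<open>m\<close> thus have equal discrepancy, and equality of derivatives passes over.\<close>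

lemma same_jet_chartI:
  assumes t: "(U, \<phi>) \<in> triv E" "m \<in> U" and c: "(V, \<kappa>) \<in> A" "m \<in> V"
    and X: "X \<in> sections A E" and Y: "Y \<in> sections A E" and eq: "X m = Y m"
    and D: "chart_deriv (V, \<kappa>) (\<lambda>p. \<phi> p (X p)) m = chart_deriv (V, \<kappa>) (\<lambda>p. \<phi> p (Y p)) m"
  shows "same_jet A E m X Y"
proof -
  have "chart_deriv (V', \<kappa>') (\<lambda>p. \<psi> p (X p)) m v = chart_deriv (V', \<kappa>') (\<lambda>p. \<psi> p (Y p)) m v"
    if t': "(U', \<psi>) \<in> triv E" "m \<in> U'" and c': "(V', \<kappa>') \<in> A" "m \<in> V'" for U' \<psi> V' \<kappa>' v
  proof -
    define \<tau> where "\<tau> w = \<psi> m (inv_into (fibre E m) (\<phi> m) w)" for w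
    have \<tau>: "linear \<tau>" unfolding \<tau>_def by (rule transition_linear[OF t t'])
    have \<tau>': "\<tau> (\<phi> m x) = \<psi> m x" if "x \<in> fibre E m" for x
      using triv_inv_left[OF t that] by (simp add: \<tau>_def)
    define w where "w = chart_deriv (V', \<kappa>') \<kappa> m v"
    define \<Phi> where "\<Phi> Z = chart_deriv (V', \<kappa>') (\<lambda>p. \<psi> p (Z p)) m v - \<tau> (chart_deriv (V, \<kappa>) (\<lambda>p. \<phi> p (Z p)) m w)" for Z
    have "\<Phi> X = \<Phi> Y"
    proof (rule tensorial_eq[OF _ _ X Y eq])
      show "\<Phi> (sec_plus E X Y) = \<Phi> X + \<Phi> Y" if "X \<in> sections A E" "Y \<in> sections A E" for X Y
        unfolding \<Phi>_def by (simp add: chart_deriv_sec_add[OF t c that] chart_deriv_sec_add[OF t' c' that] linear_add[OF \<tau>])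
      show "\<Phi> (sec_scale E f X) = f m *\<^sub>R \<Phi> X" if f: "smooth_map A UNIV f" and X: "X \<in> sections A E" for f X
      proof -
        have "chart_deriv (V', \<kappa>') f m v = chart_deriv (V, \<kappa>) f m w"
          unfolding w_def by (rule chart_deriv_change[OF c c' open_UNIV _ f]) simp
        then show ?thesis unfolding \<Phi>_def
          by (simp add: chart_deriv_sec_scale[OF t c X f] chart_deriv_sec_scale[OF t' c' X f]
              linear_add[OF \<tau>] linear_scale[OF \<tau>] \<tau>' sec_in[OF X] scaleR_diff_right)
      qed
    qed
    then show ?thesis unfolding \<Phi>_def using D by simp
  qed
  then show ?thesis using eq unfolding same_jet_def by (auto simp: frechet_local_rep)
qed

end

section \<open>Lie algebroids\<close>

text \<open>The anchor in chart coordinates. The description is definite because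
  \<open>dir_deriv\<close> is injective in its vector argument.\<close>

definition anchor_vec ::
    "('m, 'e::real_normed_vector) chart set \<Rightarrow> ('m, 'v, 'r, 'z) lie_algebroid_scheme \<Rightarrow>
     ('m, 'e) chart \<Rightarrow> 'm \<Rightarrow> 'v \<Rightarrow> 'e" where
  "anchor_vec A L c p x = (THE v. anchor L p x = dir_deriv A c p v)"

locale algebroid = manifold A for A :: "('m::{t2_space,second_countable_topology}, 'e::real_inner) chart set" +
  fixes L :: "('m, 'v, 'r::real_normed_vector, 'z) lie_algebroid_scheme"
  assumes la: "lie_algebroid A L" and framed_fibre: "framed TYPE('r)"
begin

lemma lie_algebroid_facts:
  shows "vector_bundle A L" and anchor_map: "bundle_map A L (tangent_bundle A) (anchor L)"
    and "\<forall>X\<in>sections A L. \<forall>Y\<in>sections A L. bracket L X Y \<in> sections A L"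
    and "\<forall>X\<in>sections A L. \<forall>Y\<in>sections A L. \<forall>Z\<in>sections A L.
        bracket L X (sec_plus L Y Z) = sec_plus L (bracket L X Y) (bracket L X Z)"
    and "\<forall>X\<in>sections A L. \<forall>Y\<in>sections A L. bracket L Y X = sec_scale L (\<lambda>_. - 1) (bracket L X Y)"
    and "\<forall>X\<in>sections A L. \<forall>Y\<in>sections A L. \<forall>Z\<in>sections A L.
        bracket L X (bracket L Y Z) =
          sec_plus L (bracket L (bracket L X Y) Z) (bracket L Y (bracket L X Z))"
    and "\<forall>X\<in>sections A L. \<forall>Y\<in>sections A L. \<forall>f. smooth_map A UNIV f \<longrightarrow>
        bracket L X (sec_scale L f Y) =
          sec_plus L (sec_scale L f (bracket L X Y)) (sec_scale L (lie_derivative L X f) Y)"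
  using la unfolding lie_algebroid_def by - (elim conjE, assumption)+

sublocale vec_bundle A L
  by unfold_locales (fact lie_algebroid_facts framed_fibre)+

lemma bracket_sec: "X \<in> sections A L \<Longrightarrow> Y \<in> sections A L \<Longrightarrow> bracket L X Y \<in> sections A L"
  by (rule lie_algebroid_facts(3)[THEN bspec, THEN bspec])

lemma bracket_add_right: "X \<in> sections A L \<Longrightarrow> Y \<in> sections A L \<Longrightarrow> Z \<in> sections A L \<Longrightarrow>
    bracket L X (sec_plus L Y Z) = sec_plus L (bracket L X Y) (bracket L X Z)"
  by (rule lie_algebroid_facts(4)[THEN bspec, THEN bspec, THEN bspec])

lemma bracket_anti: "X \<in> sections A L \<Longrightarrow> Y \<in> sections A L \<Longrightarrow>
    bracket L Y X = sec_scale L (\<lambda>_. - 1) (bracket L X Y)"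
  by (rule lie_algebroid_facts(5)[THEN bspec, THEN bspec])

lemma jacobi: "X \<in> sections A L \<Longrightarrow> Y \<in> sections A L \<Longrightarrow> Z \<in> sections A L \<Longrightarrow>
    bracket L X (bracket L Y Z) = sec_plus L (bracket L (bracket L X Y) Z) (bracket L Y (bracket L X Z))"
  by (rule lie_algebroid_facts(6)[THEN bspec, THEN bspec, THEN bspec])

lemma leibniz: "X \<in> sections A L \<Longrightarrow> Y \<in> sections A L \<Longrightarrow> smooth_map A UNIV f \<Longrightarrow>
    bracket L X (sec_scale L f Y) =
      sec_plus L (sec_scale L f (bracket L X Y)) (sec_scale L (lie_derivative L X f) Y)"
  by (rule lie_algebroid_facts(7)[THEN bspec, THEN bspec, THEN spec, THEN mp])

lemma anchor_vec:
  assumes c: "(V, \<kappa>) \<in> A" "p \<in> V" and x: "x \<in> fibre L p"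
  shows "anchor L p x = dir_deriv A (V, \<kappa>) p (anchor_vec A L (V, \<kappa>) p x)"
proof -
  have "anchor L p x \<in> fibre (tangent_bundle A) p"
    using anchor_map x unfolding bundle_map_def by blast
  then obtain v where v: "anchor L p x = dir_deriv A (V, \<kappa>) p v"
    unfolding tangent_fibre[OF c] by auto
  show ?thesis unfolding anchor_vec_def
    by (rule theI[of _ v]) (use v dir_deriv_inj[OF c] in auto)
qed

lemma anchor_vecI:
  assumes c: "(V, \<kappa>) \<in> A" "p \<in> V" and "anchor L p x = dir_deriv A (V, \<kappa>) p v"
  shows "anchor_vec A L (V, \<kappa>) p x = v"
  unfolding anchor_vec_def using assms dir_deriv_inj[OF c] by (intro the_equality) auto

lemma lie_derivative_chart:
  assumes c: "(V, \<kappa>) \<in> A" "p \<in> V" and X: "X \<in> sections A L" and f: "smooth_map A UNIV f"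
  shows "lie_derivative L X f p = chart_deriv (V, \<kappa>) f p (anchor_vec A L (V, \<kappa>) p (X p))"
  using anchor_vec[OF c sec_in[OF X]] f by (simp add: lie_derivative_def dir_deriv_eq)

lemma triv_bracket_add_right:
  assumes t: "(U, \<phi>) \<in> triv L" "m \<in> U" and "X \<in> sections A L" "Y \<in> sections A L" "Z \<in> sections A L"
  shows "\<phi> m (bracket L X (sec_plus L Y Z) m) = \<phi> m (bracket L X Y m) + \<phi> m (bracket L X Z m)"
  unfolding bracket_add_right[OF assms(3-5)] using assms
  by (simp add: sec_plus_def triv_facts[OF t] sec_in bracket_sec)

lemma triv_bracket_anti:
  assumes t: "(U, \<phi>) \<in> triv L" "m \<in> U" and XY: "X \<in> sections A L" "Y \<in> sections A L"
  shows "\<phi> m (bracket L Y X m) = - \<phi> m (bracket L X Y m)"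
  unfolding bracket_anti[OF XY] by (simp add: sec_scale_def triv_facts[OF t] sec_in bracket_sec XY)

lemma triv_bracket_add_left:
  assumes t: "(U, \<phi>) \<in> triv L" "m \<in> U" and XYZ: "X \<in> sections A L" "Y \<in> sections A L" "Z \<in> sections A L"
  shows "\<phi> m (bracket L (sec_plus L Y Z) X m) = \<phi> m (bracket L Y X m) + \<phi> m (bracket L Z X m)"
  using triv_bracket_add_right[OF t XYZ] triv_bracket_anti[OF t XYZ(1) sec_plus_sec[OF XYZ(2,3)]]
    triv_bracket_anti[OF t XYZ(1,2)] triv_bracket_anti[OF t XYZ(1,3)] by simp

section \<open>Smoothness of the anchor and local form of the bracket\<close>

text \<open>By the Leibniz rule, \<open>[X, f E] - f [X, E] = (X f) E\<close>, and the left side is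
  a smooth section. If \<open>E\<close> is locally a constant \<open>w \<noteq> 0\<close> in a
  trivialization, a coordinate not vanishing on \<open>w\<close> reads off
  \<open>X f\<close>.\<close>

lemma lie_derivative_smooth:
  assumes X: "X \<in> sections A L" and f: "smooth_map A UNIV f"
  shows "smooth_map A UNIV (lie_derivative L X f)"
proof (cases "\<exists>w::'r. w \<noteq> 0")
  case False
  \<comment> \<open>In rank zero there is no such \<open>w\<close>, but then \<open>X\<close> is the
    zero section and its anchor vanishes by linearity.\<close>
  have "lie_derivative L X f p = 0" for p
  proof -
    obtain U \<phi> where t: "(U, \<phi>) \<in> triv L" "p \<in> U" using triv_at .
    have "\<phi> p (X p) = \<phi> p (vzero L p)" using False by metis
    then have "X p = vzero L p" using triv_inj[OF t sec_in[OF X] zero_in] by simp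
    then have "X p = vscale L p 0 (vzero L p)" using vscale_zero zero_in by simp
    moreover have "anchor L p (vscale L p 0 (vzero L p)) = vscale (tangent_bundle A) p 0 (anchor L p (vzero L p))"
      using anchor_map zero_in unfolding bundle_map_def by blast
    ultimately show ?thesis by (simp add: lie_derivative_def tangent_bundle_def)
  qed
  then show ?thesis using smooth_map_const[of UNIV "0::real"] by (metis (no_types, lifting) ext)
next
  case True
  then obtain w :: 'r where w: "w \<noteq> 0" by auto
  obtain n and b :: "nat \<Rightarrow> 'r" and l where e: "frame n b l"
    using framed_r by (auto simp: framed_def)
  have "\<exists>i<n. l i w \<noteq> 0" using frame_sum[OF e, of w] w by (metis (no_types, lifting) lessThan_iff scaleR_zero_left sum.neutral)
  then obtain i where i: "i < n" "l i w \<noteq> 0" by auto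
  have bl: "bounded_linear (l i)" using frame_bl[OF e i(1)] .
  show ?thesis
  proof (rule smooth_map_local)
    fix p
    obtain U \<phi> where t: "(U, \<phi>) \<in> triv L" "p \<in> U" using triv_at .
    obtain E O' where E: "E \<in> sections A L" "open O'" "p \<in> O'" "O' \<subseteq> U" "\<And>q. q \<in> O' \<Longrightarrow> \<phi> q (E q) = w"
      using sec_extend[OF t(1) triv_open[OF t(1)] t(2) order_refl smooth_map_const[of _ w]] by metis
    let ?Z = "sec_minus L (bracket L X (sec_scale L f E)) (sec_scale L f (bracket L X E))"
    have s: "sec_scale L f E \<in> sections A L" "bracket L X E \<in> sections A L"
      "bracket L X (sec_scale L f E) \<in> sections A L" "sec_scale L f (bracket L X E) \<in> sections A L"
      using X E f by (auto intro!: bracket_sec sec_scale_sec)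
    have "smooth_map A O' (\<lambda>q. \<phi> q (?Z q))"
      using smooth_map_subset[OF sec_smooth[OF sec_minus_sec[OF s(3,4)] t(1)] E(4)] .
    from smooth_map_bl[OF E(2) bounded_linear_mult_left smooth_map_bl[OF E(2) bl this], of "1 / l i w"]
    have "smooth_map A O' (\<lambda>q. l i (\<phi> q (?Z q)) * (1 / l i w))" .
    moreover have "l i (\<phi> q (?Z q)) * (1 / l i w) = lie_derivative L X f q" if q: "q \<in> O'" for q
    proof -
      have qU: "q \<in> U" using E q by auto
      have "\<phi> q (bracket L X (sec_scale L f E) q) = f q *\<^sub>R \<phi> q (bracket L X E q) + lie_derivative L X f q *\<^sub>R w"
        unfolding leibniz[OF X E(1) f]
        by (simp add: sec_plus_def sec_scale_def triv_facts[OF t(1) qU] sec_in s(2) E q)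
      then have "\<phi> q (?Z q) = lie_derivative L X f q *\<^sub>R w"
        by (simp add: sec_minus_def triv_minus[OF t(1) qU] sec_in s)
          (simp add: sec_scale_def triv_facts[OF t(1) qU] sec_in s)
      then show ?thesis using i linear_scale[OF bounded_linear.linear[OF bl]] by simp
    qed
    ultimately have "smooth_map A O' (lie_derivative L X f)" by (rule smooth_map_cong[OF E(2), rotated])
    then show "\<exists>N. open N \<and> p \<in> N \<and> smooth_map A N (lie_derivative L X f)" using E by blast
  qed
qed

text \<open>The coordinates of the anchor along a frame are Lie derivatives of global coordinate
  functions. Each of these is valid on its own neighbourhood, and finitely many are
  intersected.\<close>

lemma anchor_vec_smooth:
  assumes c: "(V, \<kappa>) \<in> A" and X: "X \<in> sections A L"
  shows "smooth_map A V (\<lambda>p. anchor_vec A L (V, \<kappa>) p (X p))"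
proof (rule smooth_map_local)
  fix p assume p: "p \<in> V"
  obtain n and b :: "nat \<Rightarrow> 'e" and l where e: "frame n b l"
    using framed_e by (auto simp: framed_def)
  have "\<exists>x N. smooth_map A UNIV x \<and> open N \<and> p \<in> N \<and> N \<subseteq> V \<and>
    (\<forall>q\<in>N. \<forall>v. chart_deriv (V, \<kappa>) x q v = l i v)" if "i < n" for i
    using coordinate_functions[OF c p frame_bl[OF e that]] by metis
  then obtain x N where xN: "\<And>i. i < n \<Longrightarrow> smooth_map A UNIV (x i) \<and> open (N i) \<and> p \<in> N i \<and> N i \<subseteq> V \<and>
    (\<forall>q\<in>N i. \<forall>v. chart_deriv (V, \<kappa>) (x i) q v = l i v)" by metis
  define M where "M = V \<inter> (\<Inter>i<n. N i)"
  have M: "open M" "p \<in> M" "M \<subseteq> V" using xN p chart_facts[OF c] by (auto simp: M_def)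
  have "smooth_map A M (\<lambda>q. \<Sum>i<n. lie_derivative L X (x i) q *\<^sub>R b i)"
    by (rule smooth_map_sum[OF M(1) smooth_map_scaleR[OF M(1) smooth_map_subset[OF lie_derivative_smooth[OF X]] smooth_map_const]])
      (use xN in auto)
  moreover have "(\<Sum>i<n. lie_derivative L X (x i) q *\<^sub>R b i) = anchor_vec A L (V, \<kappa>) q (X q)" if q: "q \<in> M" for q
  proof -
    have "lie_derivative L X (x i) q = l i (anchor_vec A L (V, \<kappa>) q (X q))" if "i < n" for i
      using lie_derivative_chart[OF c _ X, of q "x i"] xN[OF that] q M that by (auto simp: M_def)
    then have "(\<Sum>i<n. lie_derivative L X (x i) q *\<^sub>R b i) = (\<Sum>i<n. l i (anchor_vec A L (V, \<kappa>) q (X q)) *\<^sub>R b i)"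
      by simp
    then show ?thesis unfolding frame_sum[OF e] .
  qed
  ultimately have "smooth_map A M (\<lambda>p. anchor_vec A L (V, \<kappa>) p (X p))" by (rule smooth_map_cong[OF M(1), rotated])
  then show "\<exists>N. open N \<and> p \<in> N \<and> smooth_map A N (\<lambda>p. anchor_vec A L (V, \<kappa>) p (X p))" using M by blast
qed

lemma triv_leibniz:
  assumes t: "(U, \<phi>) \<in> triv L" "m \<in> U" and X: "X \<in> sections A L" and Y: "Y \<in> sections A L"
    and f: "smooth_map A UNIV f"
  shows "\<phi> m (bracket L X (sec_scale L f Y) m) = f m *\<^sub>R \<phi> m (bracket L X Y m) + lie_derivative L X f m *\<^sub>R \<phi> m (Y m)"
  unfolding leibniz[OF X Y f]
  by (simp add: sec_plus_def sec_scale_def triv_facts[OF t] sec_in X Y bracket_sec)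

lemma triv_leibniz_left:
  assumes t: "(U, \<phi>) \<in> triv L" "m \<in> U" and X: "X \<in> sections A L" and Y: "Y \<in> sections A L"
    and f: "smooth_map A UNIV f"
  shows "\<phi> m (bracket L (sec_scale L f Y) X m) = f m *\<^sub>R \<phi> m (bracket L Y X m) - lie_derivative L X f m *\<^sub>R \<phi> m (Y m)"
  using triv_leibniz[OF assms] triv_bracket_anti[OF t X sec_scale_sec[OF Y f]] triv_bracket_anti[OF t X Y]
  by simp

text \<open>The difference of the two sides is tensorial in \<open>Z\<close>: scaling
  \<open>Z\<close> by \<open>f\<close> adds the derivative of \<open>f\<close> along the anchor of
  \<open>X\<close> to both. With antisymmetry, this is why a bracket at \<open>m\<close> sees only
  the 1-jets of its arguments.\<close>

lemma bracket_vanishing: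
  assumes t: "(U, \<phi>) \<in> triv L" "m \<in> U" and c: "(V, \<kappa>) \<in> A" "m \<in> V"
    and X: "X \<in> sections A L" and Z: "Z \<in> sections A L" "Z m = vzero L m"
  shows "\<phi> m (bracket L X Z m) = chart_deriv (V, \<kappa>) (\<lambda>p. \<phi> p (Z p)) m (anchor_vec A L (V, \<kappa>) m (X m))"
proof -
  define \<Phi> where "\<Phi> Z = \<phi> m (bracket L X Z m) - chart_deriv (V, \<kappa>) (\<lambda>p. \<phi> p (Z p)) m (anchor_vec A L (V, \<kappa>) m (X m))" for Z
  have "\<Phi> Z = 0"
  proof (rule tensorial_zero[OF _ _ Z])
    show "\<Phi> (sec_plus L Y Z) = \<Phi> Y + \<Phi> Z" if "Y \<in> sections A L" "Z \<in> sections A L" for Y Z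
      unfolding \<Phi>_def by (simp add: triv_bracket_add_right[OF t X that] chart_deriv_sec_add[OF t c that])
    show "\<Phi> (sec_scale L f Y) = f m *\<^sub>R \<Phi> Y" if f: "smooth_map A UNIV f" and Y: "Y \<in> sections A L" for f Y
      unfolding \<Phi>_def
      by (simp add: triv_leibniz[OF t X Y f] chart_deriv_sec_scale[OF t c Y f] lie_derivative_chart[OF c X f]
          scaleR_diff_right)
  qed
  then show ?thesis by (simp add: \<Phi>_def)
qed

lemma triv_bracket_minus_right:
  assumes t: "(U, \<phi>) \<in> triv L" "m \<in> U" and XYZ: "X \<in> sections A L" "Y \<in> sections A L" "Z \<in> sections A L"
  shows "\<phi> m (bracket L X (sec_minus L Y Z) m) = \<phi> m (bracket L X Y m) - \<phi> m (bracket L X Z m)"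
proof -
  have c: "lie_derivative L X (\<lambda>_. - 1) m = 0"
    using chart_at[of m] lie_derivative_chart[OF _ _ XYZ(1) smooth_map_const] chart_deriv_const by metis
  show ?thesis unfolding sec_minus_eq
    using triv_bracket_add_right[OF t XYZ(1,2) sec_scale_sec[OF XYZ(3) smooth_map_const]]
      triv_leibniz[OF t XYZ(1,3) smooth_map_const] c by simp
qed

text \<open>After a trivialization, fibre operations become vector arithmetic. A chart is supplied
  as well because the statements about jets to which this is applied need both.\<close>

lemma sec_eqI:
  assumes "\<And>p. X p \<in> fibre L p" "\<And>p. Y p \<in> fibre L p"
    and "\<And>U \<phi> V \<kappa> p. (U, \<phi>) \<in> triv L \<Longrightarrow> p \<in> U \<Longrightarrow> (V, \<kappa>) \<in> A \<Longrightarrow> p \<in> V \<Longrightarrow> \<phi> p (X p) = \<phi> p (Y p)"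
  shows "X = Y"
proof
  fix p
  obtain U \<phi> where t: "(U, \<phi>) \<in> triv L" "p \<in> U" using triv_at .
  obtain V \<kappa> where c: "(V, \<kappa>) \<in> A" "p \<in> V" using chart_at .
  show "X p = Y p" using assms(3)[OF t c] triv_inj[OF t assms(1,2)] by simp
qed

lemma bracket_add_left: "X \<in> sections A L \<Longrightarrow> Y \<in> sections A L \<Longrightarrow> Z \<in> sections A L \<Longrightarrow>
    bracket L (sec_plus L Y Z) X = sec_plus L (bracket L Y X) (bracket L Z X)"
  by (rule sec_eqI)
    (simp_all add: triv_bracket_add_left sec_in sec_plus_sec bracket_sec,
     simp add: sec_plus_def triv_facts sec_in bracket_sec)

lemma leibniz_left: "X \<in> sections A L \<Longrightarrow> Y \<in> sections A L \<Longrightarrow> smooth_map A UNIV f \<Longrightarrow>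
    bracket L (sec_scale L f Y) X =
      sec_minus L (sec_scale L f (bracket L Y X)) (sec_scale L (lie_derivative L X f) Y)"
  by (rule sec_eqI)
    (simp_all add: triv_leibniz_left sec_in sec_minus_sec sec_scale_sec lie_derivative_smooth bracket_sec,
     simp add: sec_minus_def sec_scale_def triv_minus triv_facts sec_in bracket_sec)

end

section \<open>The jet algebroid\<close>

lemma same_jet_refl: "same_jet A E m X X"
  and same_jet_sym: "same_jet A E m X Y \<Longrightarrow> same_jet A E m Y X"
  and same_jet_trans: "same_jet A E m X Y \<Longrightarrow> same_jet A E m Y Z \<Longrightarrow> same_jet A E m X Z"
  unfolding same_jet_def by fastforce+

lemma same_jet_value: "same_jet A E m X Y \<Longrightarrow> X m = Y m"
  by (simp add: same_jet_def)

lemma same_jet_chart_deriv: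
  "same_jet A E m X Y \<Longrightarrow> (U, \<phi>) \<in> triv E \<Longrightarrow> m \<in> U \<Longrightarrow> (V, \<kappa>) \<in> A \<Longrightarrow> m \<in> V \<Longrightarrow>
    chart_deriv (V, \<kappa>) (\<lambda>p. \<phi> p (X p)) m = chart_deriv (V, \<kappa>) (\<lambda>p. \<phi> p (Y p)) m"
proof -
  assume sj: "same_jet A E m X Y" and t: "(U, \<phi>) \<in> triv E" "m \<in> U" and c: "(V, \<kappa>) \<in> A" "m \<in> V"
  have "\<forall>(U, \<phi>)\<in>triv E. \<forall>(V, \<kappa>)\<in>A. m \<in> U \<inter> V \<longrightarrow>
      chart_deriv (V, \<kappa>) (\<lambda>p. \<phi> p (X p)) m = chart_deriv (V, \<kappa>) (\<lambda>p. \<phi> p (Y p)) m"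
    using sj unfolding same_jet_def frechet_local_rep by (rule conjunct2)
  from bspec[OF bspec[OF this t(1), unfolded split_conv] c(1), unfolded split_conv] show ?thesis
    using t c by simp
qed

lemma jet_self: "X \<in> sections A E \<Longrightarrow> X \<in> jet A E X m"
  by (simp add: jet_def same_jet_refl)

lemma jet_cong: "same_jet A E m X Y \<Longrightarrow> jet A E X m = jet A E Y m"
proof -
  assume eq: "same_jet A E m X Y"
  show ?thesis unfolding jet_def
    using same_jet_trans[OF eq] same_jet_trans[OF same_jet_sym[OF eq]] by (intro Collect_cong) iprover
qed

lemma jet_eqD: "jet A E X m = jet A E Y m \<Longrightarrow> X \<in> sections A E \<Longrightarrow> same_jet A E m X Y"
  using jet_self[of X A E m] same_jet_sym by (fastforce simp: jet_def)

lemma jet_rep_jet: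
  assumes "X \<in> sections A E"
  shows "jet_rep (jet A E X m) \<in> sections A E" and "same_jet A E m X (jet_rep (jet A E X m))"
  using someI[of "\<lambda>Y. Y \<in> jet A E X m" X] jet_self[OF assms] by (simp_all add: jet_rep_def) (simp_all add: jet_def)

lemma jet_rep_fibre:
  assumes "\<xi> \<in> jet_fibre A E m"
  shows "jet_rep \<xi> \<in> sections A E" and "jet A E (jet_rep \<xi>) m = \<xi>"
proof -
  obtain X where X: "X \<in> sections A E" "\<xi> = jet A E X m" using assms by (auto simp: jet_fibre_def)
  show "jet_rep \<xi> \<in> sections A E" unfolding X(2) by (rule jet_rep_jet(1)[OF X(1)])
  show "jet A E (jet_rep \<xi>) m = \<xi>" unfolding X(2) by (rule jet_cong[OF jet_rep_jet(2)[OF X(1)], symmetric])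
qed

lemma jet_proj_jet: "X \<in> sections A E \<Longrightarrow> jet_proj m (jet A E X m) = X m"
  unfolding jet_proj_def by (rule same_jet_value[OF jet_rep_jet(2), symmetric])

text \<open>The trivialization of \<open>J\<^sup>1T\<close> that occurs inside
  \<open>jet_algebroid\<close>, named so that its value and derivative components can be treated
  separately.\<close>

definition jet_triv ::
    "('m, 'e::real_normed_vector) chart \<Rightarrow> ('m \<Rightarrow> 'v \<Rightarrow> 'r::real_normed_vector) \<Rightarrow>
     'm \<Rightarrow> ('m \<Rightarrow> 'v) set \<Rightarrow> 'r \<times> ('e \<Rightarrow>\<^sub>L 'r)" where
  "jet_triv c \<phi> = (\<lambda>m \<xi>. (\<phi> m (jet_proj m \<xi>),
     Blinfun (frechet_derivative (local_rep c \<phi> (jet_rep \<xi>)) (at (snd c m)))))"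

definition taut :: "('m \<Rightarrow> ('m \<Rightarrow> 'v) set) \<Rightarrow> 'm \<Rightarrow> 'v" where
  "taut X = (\<lambda>p. jet_proj p (X p))"

text \<open>The adjoint representation as an operation on sections. The representative
  \<open>jet_rep (X p)\<close> is chosen anew at each \<open>p\<close>, so smoothness in
  \<open>p\<close> is not evident.\<close>

definition nabla ::
    "('m, 'v, 'r, 'z) lie_algebroid_scheme \<Rightarrow> ('m \<Rightarrow> ('m \<Rightarrow> 'v) set) \<Rightarrow> ('m \<Rightarrow> 'v) \<Rightarrow> 'm \<Rightarrow> 'v" where
  "nabla T X V = (\<lambda>p. ad T p (X p) V)"

lemma fst_jet_triv: "fst (jet_triv c \<phi> m (X m)) = \<phi> m (taut X m)"
  by (simp add: jet_triv_def taut_def)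

locale jet_bracket = manifold A for A :: "('m::{t2_space,second_countable_topology}, 'e::real_inner) chart set" +
  fixes T :: "('m, 'v, 'r::real_inner) lie_algebroid"
    and B :: "('m \<Rightarrow> ('m \<Rightarrow> 'v) set) \<Rightarrow> ('m \<Rightarrow> ('m \<Rightarrow> 'v) set) \<Rightarrow> 'm \<Rightarrow> ('m \<Rightarrow> 'v) set"
  assumes T_la: "lie_algebroid A T" and B_jet: "is_jet_bracket A T B"
begin

abbreviation J where "J \<equiv> jet_algebroid A T B"

lemma framed_model: "framed TYPE('r)"
proof -
  have "vector_bundle A T" using T_la unfolding lie_algebroid_def by (rule conjunct1)
  then show ?thesis unfolding vector_bundle_def by (intro framed_inner) (erule conjunct1)
qed

sublocale T: algebroid A T
  by unfold_locales (fact T_la framed_model)+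

sublocale J: algebroid A J
proof unfold_locales
  show "lie_algebroid A J" using B_jet unfolding is_jet_bracket_def by (rule conjunct1)
  show "framed TYPE('r \<times> ('e \<Rightarrow>\<^sub>L 'r))" by (rule framed_prod_blinfun[OF framed_e framed_model])
qed

lemma bracket_jet: "X \<in> sections A T \<Longrightarrow> Y \<in> sections A T \<Longrightarrow>
    bracket J (jet A T X) (jet A T Y) = jet A T (bracket T X Y)"
  using B_jet unfolding is_jet_bracket_def by (simp add: jet_algebroid_def)

lemma fibre_J: "fibre J = jet_fibre A T"
  by (simp add: jet_algebroid_def)

lemma lie_derivative_J: "lie_derivative J X f = lie_derivative T (taut X) f"
  by (simp add: lie_derivative_def jet_algebroid_def taut_def)

lemma anchor_vec_J: "anchor_vec A J c p (X p) = anchor_vec A T c p (taut X p)"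
  by (simp add: anchor_vec_def jet_algebroid_def taut_def)

lemma jet_triv_in: "(U, \<phi>) \<in> triv T \<Longrightarrow> (V, \<kappa>) \<in> A \<Longrightarrow> (U \<inter> V, jet_triv (V, \<kappa>) \<phi>) \<in> triv J"
  unfolding jet_algebroid_def jet_triv_def by auto

lemma jet_in_fibre: "X \<in> sections A T \<Longrightarrow> jet A T X m \<in> fibre J m"
  by (auto simp: fibre_J jet_fibre_def)

lemma rep_sec:
  assumes "X \<in> sections A J"
  shows "jet_rep (X p) \<in> sections A T" and "jet A T (jet_rep (X p)) p = X p" and "jet_rep (X p) p = taut X p"
  using jet_rep_fibre[of "X p" A T p] J.sec_in[OF assms, of p] by (auto simp: fibre_J taut_def jet_proj_def)

lemma taut_sec:
  assumes X: "X \<in> sections A J"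
  shows "taut X \<in> sections A T"
proof (rule T.sections_localI)
  fix p
  show "taut X p \<in> fibre T p" using rep_sec[OF X, of p] T.sec_in by metis
  obtain U \<phi> where t: "(U, \<phi>) \<in> triv T" "p \<in> U" using T.triv_at .
  obtain V \<kappa> where c: "(V, \<kappa>) \<in> A" "p \<in> V" using chart_at .
  have o: "open (U \<inter> V)" using T.triv_open[OF t(1)] chart_facts(1)[OF c(1)] by auto
  have "smooth_map A (U \<inter> V) (\<lambda>q. fst (jet_triv (V, \<kappa>) \<phi> q (X q)))"
    by (rule smooth_map_bl[OF o bounded_linear_fst J.sec_smooth[OF X jet_triv_in[OF t(1) c(1)]]])
  then have "smooth_map A (U \<inter> V) (\<lambda>q. \<phi> q (taut X q))" unfolding fst_jet_triv .
  then show "\<exists>U \<phi> N. (U, \<phi>) \<in> triv T \<and> open N \<and> p \<in> N \<and> N \<subseteq> U \<and> smooth_map A N (\<lambda>q. \<phi> q (taut X q))"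
    using t c o by (intro exI[of _ U] exI[of _ \<phi>] exI[of _ "U \<inter> V"]) auto
qed

lemma taut_jet: "W \<in> sections A T \<Longrightarrow> taut (jet A T W) = W"
  by (rule ext) (simp add: taut_def jet_proj_jet)

section \<open>The adjoint action at a point, in coordinates\<close>

context
  fixes U \<phi> V \<kappa> p
  assumes t: "(U, \<phi>) \<in> triv T" "p \<in> U" and c: "(V, \<kappa>) \<in> A" "p \<in> V"
begin

lemma snd_jet_triv:
  assumes X: "X \<in> sections A J"
  shows "blinfun_apply (snd (jet_triv (V, \<kappa>) \<phi> p (X p))) = chart_deriv (V, \<kappa>) (\<lambda>q. \<phi> q (jet_rep (X p) q)) p"
  using chart_deriv_linear[OF c(1) T.triv_open[OF t(1)] c(2) t(2) T.sec_smooth[OF rep_sec(1)[OF X] t(1)]]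
  by (simp add: jet_triv_def frechet_local_rep bounded_linear_Blinfun_apply)

lemma jet_triv_jet:
  assumes W: "W \<in> sections A T"
  shows "jet_triv (V, \<kappa>) \<phi> p (jet A T W p) = (\<phi> p (W p), Blinfun (chart_deriv (V, \<kappa>) (\<lambda>q. \<phi> q (W q)) p))"
  using jet_proj_jet[OF W] same_jet_chart_deriv[OF jet_rep_jet(2)[OF W] t c]
  by (simp add: jet_triv_def frechet_local_rep)

text \<open>\<open>R - R'\<close> vanishes at \<open>p\<close> along with its derivative, and by
  \<open>bracket_vanishing\<close> its bracket with \<open>Z\<close> is a derivative of it along the
  anchor of \<open>Z\<close>.\<close>

lemma bracket_jet_eq:
  assumes R: "R \<in> sections A T" "R' \<in> sections A T" and Z: "Z \<in> sections A T" and eq: "R p = R' p"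
    and D: "chart_deriv (V, \<kappa>) (\<lambda>q. \<phi> q (R q)) p = chart_deriv (V, \<kappa>) (\<lambda>q. \<phi> q (R' q)) p"
  shows "\<phi> p (bracket T R Z p) = \<phi> p (bracket T R' Z p)"
proof -
  have "sec_minus T R R' p = vzero T p"
    using T.vminus_zero_iff T.sec_in R eq by (auto simp: sec_minus_def)
  from T.bracket_vanishing[OF t c Z T.sec_minus_sec[OF R] this]
  have "\<phi> p (bracket T Z (sec_minus T R R') p) = 0"
    by (simp add: T.chart_deriv_sec_minus[OF t c R] D)
  then show ?thesis
    using T.triv_bracket_minus_right[OF t Z R] T.triv_bracket_anti[OF t Z R(1)] T.triv_bracket_anti[OF t Z R(2)] by simp
qed

text \<open>\<open>jet_rep (X p)\<close> and \<open>taut X\<close> agree at \<open>p\<close>, so the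
  bracket of their difference with \<open>Z\<close> is given by a first derivative of that
  difference. The right side consists of data smooth in \<open>p\<close>, which is how
  \<open>nabla_sec\<close> obtains smoothness.\<close>

lemma triv_nabla_eq:
  assumes X: "X \<in> sections A J" and Z: "Z \<in> sections A T"
  shows "\<phi> p (nabla T X Z p) = \<phi> p (bracket T (taut X) Z p)
    + chart_deriv (V, \<kappa>) (\<lambda>q. \<phi> q (taut X q)) p (anchor_vec A T (V, \<kappa>) p (Z p))
    - blinfun_apply (snd (jet_triv (V, \<kappa>) \<phi> p (X p))) (anchor_vec A T (V, \<kappa>) p (Z p))"
proof -
  note R = rep_sec[OF X, of p] and a = taut_sec[OF X]
  have "sec_minus T (jet_rep (X p)) (taut X) p = vzero T p"
    using T.vminus_zero_iff T.sec_in R a by (auto simp: sec_minus_def)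
  from T.bracket_vanishing[OF t c Z T.sec_minus_sec[OF R(1) a] this]
  show ?thesis
    using T.triv_bracket_minus_right[OF t Z R(1) a] T.triv_bracket_anti[OF t Z R(1)] T.triv_bracket_anti[OF t Z a]
    by (simp add: T.chart_deriv_sec_minus[OF t c R(1) a] snd_jet_triv[OF X] nabla_def ad_def algebra_simps)
qed

lemma triv_nabla_add_right:
  assumes X: "X \<in> sections A J" and Z: "Z \<in> sections A T" "Z' \<in> sections A T"
  shows "\<phi> p (nabla T X (sec_plus T Z Z') p) = \<phi> p (nabla T X Z p) + \<phi> p (nabla T X Z' p)"
  using T.triv_bracket_add_right[OF t rep_sec(1)[OF X] Z] by (simp add: nabla_def ad_def)

lemma triv_nabla_minus_right:
  assumes X: "X \<in> sections A J" and Z: "Z \<in> sections A T" "Z' \<in> sections A T"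
  shows "\<phi> p (nabla T X (sec_minus T Z Z') p) = \<phi> p (nabla T X Z p) - \<phi> p (nabla T X Z' p)"
  using T.triv_bracket_minus_right[OF t rep_sec(1)[OF X] Z] by (simp add: nabla_def ad_def)

lemma triv_nabla_scale_right:
  assumes X: "X \<in> sections A J" and Z: "Z \<in> sections A T" and f: "smooth_map A UNIV f"
  shows "\<phi> p (nabla T X (sec_scale T f Z) p) = f p *\<^sub>R \<phi> p (nabla T X Z p) + lie_derivative T (taut X) f p *\<^sub>R \<phi> p (Z p)"
  using T.triv_leibniz[OF t rep_sec(1)[OF X] Z f] rep_sec(3)[OF X, of p]
  by (simp add: nabla_def ad_def lie_derivative_def)

text \<open>Lets the chosen representative be replaced by any convenient \<open>W\<close> with the
  same coordinates at \<open>p\<close>.\<close>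

lemma nabla_jet_triv:
  assumes W: "W \<in> sections A T" and X: "X \<in> sections A J" and Z: "Z \<in> sections A T"
    and eq: "taut X p = W p"
    and D: "blinfun_apply (snd (jet_triv (V, \<kappa>) \<phi> p (X p))) = chart_deriv (V, \<kappa>) (\<lambda>q. \<phi> q (W q)) p"
  shows "\<phi> p (nabla T X Z p) = \<phi> p (bracket T W Z p)"
  using bracket_jet_eq[OF rep_sec(1)[OF X] W Z] eq D rep_sec(3)[OF X] snd_jet_triv[OF X]
  by (simp add: nabla_def ad_def)

text \<open>\<open>jet_rep\<close> need not commute with addition, but the sum of the chosen
  representatives has the coordinates of the sum of the jets, and the bracket sees nothing
  else.\<close>

lemma triv_nabla_add_left:
  assumes X: "X \<in> sections A J" "Y \<in> sections A J" and Z: "Z \<in> sections A T"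
  shows "\<phi> p (nabla T (sec_plus J X Y) Z p) = \<phi> p (nabla T X Z p) + \<phi> p (nabla T Y Z p)"
proof -
  note tJ = jet_triv_in[OF t(1) c(1)]
  have pU: "p \<in> U \<inter> V" using t c by simp
  note R = rep_sec[OF X(1), of p] and R' = rep_sec[OF X(2), of p]
  let ?W = "sec_plus T (jet_rep (X p)) (jet_rep (Y p))"
  have s: "?W \<in> sections A T" "sec_plus J X Y \<in> sections A J" using R R' X T.sec_plus_sec J.sec_plus_sec by auto
  have e: "jet_triv (V, \<kappa>) \<phi> p (sec_plus J X Y p) = jet_triv (V, \<kappa>) \<phi> p (X p) + jet_triv (V, \<kappa>) \<phi> p (Y p)"
    using J.triv_facts(3)[OF tJ pU] J.sec_in X by (simp add: sec_plus_def)
  have "\<phi> p (taut (sec_plus J X Y) p) = \<phi> p (?W p)"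
    using arg_cong[OF e, of fst] R R' T.triv_facts(3)[OF t T.sec_in[OF R(1)] T.sec_in[OF R'(1)]]
    by (simp add: fst_jet_triv) (simp add: sec_plus_def)
  then have v: "taut (sec_plus J X Y) p = ?W p"
    using T.triv_inj[OF t T.sec_in[OF taut_sec[OF s(2)]] T.sec_in[OF s(1)]] by simp
  have d: "blinfun_apply (snd (jet_triv (V, \<kappa>) \<phi> p (sec_plus J X Y p))) = chart_deriv (V, \<kappa>) (\<lambda>q. \<phi> q (?W q)) p"
    by (rule ext) (simp add: e blinfun.add_left snd_jet_triv[OF X(1)] snd_jet_triv[OF X(2)]
        T.chart_deriv_sec_add[OF t c R(1) R'(1)])
  show ?thesis
    using nabla_jet_triv[OF s Z v d] T.triv_bracket_add_left[OF t Z R(1) R'(1)] by (simp add: nabla_def ad_def)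
qed

lemma triv_nabla_scale_left:
  assumes X: "X \<in> sections A J" and f: "smooth_map A UNIV f" and Z: "Z \<in> sections A T"
  shows "\<phi> p (nabla T (sec_scale J f X) Z p) = f p *\<^sub>R \<phi> p (nabla T X Z p)"
proof -
  note tJ = jet_triv_in[OF t(1) c(1)]
  have pU: "p \<in> U \<inter> V" using t c by simp
  note R = rep_sec[OF X(1), of p]
  \<comment> \<open>The value \<open>f p\<close> is frozen: scaling a jet at \<open>p\<close>
    multiplies a representative by a number, so no derivative of \<open>f\<close> appears.\<close>
  let ?W = "sec_scale T (\<lambda>_. f p) (jet_rep (X p))"
  have s: "?W \<in> sections A T" "sec_scale J f X \<in> sections A J"
    by (rule T.sec_scale_sec[OF R(1) smooth_map_const], rule J.sec_scale_sec[OF X f])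
  have e: "jet_triv (V, \<kappa>) \<phi> p (sec_scale J f X p) = f p *\<^sub>R jet_triv (V, \<kappa>) \<phi> p (X p)"
    using J.triv_facts(4)[OF tJ pU] J.sec_in X by (simp add: sec_scale_def)
  have "\<phi> p (taut (sec_scale J f X) p) = \<phi> p (?W p)"
    using arg_cong[OF e, of fst] R T.triv_facts(4)[OF t T.sec_in[OF R(1)]]
    by (simp add: fst_jet_triv) (simp add: sec_scale_def)
  then have v: "taut (sec_scale J f X) p = ?W p"
    using T.triv_inj[OF t T.sec_in[OF taut_sec[OF s(2)]] T.sec_in[OF s(1)]] by simp
  have d: "blinfun_apply (snd (jet_triv (V, \<kappa>) \<phi> p (sec_scale J f X p))) = chart_deriv (V, \<kappa>) (\<lambda>q. \<phi> q (?W q)) p"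
    by (rule ext) (simp add: e blinfun.scaleR_left snd_jet_triv[OF X(1)]
        T.chart_deriv_sec_scale[OF t c R(1) smooth_map_const] chart_deriv_const)
  have "lie_derivative T Z (\<lambda>_. f p) p = 0"
    by (simp add: T.lie_derivative_chart[OF c Z smooth_map_const] chart_deriv_const)
  then show ?thesis
    using nabla_jet_triv[OF s Z v d] T.triv_leibniz_left[OF t Z R(1) smooth_map_const[of _ "f p"]] by (simp add: nabla_def ad_def)
qed

end

lemma nabla_sec:
  assumes X: "X \<in> sections A J" and Z: "Z \<in> sections A T"
  shows "nabla T X Z \<in> sections A T"
proof (rule T.sections_localI)
  fix p
  show "nabla T X Z p \<in> fibre T p" by (simp add: nabla_def ad_def T.sec_in T.bracket_sec rep_sec X Z)
  obtain U \<phi> where t: "(U, \<phi>) \<in> triv T" "p \<in> U" using T.triv_at .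
  obtain V \<kappa> where c: "(V, \<kappa>) \<in> A" "p \<in> V" using chart_at .
  let ?N = "U \<inter> V"
  have o: "open ?N" using T.triv_open[OF t(1)] chart_facts(1)[OF c(1)] by auto
  have f: "smooth_map A ?N (\<lambda>q. \<phi> q (taut X q))"
    by (rule smooth_map_subset[OF T.sec_smooth[OF taut_sec[OF X] t(1)]]) auto
  have \<tau>: "smooth_map A ?N (\<lambda>q. anchor_vec A T (V, \<kappa>) q (Z q))"
    by (rule smooth_map_subset[OF T.anchor_vec_smooth[OF c(1) Z]]) auto
  have 1: "smooth_map A ?N (\<lambda>q. \<phi> q (bracket T (taut X) Z q))"
    by (rule smooth_map_subset[OF T.sec_smooth[OF T.bracket_sec[OF taut_sec[OF X] Z] t(1)]]) auto
  have 2: "smooth_map A ?N (\<lambda>q. blinfun_apply (Blinfun (chart_deriv (V, \<kappa>) (\<lambda>q. \<phi> q (taut X q)) q)) (anchor_vec A T (V, \<kappa>) q (Z q)))"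
    by (rule smooth_map_bilinear[OF o bounded_bilinear_blinfun_apply smooth_map_Blinfun_chart_deriv[OF c(1) o _ f] \<tau>]) auto
  have 3: "smooth_map A ?N (\<lambda>q. blinfun_apply (snd (jet_triv (V, \<kappa>) \<phi> q (X q))) (anchor_vec A T (V, \<kappa>) q (Z q)))"
    by (rule smooth_map_bilinear[OF o bounded_bilinear_blinfun_apply
          smooth_map_bl[OF o bounded_linear_snd J.sec_smooth[OF X jet_triv_in[OF t(1) c(1)]]] \<tau>])
  have "smooth_map A ?N (\<lambda>q. \<phi> q (nabla T X Z q))"
  proof (rule smooth_map_cong[OF o _ smooth_map_minus[OF o smooth_map_add[OF o 1 2] 3]])
    fix q assume q: "q \<in> ?N"
    have "bounded_linear (chart_deriv (V, \<kappa>) (\<lambda>q. \<phi> q (taut X q)) q)"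
      using chart_deriv_linear[OF c(1) o _ _ f, of q] q by auto
    then show "\<phi> q (bracket T (taut X) Z q) +
         blinfun_apply (Blinfun (chart_deriv (V, \<kappa>) (\<lambda>q. \<phi> q (taut X q)) q)) (anchor_vec A T (V, \<kappa>) q (Z q)) -
         blinfun_apply (snd (jet_triv (V, \<kappa>) \<phi> q (X q))) (anchor_vec A T (V, \<kappa>) q (Z q)) = \<phi> q (nabla T X Z q)"
      using triv_nabla_eq[OF t(1) _ c(1) _ X Z, of q] q by (simp add: bounded_linear_Blinfun_apply)
  qed
  then show "\<exists>U \<phi> N. (U, \<phi>) \<in> triv T \<and> open N \<and> p \<in> N \<and> N \<subseteq> U \<and> smooth_map A N (\<lambda>q. \<phi> q (nabla T X Z q))"
    using t c o by (intro exI[of _ U] exI[of _ \<phi>] exI[of _ "U \<inter> V"]) auto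
qed

lemma jet_sec:
  assumes W: "W \<in> sections A T"
  shows "jet A T W \<in> sections A J"
proof (rule J.sections_localI)
  fix p
  show "jet A T W p \<in> fibre J p" by (rule jet_in_fibre[OF W])
  obtain U \<phi> where t: "(U, \<phi>) \<in> triv T" "p \<in> U" using T.triv_at .
  obtain V \<kappa> where c: "(V, \<kappa>) \<in> A" "p \<in> V" using chart_at .
  let ?N = "U \<inter> V"
  have o: "open ?N" using T.triv_open[OF t(1)] chart_facts(1)[OF c(1)] by auto
  have f: "smooth_map A ?N (\<lambda>q. \<phi> q (W q))"
    by (rule smooth_map_subset[OF T.sec_smooth[OF W t(1)]]) auto
  have "smooth_map A ?N (\<lambda>q. (\<phi> q (W q), 0) + (0, Blinfun (chart_deriv (V, \<kappa>) (\<lambda>q. \<phi> q (W q)) q)))"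
    by (rule smooth_map_add[OF o smooth_map_bl[OF o bounded_linear_Pair[OF bounded_linear_ident bounded_linear_zero] f]
        smooth_map_bl[OF o bounded_linear_Pair[OF bounded_linear_zero bounded_linear_ident]
            smooth_map_Blinfun_chart_deriv[OF c(1) o _ f]]]) auto
  then have "smooth_map A ?N (\<lambda>q. jet_triv (V, \<kappa>) \<phi> q (jet A T W q))"
    by (rule smooth_map_cong[OF o, rotated]) (simp add: jet_triv_jet[OF t(1) _ c(1) _ W])
  then show "\<exists>U \<phi> N. (U, \<phi>) \<in> triv J \<and> open N \<and> p \<in> N \<and> N \<subseteq> U \<and> smooth_map A N (\<lambda>q. \<phi> q (jet A T W q))"
    using t c o jet_triv_in[OF t(1) c(1)] by (intro exI[of _ ?N] exI[of _ "jet_triv (V, \<kappa>) \<phi>"]) auto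
qed

section \<open>Compatibility with the tautological map\<close>

lemma taut_plus: "X \<in> sections A J \<Longrightarrow> Y \<in> sections A J \<Longrightarrow> taut (sec_plus J X Y) = sec_plus T (taut X) (taut Y)"
proof (rule T.sec_eqI)
  fix U \<phi> V \<kappa> p
  assume X: "X \<in> sections A J" "Y \<in> sections A J"
    and t: "(U, \<phi>) \<in> triv T" "p \<in> U" and c: "(V, \<kappa>) \<in> A" "p \<in> V"
  have "p \<in> U \<inter> V" using t c by auto
  from J.triv_facts(3)[OF jet_triv_in[OF t(1) c(1)] this J.sec_in[OF X(1)] J.sec_in[OF X(2)]]
  have "fst (jet_triv (V, \<kappa>) \<phi> p (sec_plus J X Y p)) = fst (jet_triv (V, \<kappa>) \<phi> p (X p)) + fst (jet_triv (V, \<kappa>) \<phi> p (Y p))"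
    by (simp add: sec_plus_def)
  then show "\<phi> p (taut (sec_plus J X Y) p) = \<phi> p (sec_plus T (taut X) (taut Y) p)"
    unfolding fst_jet_triv using X T.triv_facts(3)[OF t] by (simp add: sec_plus_def T.sec_in taut_sec)
qed (auto intro!: T.sec_in taut_sec J.sec_plus_sec T.sec_plus_sec)

lemma taut_scale: "X \<in> sections A J \<Longrightarrow> smooth_map A UNIV f \<Longrightarrow> taut (sec_scale J f X) = sec_scale T f (taut X)"
proof (rule T.sec_eqI)
  fix U \<phi> V \<kappa> p
  assume X: "X \<in> sections A J"
    and t: "(U, \<phi>) \<in> triv T" "p \<in> U" and c: "(V, \<kappa>) \<in> A" "p \<in> V"
  have "p \<in> U \<inter> V" using t c by auto
  from J.triv_facts(4)[OF jet_triv_in[OF t(1) c(1)] this J.sec_in[OF X(1)]]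
  have "fst (jet_triv (V, \<kappa>) \<phi> p (sec_scale J f X p)) = f p *\<^sub>R fst (jet_triv (V, \<kappa>) \<phi> p (X p))"
    by (simp add: sec_scale_def)
  then show "\<phi> p (taut (sec_scale J f X) p) = \<phi> p (sec_scale T f (taut X) p)"
    unfolding fst_jet_triv using X T.triv_facts(4)[OF t] by (simp add: sec_scale_def T.sec_in taut_sec)
qed (auto intro!: T.sec_in taut_sec J.sec_scale_sec T.sec_scale_sec)

text \<open>Every vector of \<open>J\<close> is the value of a holonomic section, so tensorial identities
  need only be checked on holonomic sections.\<close>

lemma jet_tensorial_zero:
  fixes \<Phi> :: "('m \<Rightarrow> ('m \<Rightarrow> 'v) set) \<Rightarrow> 'w::real_vector"
  assumes add: "\<And>X Y. X \<in> sections A J \<Longrightarrow> Y \<in> sections A J \<Longrightarrow> \<Phi> (sec_plus J X Y) = \<Phi> X + \<Phi> Y"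
    and scale: "\<And>f X. smooth_map A UNIV f \<Longrightarrow> X \<in> sections A J \<Longrightarrow> \<Phi> (sec_scale J f X) = f m *\<^sub>R \<Phi> X"
    and holonomic: "\<And>W. W \<in> sections A T \<Longrightarrow> \<Phi> (jet A T W) = 0"
    and X: "X \<in> sections A J"
  shows "\<Phi> X = 0"
  using J.tensorial_eq[OF add scale X jet_sec[OF rep_sec(1)[OF X]] rep_sec(2)[OF X, symmetric]]
    holonomic[OF rep_sec(1)[OF X]] by simp

text \<open>The defect \<open>\<Phi>\<close> is tensorial in each argument, since both brackets obey
  Leibniz rules with the same Lie derivatives. It vanishes on two holonomic sections by
  \<open>bracket_jet\<close>; the second argument is made arbitrary while the first is still
  holonomic, then the first.\<close>

lemma taut_bracket:
  assumes X: "X \<in> sections A J" and Y: "Y \<in> sections A J"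
  shows "taut (bracket J X Y) = bracket T (taut X) (taut Y)"
proof (rule T.sec_eqI)
  show "taut (bracket J X Y) p \<in> fibre T p" "bracket T (taut X) (taut Y) p \<in> fibre T p" for p
    using X Y by (auto intro!: T.sec_in taut_sec J.bracket_sec T.bracket_sec)
  fix U \<phi> V \<kappa> p
  assume t: "(U, \<phi>) \<in> triv T" "p \<in> U" and c: "(V, \<kappa>) \<in> A" "p \<in> V"
  note tJ = jet_triv_in[OF t(1) c(1)]
  have pU: "p \<in> U \<inter> V" using t c by simp
  define \<Phi> where "\<Phi> X Y = fst (jet_triv (V, \<kappa>) \<phi> p (bracket J X Y p)) - \<phi> p (bracket T (taut X) (taut Y) p)" for X Y
  have holonomic: "\<Phi> (jet A T W) Y = 0" if W: "W \<in> sections A T" and Y: "Y \<in> sections A J" for W Y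
  proof (rule jet_tensorial_zero[where \<Phi>="\<Phi> (jet A T W)" and m=p, OF _ _ _ Y])
    note a = jet_sec[OF W]
    show "\<Phi> (jet A T W) (sec_plus J X Y) = \<Phi> (jet A T W) X + \<Phi> (jet A T W) Y"
      if "X \<in> sections A J" "Y \<in> sections A J" for X Y
      unfolding \<Phi>_def by (simp add: taut_plus[OF that] J.triv_bracket_add_right[OF tJ pU a that]
          T.triv_bracket_add_right[OF t taut_sec[OF a] taut_sec[OF that(1)] taut_sec[OF that(2)]])
    show "\<Phi> (jet A T W) (sec_scale J f X) = f p *\<^sub>R \<Phi> (jet A T W) X"
      if f: "smooth_map A UNIV f" and X: "X \<in> sections A J" for f X
      unfolding \<Phi>_def
      by (simp add: taut_scale[OF X f] J.triv_leibniz[OF tJ pU a X f] T.triv_leibniz[OF t taut_sec[OF a] taut_sec[OF X] f]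
          lie_derivative_J fst_jet_triv scaleR_diff_right)
    show "\<Phi> (jet A T W) (jet A T W') = 0" if W': "W' \<in> sections A T" for W'
      unfolding \<Phi>_def bracket_jet[OF W W'] fst_jet_triv taut_jet[OF W] taut_jet[OF W']
        taut_jet[OF T.bracket_sec[OF W W']] by simp
  qed
  have "\<Phi> X Y = 0"
  proof (rule jet_tensorial_zero[where \<Phi>="\<lambda>X. \<Phi> X Y" and m=p, OF _ _ _ X])
    show "\<Phi> (sec_plus J X X') Y = \<Phi> X Y + \<Phi> X' Y"
      if "X \<in> sections A J" "X' \<in> sections A J" for X X'
      unfolding \<Phi>_def by (simp add: taut_plus[OF that] J.triv_bracket_add_left[OF tJ pU Y that]
          T.triv_bracket_add_left[OF t taut_sec[OF Y] taut_sec[OF that(1)] taut_sec[OF that(2)]])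
    show "\<Phi> (sec_scale J f X) Y = f p *\<^sub>R \<Phi> X Y"
      if f: "smooth_map A UNIV f" and X: "X \<in> sections A J" for f X
      unfolding \<Phi>_def
      by (simp add: taut_scale[OF X f] J.triv_leibniz_left[OF tJ pU Y X f] T.triv_leibniz_left[OF t taut_sec[OF Y] taut_sec[OF X] f]
          lie_derivative_J fst_jet_triv scaleR_diff_right)
  qed (rule holonomic[OF _ Y])
  then show "\<phi> p (taut (bracket J X Y) p) = \<phi> p (bracket T (taut X) (taut Y) p)"
    by (simp add: \<Phi>_def fst_jet_triv)
qed

lemma nabla_jet:
  assumes W: "W \<in> sections A T" and Z: "Z \<in> sections A T"
  shows "nabla T (jet A T W) Z = bracket T W Z"
proof (rule T.sec_eqI)
  show "nabla T (jet A T W) Z p \<in> fibre T p" "bracket T W Z p \<in> fibre T p" for p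
    using W Z by (auto intro!: T.sec_in nabla_sec jet_sec T.bracket_sec)
  fix U \<phi> V \<kappa> p
  assume t: "(U, \<phi>) \<in> triv T" "p \<in> U" and c: "(V, \<kappa>) \<in> A" "p \<in> V"
  show "\<phi> p (nabla T (jet A T W) Z p) = \<phi> p (bracket T W Z p)"
    using same_jet_chart_deriv[OF jet_rep_jet(2)[OF W] t c]
    by (intro nabla_jet_triv[OF t c W jet_sec[OF W] Z]) (simp_all add: snd_jet_triv[OF t c jet_sec[OF W]] taut_jet[OF W])
qed

lemma nabla_add_left: "X \<in> sections A J \<Longrightarrow> Y \<in> sections A J \<Longrightarrow> Z \<in> sections A T \<Longrightarrow>
   nabla T (sec_plus J X Y) Z = sec_plus T (nabla T X Z) (nabla T Y Z)"
  by (rule T.sec_eqI)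
    (auto intro!: T.sec_in nabla_sec J.sec_plus_sec T.sec_plus_sec simp: triv_nabla_add_left,
     auto simp: sec_plus_def T.triv_facts T.sec_in nabla_sec)

lemma nabla_scale_left: "X \<in> sections A J \<Longrightarrow> smooth_map A UNIV f \<Longrightarrow> Z \<in> sections A T \<Longrightarrow>
   nabla T (sec_scale J f X) Z = sec_scale T f (nabla T X Z)"
  by (rule T.sec_eqI)
    (auto intro!: T.sec_in nabla_sec J.sec_scale_sec T.sec_scale_sec simp: triv_nabla_scale_left,
     auto simp: sec_scale_def T.triv_facts T.sec_in nabla_sec)

end

section \<open>Spencer operator and torsion\<close>

definition spencer ::
    "('m, 'v, 'r, 'z) lie_algebroid_scheme \<Rightarrow> ('m \<Rightarrow> ('m \<Rightarrow> 'v) set) \<Rightarrow> ('m \<Rightarrow> 'v) \<Rightarrow> 'm \<Rightarrow> 'v" where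
  "spencer T X V = sec_minus T (nabla T X V) (bracket T (taut X) V)"

text \<open>The torsion as a section. Taking the bracket from a separate argument allows
  \<open>K = J\<close>, so that arbitrary sections of \<open>J\<close> can be inserted.\<close>

definition jet_torsion ::
    "('m, 'v, 'r, 'y) lie_algebroid_scheme \<Rightarrow> ('m, ('m \<Rightarrow> 'v) set, 'k, 'z) lie_algebroid_scheme \<Rightarrow>
     ('m \<Rightarrow> ('m \<Rightarrow> 'v) set) \<Rightarrow> ('m \<Rightarrow> ('m \<Rightarrow> 'v) set) \<Rightarrow> 'm \<Rightarrow> 'v" where
  "jet_torsion T K X Y = sec_minus T (sec_minus T (nabla T X (taut Y)) (nabla T Y (taut X))) (taut (bracket K X Y))"

text \<open>If \<open>X\<close> has components \<open>(u, L)\<close> in \<open>jet_triv c \<phi>\<close>, this is \<open>Du - L\<close>, the coordinate form of the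
  Spencer operator of \<open>X\<close>.\<close>

definition holonomy_defect ::
    "('m, 'e::real_normed_vector) chart \<Rightarrow> ('m \<Rightarrow> 'v \<Rightarrow> 'r::real_normed_vector) \<Rightarrow>
     ('m \<Rightarrow> ('m \<Rightarrow> 'v) set) \<Rightarrow> 'm \<Rightarrow> 'e \<Rightarrow>\<^sub>L 'r" where
  "holonomy_defect c \<phi> X q = Blinfun (chart_deriv c (\<lambda>q. \<phi> q (taut X q)) q) - snd (jet_triv c \<phi> q (X q))"

text \<open>Evaluation of an operator at a fixed vector is bounded linear and commutes with the
  outer derivative. What remains is an iterated directional derivative of the coordinate expression
  of \<open>f\<close>.\<close>

lemma (in manifold) chart_deriv_Blinfun_symmetric:
  fixes f :: "'m \<Rightarrow> 'b::real_normed_vector"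
  assumes fr: "framed TYPE('b)" and c: "(V, \<kappa>) \<in> A" and W: "open W" "W \<subseteq> V" "m \<in> W" and f: "smooth_map A W f"
  shows "blinfun_apply (chart_deriv (V, \<kappa>) (\<lambda>q. Blinfun (chart_deriv (V, \<kappa>) f q)) m a) b
    = blinfun_apply (chart_deriv (V, \<kappa>) (\<lambda>q. Blinfun (chart_deriv (V, \<kappa>) f q)) m b) a"
proof -
  let ?S = "\<kappa> ` (V \<inter> W)" and ?g = "\<lambda>x. f (inv_into V \<kappa> x)"
  have m: "m \<in> V" using W by auto
  have g: "smooth_on ?S ?g" using smooth_mapD[OF f c] .
  have S: "open ?S" "\<kappa> m \<in> ?S" using chart_open[OF c W(1)] W by auto
  have "blinfun_apply (chart_deriv (V, \<kappa>) (\<lambda>q. Blinfun (chart_deriv (V, \<kappa>) f q)) m a) b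
     = frechet_derivative (\<lambda>y. frechet_derivative ?g (at y) b) (at (\<kappa> m)) a" for a b
  proof -
    have "blinfun_apply (chart_deriv (V, \<kappa>) (\<lambda>q. Blinfun (chart_deriv (V, \<kappa>) f q)) m a) b
      = chart_deriv (V, \<kappa>) (\<lambda>q. blinfun_apply (Blinfun (chart_deriv (V, \<kappa>) f q)) b) m a"
      by (rule chart_deriv_bl[OF c W(1) m W(3) smooth_map_Blinfun_chart_deriv[OF c W(1,2) f]
            blinfun.bounded_linear_left, symmetric])
    also have "\<dots> = chart_deriv (V, \<kappa>) (\<lambda>q. chart_deriv (V, \<kappa>) f q b) m a"
    proof (rule fun_cong[OF chart_deriv_cong[OF c W(1) m W(3)]])
      fix q assume "q \<in> W"
      then show "blinfun_apply (Blinfun (chart_deriv (V, \<kappa>) f q)) b = chart_deriv (V, \<kappa>) f q b"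
        using bounded_linear_Blinfun_apply[OF chart_deriv_linear[OF c W(1) _ _ f]] W by auto
    qed
    also have "\<dots> = frechet_derivative (\<lambda>y. frechet_derivative ?g (at y) b) (at (\<kappa> m)) a"
      unfolding chart_deriv_def fst_conv snd_conv
      by (rule fun_cong[OF frechet_derivative_cong_open[OF S]]) (use chart_inv_in[OF _ c] in auto)
    finally show ?thesis .
  qed
  then show ?thesis using frechet_derivative_symmetric[OF fr S g] by metis
qed

context jet_bracket
begin

text \<open>The curvature \<open>\<Psi>\<close> is tensorial in \<open>X\<close> and
  \<open>Y\<close>. On holonomic sections the action is the bracket of \<open>T\<close>, and
  flatness is the Jacobi identity.\<close>

lemma nabla_flat:
  assumes X: "X \<in> sections A J" and Y: "Y \<in> sections A J" and Z: "Z \<in> sections A T"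
    and t: "(U, \<phi>) \<in> triv T" "p \<in> U" and c: "(V, \<kappa>) \<in> A" "p \<in> V"
  shows "\<phi> p (nabla T (bracket J X Y) Z p) = \<phi> p (nabla T X (nabla T Y Z) p) - \<phi> p (nabla T Y (nabla T X Z) p)"
proof -
  define \<Psi> where "\<Psi> X Y = \<phi> p (nabla T (bracket J X Y) Z p) - \<phi> p (nabla T X (nabla T Y Z) p) + \<phi> p (nabla T Y (nabla T X Z) p)" for X Y
  note nabla_simps = triv_nabla_add_left[OF t c] triv_nabla_scale_left[OF t c] triv_nabla_add_right[OF t c]
    triv_nabla_scale_right[OF t c] nabla_sec J.bracket_sec J.sec_scale_sec J.lie_derivative_smooth T.lie_derivative_smooth taut_sec smooth_map_const Z
  have holonomic: "\<Psi> (jet A T W) Y = 0" if W: "W \<in> sections A T" and Y: "Y \<in> sections A J" for W Y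
  proof (rule jet_tensorial_zero[where \<Phi>="\<Psi> (jet A T W)" and m=p, OF _ _ _ Y])
    note a = jet_sec[OF W]
    show "\<Psi> (jet A T W) (sec_plus J X Y) = \<Psi> (jet A T W) X + \<Psi> (jet A T W) Y"
      if s: "X \<in> sections A J" "Y \<in> sections A J" for X Y
      unfolding \<Psi>_def J.bracket_add_right[OF a s] nabla_add_left[OF s Z] by (simp add: nabla_simps a s)
    show "\<Psi> (jet A T W) (sec_scale J f X) = f p *\<^sub>R \<Psi> (jet A T W) X"
      if f: "smooth_map A UNIV f" and X: "X \<in> sections A J" for f X
      unfolding \<Psi>_def J.leibniz[OF a X f] nabla_scale_left[OF X f Z]
      by (simp add: nabla_simps a X f lie_derivative_J algebra_simps)
    show "\<Psi> (jet A T W) (jet A T W') = 0" if W': "W' \<in> sections A T" for W'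
    proof -
      have "\<Psi> (jet A T W) (jet A T W') = \<phi> p (bracket T (bracket T W W') Z p)
          - \<phi> p (bracket T W (bracket T W' Z) p) + \<phi> p (bracket T W' (bracket T W Z) p)"
        unfolding \<Psi>_def bracket_jet[OF W W'] nabla_jet[OF W Z] nabla_jet[OF W' Z]
          nabla_jet[OF T.bracket_sec[OF W W'] Z] nabla_jet[OF W T.bracket_sec[OF W' Z]]
          nabla_jet[OF W' T.bracket_sec[OF W Z]] ..
      moreover have "\<phi> p (bracket T W (bracket T W' Z) p) = \<phi> p (bracket T (bracket T W W') Z p) + \<phi> p (bracket T W' (bracket T W Z) p)"
        unfolding T.jacobi[OF W W' Z] using W W' Z
        by (simp add: sec_plus_def T.triv_facts[OF t] T.sec_in T.bracket_sec)
      ultimately show ?thesis by simp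
    qed
  qed
  have "\<Psi> X Y = 0"
  proof (rule jet_tensorial_zero[where \<Phi>="\<lambda>X. \<Psi> X Y" and m=p, OF _ _ _ X])
    show "\<Psi> (sec_plus J X X') Y = \<Psi> X Y + \<Psi> X' Y"
      if s: "X \<in> sections A J" "X' \<in> sections A J" for X X'
      unfolding \<Psi>_def J.bracket_add_left[OF Y s] nabla_add_left[OF s Z] by (simp add: nabla_simps Y s)
    show "\<Psi> (sec_scale J f X) Y = f p *\<^sub>R \<Psi> X Y"
      if f: "smooth_map A UNIV f" and X: "X \<in> sections A J" for f X
      unfolding \<Psi>_def J.leibniz_left[OF Y X f] nabla_scale_left[OF X f Z] J.sec_minus_eq
      by (simp add: nabla_simps Y X f lie_derivative_J algebra_simps)
  qed (rule holonomic[OF _ Y])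
  then show ?thesis by (simp add: \<Psi>_def diff_add_eq eq_diff_eq)
qed

lemma spencer_sec: "X \<in> sections A J \<Longrightarrow> Z \<in> sections A T \<Longrightarrow> spencer T X Z \<in> sections A T"
  unfolding spencer_def by (intro T.sec_minus_sec nabla_sec T.bracket_sec taut_sec)

lemma jet_torsion_sec: "X \<in> sections A J \<Longrightarrow> Y \<in> sections A J \<Longrightarrow> jet_torsion T J X Y \<in> sections A T"
  unfolding jet_torsion_def by (intro T.sec_minus_sec nabla_sec T.bracket_sec taut_sec J.bracket_sec)

section \<open>Pointwise identities for the Spencer operator and the torsion\<close>

context
  fixes U \<phi> V \<kappa> p
  assumes t: "(U, \<phi>) \<in> triv T" "p \<in> U" and c: "(V, \<kappa>) \<in> A" "p \<in> V"
begin

lemma triv_spencer: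
  assumes X: "X \<in> sections A J" and Z: "Z \<in> sections A T"
  shows "\<phi> p (spencer T X Z p) = \<phi> p (nabla T X Z p) - \<phi> p (bracket T (taut X) Z p)"
  using assms by (simp add: spencer_def sec_minus_def T.triv_minus[OF t] T.sec_in nabla_sec T.bracket_sec taut_sec)

lemma triv_jet_torsion:
  assumes X: "X \<in> sections A J" and Y: "Y \<in> sections A J"
  shows "\<phi> p (jet_torsion T J X Y p) = \<phi> p (nabla T X (taut Y) p) - \<phi> p (nabla T Y (taut X) p) - \<phi> p (bracket T (taut X) (taut Y) p)"
  using assms
  by (simp add: jet_torsion_def sec_minus_def T.triv_minus[OF t] T.sec_in nabla_sec T.bracket_sec taut_sec taut_bracket)

lemma triv_nabla_vanishing:
  assumes X: "X \<in> sections A J" and Z: "Z \<in> sections A T" "Z p = vzero T p"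
  shows "\<phi> p (nabla T X Z p) = chart_deriv (V, \<kappa>) (\<lambda>q. \<phi> q (Z q)) p (anchor_vec A T (V, \<kappa>) p (taut X p))"
  using T.bracket_vanishing[OF t c rep_sec(1)[OF X] Z] rep_sec(3)[OF X, of p] by (simp add: nabla_def ad_def)

lemma triv_spencer_defect:
  assumes X: "X \<in> sections A J" and Z: "Z \<in> sections A T"
  shows "\<phi> p (spencer T X Z p) = blinfun_apply (holonomy_defect (V, \<kappa>) \<phi> X p) (anchor_vec A T (V, \<kappa>) p (Z p))"
  using chart_deriv_linear[OF c(1) T.triv_open[OF t(1)] c(2) t(2) T.sec_smooth[OF taut_sec[OF X] t(1)]]
  by (simp add: triv_spencer[OF X Z] triv_nabla_eq[OF t c X Z] holonomy_defect_def blinfun.diff_left bounded_linear_Blinfun_apply)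

text \<open>The difference of \<open>taut Y\<close> and \<open>taut Y'\<close> vanishes at
  \<open>p\<close>. Both the action of \<open>X\<close> and the bracket with \<open>taut X\<close>
  differentiate such a section along the same anchor, so their changes cancel; the remaining term
  sees only \<open>Y p\<close>.\<close>

lemma jet_torsion_eq_right:
  assumes X: "X \<in> sections A J" and Y: "Y \<in> sections A J" and Y': "Y' \<in> sections A J" and eq: "Y p = Y' p"
  shows "\<phi> p (jet_torsion T J X Y p) = \<phi> p (jet_torsion T J X Y' p)"
proof -
  note a = taut_sec[OF X] taut_sec[OF Y] taut_sec[OF Y']
  let ?Z = "sec_minus T (taut Y) (taut Y')"
  have Z: "?Z \<in> sections A T" using a T.sec_minus_sec by auto
  have "taut Y p = taut Y' p" using eq by (simp add: taut_def)
  then have "?Z p = vzero T p" using T.vminus_zero_iff T.sec_in a by (auto simp: sec_minus_def)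
  from triv_nabla_vanishing[OF X Z this] T.bracket_vanishing[OF t c a(1) Z this]
  have "\<phi> p (nabla T X (taut Y) p) - \<phi> p (nabla T X (taut Y') p)
      = \<phi> p (bracket T (taut X) (taut Y) p) - \<phi> p (bracket T (taut X) (taut Y') p)"
    using triv_nabla_minus_right[OF t c X a(2,3)] T.triv_bracket_minus_right[OF t a] by simp
  moreover have "nabla T Y (taut X) p = nabla T Y' (taut X) p" using eq by (simp add: nabla_def)
  ultimately show ?thesis by (simp add: triv_jet_torsion[OF X Y] triv_jet_torsion[OF X Y'] algebra_simps)
qed

lemma jet_torsion_anti:
  assumes X: "X \<in> sections A J" and Y: "Y \<in> sections A J"
  shows "\<phi> p (jet_torsion T J X Y p) = - \<phi> p (jet_torsion T J Y X p)"
  using T.triv_bracket_anti[OF t taut_sec[OF X] taut_sec[OF Y]] by (simp add: triv_jet_torsion[OF X Y] triv_jet_torsion[OF Y X])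

lemma jet_torsion_cong:
  assumes X: "X \<in> sections A J" "X' \<in> sections A J" "X p = X' p" and Y: "Y \<in> sections A J" "Y' \<in> sections A J" "Y p = Y' p"
  shows "jet_torsion T J X Y p = jet_torsion T J X' Y' p"
proof -
  have "\<phi> p (jet_torsion T J X Y p) = \<phi> p (jet_torsion T J X' Y' p)"
    using jet_torsion_eq_right[OF X(1) Y] jet_torsion_eq_right[OF Y(2) X] jet_torsion_anti[OF X(1) Y(2)] jet_torsion_anti[OF X(2) Y(2)] by simp
  then show ?thesis using T.triv_inj[OF t] T.sec_in jet_torsion_sec X Y by metis
qed

text \<open>Flatness turns the actions of \<open>bracket J X Y\<close> and
  \<open>bracket J X Z\<close> into commutators, and the Jacobi identity disposes of the triple
  brackets. In what is left, each action of \<open>X\<close> is paired with the bracket by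
  \<open>taut X\<close>, which is \<open>spencer T X\<close>.\<close>

lemma jet_torsion_derivative:
  assumes X: "X \<in> sections A J" and Y: "Y \<in> sections A J" and Z: "Z \<in> sections A J"
  shows "\<phi> p (nabla T X (jet_torsion T J Y Z) p) - \<phi> p (jet_torsion T J (bracket J X Y) Z p) - \<phi> p (jet_torsion T J Y (bracket J X Z) p)
    = \<phi> p (nabla T Y (spencer T X (taut Z)) p) - \<phi> p (nabla T Z (spencer T X (taut Y)) p)
      - \<phi> p (spencer T X (bracket T (taut Y) (taut Z)) p)"
proof -
  note s = X Y Z taut_sec[OF X] taut_sec[OF Y] taut_sec[OF Z]
  have j: "\<phi> p (bracket T (taut X) (bracket T (taut Y) (taut Z)) p) =
    \<phi> p (bracket T (bracket T (taut X) (taut Y)) (taut Z) p) + \<phi> p (bracket T (taut Y) (bracket T (taut X) (taut Z)) p)"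
    unfolding T.jacobi[OF s(4-6)] using s by (simp add: sec_plus_def T.triv_facts[OF t] T.sec_in T.bracket_sec)
  have 1: "\<phi> p (nabla T X (jet_torsion T J Y Z) p) = \<phi> p (nabla T X (nabla T Y (taut Z)) p) - \<phi> p (nabla T X (nabla T Z (taut Y)) p)
    - \<phi> p (nabla T X (bracket T (taut Y) (taut Z)) p)"
    unfolding jet_torsion_def using s
    by (simp add: triv_nabla_minus_right[OF t c] nabla_sec T.sec_minus_sec T.bracket_sec taut_bracket)
  have 2: "\<phi> p (jet_torsion T J (bracket J X Y) Z p) = \<phi> p (nabla T X (nabla T Y (taut Z)) p) - \<phi> p (nabla T Y (nabla T X (taut Z)) p)
    - \<phi> p (nabla T Z (bracket T (taut X) (taut Y)) p) - \<phi> p (bracket T (bracket T (taut X) (taut Y)) (taut Z) p)"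
    using s by (simp add: triv_jet_torsion J.bracket_sec taut_bracket nabla_flat[OF _ _ _ t c])
  have 3: "\<phi> p (jet_torsion T J Y (bracket J X Z) p) = \<phi> p (nabla T Y (bracket T (taut X) (taut Z)) p)
    - (\<phi> p (nabla T X (nabla T Z (taut Y)) p) - \<phi> p (nabla T Z (nabla T X (taut Y)) p))
    - \<phi> p (bracket T (taut Y) (bracket T (taut X) (taut Z)) p)"
    using s by (simp add: triv_jet_torsion J.bracket_sec taut_bracket nabla_flat[OF _ _ _ t c])
  have 4: "\<phi> p (nabla T W (spencer T X V) p) = \<phi> p (nabla T W (nabla T X V) p) - \<phi> p (nabla T W (bracket T (taut X) V) p)"
    if "W \<in> sections A J" "V \<in> sections A T" for W V
    unfolding spencer_def using s that by (simp add: triv_nabla_minus_right[OF t c] nabla_sec T.bracket_sec)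
  show ?thesis
    unfolding 1 2 3 4[OF Y s(6)] 4[OF Z s(5)] triv_spencer[OF X T.bracket_sec[OF s(5,6)]] j by simp
qed

lemma smooth_taut: "X \<in> sections A J \<Longrightarrow> smooth_map A (U \<inter> V) (\<lambda>q. \<phi> q (taut X q))"
  by (rule smooth_map_subset[OF T.sec_smooth[OF taut_sec t(1)]]) auto

lemma open_UV: "open (U \<inter> V)" and p_UV: "p \<in> U \<inter> V"
  using T.triv_open[OF t(1)] chart_facts(1)[OF c(1)] t c by auto

lemma smooth_jet_triv: "X \<in> sections A J \<Longrightarrow> smooth_map A (U \<inter> V) (\<lambda>q. jet_triv (V, \<kappa>) \<phi> q (X q))"
  by (rule J.sec_smooth[OF _ jet_triv_in[OF t(1) c(1)]])

lemma smooth_defect: "X \<in> sections A J \<Longrightarrow> smooth_map A (U \<inter> V) (holonomy_defect (V, \<kappa>) \<phi> X)"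
  unfolding holonomy_defect_def
  by (rule smooth_map_minus[OF open_UV smooth_map_Blinfun_chart_deriv[OF c(1) open_UV _ smooth_taut]
      smooth_map_bl[OF open_UV bounded_linear_snd smooth_jet_triv]]) auto

text \<open>\<open>spencer T X Z\<close> vanishes at \<open>p\<close>, so \<open>Y\<close> acts on
  it by a plain derivative along its anchor. It is the defect applied to the anchor of
  \<open>Z\<close>; the product-rule term that differentiates this anchor is multiplied by the
  defect at \<open>p\<close>, which is \<open>0\<close>.\<close>

lemma triv_nabla_spencer:
  assumes X: "X \<in> sections A J" and Y: "Y \<in> sections A J" and Z: "Z \<in> sections A T"
    and H: "holonomy_defect (V, \<kappa>) \<phi> X p = 0"
  shows "\<phi> p (nabla T Y (spencer T X Z) p) = blinfun_apply
    (chart_deriv (V, \<kappa>) (holonomy_defect (V, \<kappa>) \<phi> X) p (anchor_vec A T (V, \<kappa>) p (taut Y p)))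
    (anchor_vec A T (V, \<kappa>) p (Z p))"
proof -
  note S = spencer_sec[OF X Z]
  have "\<phi> p (spencer T X Z p) = \<phi> p (vzero T p)"
    using triv_spencer_defect[OF X Z] H T.triv_facts(2)[OF t] by simp
  then have S0: "spencer T X Z p = vzero T p" using T.triv_inj[OF t T.sec_in[OF S] T.zero_in] by simp
  have "\<phi> p (nabla T Y (spencer T X Z) p) =
      chart_deriv (V, \<kappa>) (\<lambda>q. \<phi> q (spencer T X Z q)) p (anchor_vec A T (V, \<kappa>) p (taut Y p))"
    by (rule triv_nabla_vanishing[OF Y S S0])
  \<comment> \<open>The identity is used at every \<open>q\<close> near \<open>p\<close>, whereas
    the surrounding context fixes \<open>p\<close>; hence the fact in its exported form.\<close>
  also have "chart_deriv (V, \<kappa>) (\<lambda>q. \<phi> q (spencer T X Z q)) p = chart_deriv (V, \<kappa>)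
      (\<lambda>q. blinfun_apply (holonomy_defect (V, \<kappa>) \<phi> X q) (anchor_vec A T (V, \<kappa>) q (Z q))) p"
    by (rule chart_deriv_cong[OF c(1) open_UV c(2) p_UV])
      (use jet_bracket.triv_spencer_defect[OF jet_bracket_axioms t(1) _ c(1) _ X Z] in auto)
  also have "\<dots> (anchor_vec A T (V, \<kappa>) p (taut Y p)) = blinfun_apply
    (chart_deriv (V, \<kappa>) (holonomy_defect (V, \<kappa>) \<phi> X) p (anchor_vec A T (V, \<kappa>) p (taut Y p)))
    (anchor_vec A T (V, \<kappa>) p (Z p))"
    using chart_deriv_bilinear[OF c(1) open_UV c(2) p_UV smooth_defect[OF X]
        smooth_map_subset[OF T.anchor_vec_smooth[OF c(1) Z]] bounded_bilinear_blinfun_apply] H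
    by simp
  finally show ?thesis .
qed

lemma jet_torsion_derivative_defect:
  assumes X: "X \<in> sections A J" and Y: "Y \<in> sections A J" and Z: "Z \<in> sections A J"
    and H: "holonomy_defect (V, \<kappa>) \<phi> X p = 0"
  shows "\<phi> p (nabla T X (jet_torsion T J Y Z) p) - \<phi> p (jet_torsion T J (bracket J X Y) Z p) - \<phi> p (jet_torsion T J Y (bracket J X Z) p)
    = blinfun_apply
        (chart_deriv (V, \<kappa>) (holonomy_defect (V, \<kappa>) \<phi> X) p (anchor_vec A T (V, \<kappa>) p (taut Y p)))
        (anchor_vec A T (V, \<kappa>) p (taut Z p))
      - blinfun_apply
        (chart_deriv (V, \<kappa>) (holonomy_defect (V, \<kappa>) \<phi> X) p (anchor_vec A T (V, \<kappa>) p (taut Z p)))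
        (anchor_vec A T (V, \<kappa>) p (taut Y p))"
  unfolding jet_torsion_derivative[OF X Y Z]
    triv_nabla_spencer[OF X Y taut_sec[OF Z] H] triv_nabla_spencer[OF X Z taut_sec[OF Y] H]
    triv_spencer_defect[OF X T.bracket_sec[OF taut_sec[OF Y] taut_sec[OF Z]]] H by simp

section \<open>Recognizing jets of holonomic sections\<close>

text \<open>The derivative of the \<open>Du\<close> part of the defect is symmetric in any case, so
  asymmetry can come only from the second component of \<open>X\<close>.\<close>

lemma defect_symmetric_iff:
  assumes X: "X \<in> sections A J"
  shows "(blinfun_apply (chart_deriv (V, \<kappa>) (holonomy_defect (V, \<kappa>) \<phi> X) p a) b
     = blinfun_apply (chart_deriv (V, \<kappa>) (holonomy_defect (V, \<kappa>) \<phi> X) p b) a) \<longleftrightarrow>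
    (blinfun_apply (chart_deriv (V, \<kappa>) (\<lambda>q. snd (jet_triv (V, \<kappa>) \<phi> q (X q))) p a) b
     = blinfun_apply (chart_deriv (V, \<kappa>) (\<lambda>q. snd (jet_triv (V, \<kappa>) \<phi> q (X q))) p b) a)"
proof -
  have s1: "smooth_map A (U \<inter> V) (\<lambda>q. Blinfun (chart_deriv (V, \<kappa>) (\<lambda>q. \<phi> q (taut X q)) q))"
    by (rule smooth_map_Blinfun_chart_deriv[OF c(1) open_UV _ smooth_taut[OF X]]) simp
  have s2: "smooth_map A (U \<inter> V) (\<lambda>q. snd (jet_triv (V, \<kappa>) \<phi> q (X q)))"
    by (rule smooth_map_bl[OF open_UV bounded_linear_snd smooth_jet_triv[OF X]])
  have "chart_deriv (V, \<kappa>) (holonomy_defect (V, \<kappa>) \<phi> X) p =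
    (\<lambda>a. chart_deriv (V, \<kappa>) (\<lambda>q. Blinfun (chart_deriv (V, \<kappa>) (\<lambda>q. \<phi> q (taut X q)) q)) p a
      - chart_deriv (V, \<kappa>) (\<lambda>q. snd (jet_triv (V, \<kappa>) \<phi> q (X q))) p a)"
    unfolding holonomy_defect_def
    by (rule chart_derivI[OF has_derivative_diff[OF chart_deriv_has_derivative[OF c(1) open_UV c(2) p_UV s1]
          chart_deriv_has_derivative[OF c(1) open_UV c(2) p_UV s2]]])
  then show ?thesis
    using chart_deriv_Blinfun_symmetric[OF framed_model c(1) open_UV _ p_UV smooth_taut[OF X], of a b]
    by (simp add: blinfun.diff_left)
qed

text \<open>The derivative of the defect involves second derivatives of \<open>taut X\<close>, which
  the 1-jet of \<open>X\<close> does not determine; \<open>defect_symmetric_iff\<close> removes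
  them, so the forward direction may replace \<open>X\<close> by \<open>jet A T W\<close>.
  Conversely, the symmetric derivative of the second component serves as the Hessian of a section to
  be constructed.\<close>

lemma holonomic_extension_iff:
  assumes X: "X \<in> sections A J"
  shows "(\<exists>W\<in>sections A T. jet A J X p = jet A J (jet A T W) p) \<longleftrightarrow>
    holonomy_defect (V, \<kappa>) \<phi> X p = 0 \<and>
    (\<forall>a b. blinfun_apply (chart_deriv (V, \<kappa>) (holonomy_defect (V, \<kappa>) \<phi> X) p a) b
      = blinfun_apply (chart_deriv (V, \<kappa>) (holonomy_defect (V, \<kappa>) \<phi> X) p b) a)"
    (is "?P \<longleftrightarrow> ?H \<and> ?S")
proof
  note tJ = jet_triv_in[OF t(1) c(1)]
  assume ?P
  then obtain W where W: "W \<in> sections A T" "jet A J X p = jet A J (jet A T W) p" by auto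
  have sj: "same_jet A J p X (jet A T W)" by (rule jet_eqD[OF W(2) X])
  have eq: "X p = jet A T W p" by (rule same_jet_value[OF sj])
  have D: "chart_deriv (V, \<kappa>) (\<lambda>q. jet_triv (V, \<kappa>) \<phi> q (X q)) p
      = chart_deriv (V, \<kappa>) (\<lambda>q. jet_triv (V, \<kappa>) \<phi> q (jet A T W q)) p"
    by (rule same_jet_chart_deriv[OF sj tJ p_UV c])
  note bl = chart_deriv_bl[OF c(1) open_UV c(2) p_UV smooth_jet_triv]
  have "chart_deriv (V, \<kappa>) (\<lambda>q. fst (jet_triv (V, \<kappa>) \<phi> q (X q))) p v
      = chart_deriv (V, \<kappa>) (\<lambda>q. fst (jet_triv (V, \<kappa>) \<phi> q (jet A T W q))) p v" for v
    unfolding bl[OF X bounded_linear_fst] bl[OF jet_sec[OF W(1)] bounded_linear_fst] D ..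
  then have 1: "chart_deriv (V, \<kappa>) (\<lambda>q. \<phi> q (taut X q)) p = chart_deriv (V, \<kappa>) (\<lambda>q. \<phi> q (W q)) p"
    unfolding fst_jet_triv taut_jet[OF W(1)] by (rule ext)
  have ?H unfolding holonomy_defect_def eq jet_triv_jet[OF t c W(1)] 1 by simp
  moreover have ?S
  proof (intro allI)
    fix a b
    let ?D = "chart_deriv (V, \<kappa>) (\<lambda>q. Blinfun (chart_deriv (V, \<kappa>) (\<lambda>q. \<phi> q (W q)) q)) p"
    have f: "smooth_map A (U \<inter> V) (\<lambda>q. \<phi> q (W q))" by (rule smooth_map_subset[OF T.sec_smooth[OF W(1) t(1)]]) auto
    have 2: "chart_deriv (V, \<kappa>) (\<lambda>q. snd (jet_triv (V, \<kappa>) \<phi> q (X q))) p v = ?D v" for v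
    proof -
      have "chart_deriv (V, \<kappa>) (\<lambda>q. snd (jet_triv (V, \<kappa>) \<phi> q (X q))) p v
        = chart_deriv (V, \<kappa>) (\<lambda>q. snd (jet_triv (V, \<kappa>) \<phi> q (jet A T W q))) p v"
        unfolding bl[OF X bounded_linear_snd] bl[OF jet_sec[OF W(1)] bounded_linear_snd] D ..
      also have "\<dots> = ?D v"
        by (rule fun_cong[OF chart_deriv_cong[OF c(1) open_UV c(2) p_UV]])
          (simp add: jet_bracket.jet_triv_jet[OF jet_bracket_axioms t(1) _ c(1) _ W(1)])
      finally show ?thesis .
    qed
    show "blinfun_apply (chart_deriv (V, \<kappa>) (holonomy_defect (V, \<kappa>) \<phi> X) p a) b
      = blinfun_apply (chart_deriv (V, \<kappa>) (holonomy_defect (V, \<kappa>) \<phi> X) p b) a"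
      unfolding defect_symmetric_iff[OF X] 2
      by (rule chart_deriv_Blinfun_symmetric[OF framed_model c(1) open_UV _ p_UV f]) simp
  qed
  ultimately show "?H \<and> ?S" ..
next
  note tJ = jet_triv_in[OF t(1) c(1)]
  assume HS: "?H \<and> ?S"
  define u0 where "u0 = \<phi> p (taut X p)"
  define L0 where "L0 = snd (jet_triv (V, \<kappa>) \<phi> p (X p))"
  define M where "M = chart_deriv (V, \<kappa>) (\<lambda>q. snd (jet_triv (V, \<kappa>) \<phi> q (X q))) p"
  define x0 where "x0 = \<kappa> p"
  have snd_smooth: "smooth_map A (U \<inter> V) (\<lambda>q. snd (jet_triv (V, \<kappa>) \<phi> q (X q)))"
    by (rule smooth_map_bl[OF open_UV bounded_linear_snd smooth_jet_triv[OF X]])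
  have M: "bounded_linear M" unfolding M_def
    by (rule chart_deriv_linear[OF c(1) open_UV c(2) p_UV snd_smooth])
  have sym: "blinfun_apply (M a) b = blinfun_apply (M b) a" for a b
    using HS unfolding defect_symmetric_iff[OF X] M_def by blast
  \<comment> \<open>Value \<open>u0\<close>, derivative \<open>L0\<close> and Hessian
    \<open>M\<close> at \<open>x0\<close>. In \<open>Dw\<close> the symmetry of \<open>M\<close>
    merges the two halves of the differentiated quadratic term.\<close>
  define w where "w x = u0 + (blinfun_apply L0 (x + - x0) + (1/2) *\<^sub>R blinfun_apply (M (x + - x0)) (x + - x0))" for x
  have Dw: "(w has_derivative (\<lambda>v. blinfun_apply (L0 + M (x - x0)) v)) (at x)" for x
  proof -
    have "(w has_derivative (\<lambda>v. blinfun_apply L0 v + (1/2) *\<^sub>R (blinfun_apply (M (x - x0)) v + blinfun_apply (M v) (x - x0)))) (at x)"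
      unfolding w_def
      by (auto intro!: derivative_eq_intros bounded_linear.has_derivative[OF M])
    moreover have "(1/2) *\<^sub>R (blinfun_apply (M (x - x0)) v + blinfun_apply (M v) (x - x0)) = blinfun_apply (M (x - x0)) v" for v
      unfolding sym[of v] scaleR_half_double ..
    ultimately show ?thesis by (simp add: blinfun.add_left)
  qed
  have tr: "smooth_on UNIV (\<lambda>x. x + - x0)"
    by (rule smooth_on_add[OF open_UNIV smooth_on_id[OF open_UNIV] smooth_on_const])
  have "smooth_on UNIV w" unfolding w_def
    by (rule smooth_on_add[OF open_UNIV smooth_on_const smooth_on_add[OF open_UNIV
          smooth_on_bounded_linear[OF open_UNIV blinfun.bounded_linear_right tr]
          smooth_on_bounded_linear[OF open_UNIV bounded_linear_scaleR_right
            smooth_on_bilinear[OF open_UNIV bounded_bilinear_blinfun_apply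
              smooth_on_bounded_linear[OF open_UNIV M tr] tr]]]])
  then have "smooth_on (\<kappa> ` (V \<inter> U)) w" by (rule smooth_on_subset) simp
  then have "smooth_map A (V \<inter> U) (\<lambda>q. w (\<kappa> q))"
    by (rule smooth_map_chart[OF c(1) T.triv_open[OF t(1)]])
  then have ws: "smooth_map A (U \<inter> V) (\<lambda>q. w (\<kappa> q))" by (simp add: Int_commute)
  obtain W N where W: "W \<in> sections A T" "open N" "p \<in> N" "N \<subseteq> U \<inter> V" "\<And>q. q \<in> N \<Longrightarrow> \<phi> q (W q) = w (\<kappa> q)"
    using T.sec_extend[OF t(1) open_UV p_UV _ ws] by auto
  have DW: "chart_deriv (V, \<kappa>) (\<lambda>q. \<phi> q (W q)) q = blinfun_apply (L0 + M (\<kappa> q - x0))" if q: "q \<in> N" for q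
  proof (rule chart_derivI)
    show "((\<lambda>x. \<phi> (inv_into V \<kappa> x) (W (inv_into V \<kappa> x))) has_derivative blinfun_apply (L0 + M (\<kappa> q - x0))) (at (\<kappa> q))"
      by (rule has_derivative_transform_within_open[OF Dw chart_open[OF c(1) W(2)]])
        (use q W(4,5) chart_inv_in[OF _ c(1)] in auto)
  qed
  have MD: "chart_deriv (V, \<kappa>) (\<lambda>q. Blinfun (chart_deriv (V, \<kappa>) (\<lambda>q. \<phi> q (W q)) q)) p = M"
  proof (rule chart_derivI)
    have "((\<lambda>x. L0 + M (x - x0)) has_derivative M) (at (\<kappa> p))"
      by (auto intro!: derivative_eq_intros bounded_linear.has_derivative[OF M])
    then show "((\<lambda>x. Blinfun (chart_deriv (V, \<kappa>) (\<lambda>q. \<phi> q (W q)) (inv_into V \<kappa> x))) has_derivative M) (at (\<kappa> p))"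
      by (rule has_derivative_transform_within_open[OF _ chart_open[OF c(1) W(2)]])
        (use c W(3) DW chart_inv[OF c(1)] in \<open>auto simp: blinfun_apply_inverse\<close>)
  qed
  have M0: "M 0 = 0" using linear_0[OF bounded_linear.linear[OF M]] .
  have L: "chart_deriv (V, \<kappa>) (\<lambda>q. \<phi> q (W q)) p = blinfun_apply L0"
    using DW[OF W(3)] by (simp add: x0_def M0)
  have wp: "\<phi> p (W p) = u0" using W(5)[OF W(3)] by (simp add: w_def x0_def M0)
  have "bounded_linear (chart_deriv (V, \<kappa>) (\<lambda>q. \<phi> q (taut X q)) p)"
    by (rule chart_deriv_linear[OF c(1) open_UV c(2) p_UV smooth_taut[OF X]])
  \<comment> \<open>The vanishing defect ties the derivative of the value component of
    \<open>X\<close> to \<open>L0\<close>, as the jet of \<open>W\<close> requires.\<close>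
  moreover have "Blinfun (chart_deriv (V, \<kappa>) (\<lambda>q. \<phi> q (taut X q)) p) = L0"
    using HS by (simp add: holonomy_defect_def L0_def)
  ultimately have tX: "chart_deriv (V, \<kappa>) (\<lambda>q. \<phi> q (taut X q)) p = blinfun_apply L0"
    using bounded_linear_Blinfun_apply by metis
  have "jet_triv (V, \<kappa>) \<phi> p (X p) = jet_triv (V, \<kappa>) \<phi> p (jet A T W p)"
    unfolding jet_triv_jet[OF t c W(1)] L wp blinfun_apply_inverse
    by (rule prod_eqI) (simp_all add: fst_jet_triv u0_def L0_def)
  then have eq: "X p = jet A T W p"
    using J.triv_inj[OF tJ p_UV J.sec_in[OF X] jet_in_fibre[OF W(1)]] by simp
  note bl = chart_deriv_bl[OF c(1) open_UV c(2) p_UV smooth_jet_triv]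
  have "same_jet A J p X (jet A T W)"
  proof (rule J.same_jet_chartI[OF tJ p_UV c X jet_sec[OF W(1)] eq], rule ext, rule prod_eqI)
    fix v
    show "fst (chart_deriv (V, \<kappa>) (\<lambda>q. jet_triv (V, \<kappa>) \<phi> q (X q)) p v)
      = fst (chart_deriv (V, \<kappa>) (\<lambda>q. jet_triv (V, \<kappa>) \<phi> q (jet A T W q)) p v)"
      unfolding bl[OF X bounded_linear_fst, symmetric] bl[OF jet_sec[OF W(1)] bounded_linear_fst, symmetric]
        fst_jet_triv taut_jet[OF W(1)] tX L ..
    have "chart_deriv (V, \<kappa>) (\<lambda>q. snd (jet_triv (V, \<kappa>) \<phi> q (jet A T W q))) p
      = chart_deriv (V, \<kappa>) (\<lambda>q. Blinfun (chart_deriv (V, \<kappa>) (\<lambda>q. \<phi> q (W q)) q)) p"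
      by (rule chart_deriv_cong[OF c(1) open_UV c(2) p_UV])
        (simp add: jet_bracket.jet_triv_jet[OF jet_bracket_axioms t(1) _ c(1) _ W(1)])
    then show "snd (chart_deriv (V, \<kappa>) (\<lambda>q. jet_triv (V, \<kappa>) \<phi> q (X q)) p v)
      = snd (chart_deriv (V, \<kappa>) (\<lambda>q. jet_triv (V, \<kappa>) \<phi> q (jet A T W q)) p v)"
      unfolding bl[OF X bounded_linear_snd, symmetric] bl[OF jet_sec[OF W(1)] bounded_linear_snd, symmetric]
      by (simp add: MD M_def)
  qed
  then show ?P using jet_cong[of A J p X "jet A T W"] W(1) by (intro bexI[of _ W])
qed

end

end

section \<open>Geometric structures\<close>

locale geometric_structure = jet_bracket A T B
  for A :: "('m::{t2_space,second_countable_topology}, 'e::real_inner) chart set"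
    and T :: "('m, 'v, 'r::real_inner) lie_algebroid"
    and B :: "('m \<Rightarrow> ('m \<Rightarrow> 'v) set) \<Rightarrow> ('m \<Rightarrow> ('m \<Rightarrow> 'v) set) \<Rightarrow> 'm \<Rightarrow> ('m \<Rightarrow> 'v) set" +
  fixes G :: "('m, ('m \<Rightarrow> 'v) set, 'k::real_inner) lie_algebroid"
  assumes sub: "subalgebroid A G (jet_algebroid A T B)" and trans: "transitive A G"
begin

lemma subalgebroid_facts:
  shows "vector_bundle A G" and "bundle_map A G J (\<lambda>m x. x)"
    and "\<forall>X\<in>sections A G. \<forall>Y\<in>sections A G. bracket J X Y \<in> sections A G"
    and "\<forall>X\<in>sections A G. \<forall>Y\<in>sections A G. bracket G X Y = bracket J X Y"
    and "\<forall>m. \<forall>x\<in>fibre G m. anchor G m x = anchor J m x"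
  using sub unfolding subalgebroid_def by - (elim conjE, assumption)+

sublocale G: vec_bundle A G
proof unfold_locales
  show "vector_bundle A G" by (rule subalgebroid_facts)
  then show "framed TYPE('k)" unfolding vector_bundle_def by (intro framed_inner) (erule conjunct1)
qed

lemma G_fibre: "x \<in> fibre G m \<Longrightarrow> x \<in> fibre J m"
  using subalgebroid_facts(2) unfolding bundle_map_def by blast

text \<open>\<open>bundle_map\<close> gives smoothness of the inclusion on vectors constant in a
  trivialization. A section is expanded in a frame of the model fibre of \<open>G\<close>, using
  that the inclusion is fibrewise linear.\<close>

lemma G_sec:
  assumes X: "X \<in> sections A G"
  shows "X \<in> sections A J"
proof (rule J.sections_localI)
  show "X p \<in> fibre J p" for p using G_fibre G.sec_in[OF X] by blast
  obtain n and b :: "nat \<Rightarrow> 'k" and l where e: "frame n b l"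
    using G.framed_r by (auto simp: framed_def)
  have inc: "\<forall>(U, \<phi>)\<in>triv G. \<forall>(V, \<psi>)\<in>triv J. \<forall>w.
      smooth_map A (U \<inter> V) (\<lambda>m. \<psi> m (inv_into (fibre G m) (\<phi> m) w))"
    and add: "\<forall>m. \<forall>x\<in>fibre G m. \<forall>y\<in>fibre G m. vplus G m x y = vplus J m x y"
    and scale: "\<forall>m c. \<forall>x\<in>fibre G m. vscale G m c x = vscale J m c x"
    using subalgebroid_facts(2) unfolding bundle_map_def by - (elim conjE, assumption)+
  fix p
  obtain U \<phi> where t: "(U, \<phi>) \<in> triv G" "p \<in> U" using G.triv_at .
  obtain V \<psi> where t': "(V, \<psi>) \<in> triv J" "p \<in> V" using J.triv_at .
  let ?N = "U \<inter> V"
  have o: "open ?N" using G.triv_open[OF t(1)] J.triv_open[OF t'(1)] by auto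
  have i: "smooth_map A ?N (\<lambda>m. \<psi> m (inv_into (fibre G m) (\<phi> m) w))" for w
    using bspec[OF bspec[OF inc t(1), unfolded split_conv] t'(1), unfolded split_conv] by (rule spec)
  have s: "smooth_map A ?N (\<lambda>q. \<phi> q (X q))" by (rule smooth_map_subset[OF G.sec_smooth[OF X t(1)]]) auto
  have "smooth_map A ?N (\<lambda>q. \<Sum>i<n. l i (\<phi> q (X q)) *\<^sub>R \<psi> q (inv_into (fibre G q) (\<phi> q) (b i)))"
    by (rule smooth_map_sum[OF o smooth_map_scaleR[OF o smooth_map_bl[OF o frame_bl[OF e] s] i]]) simp
  then have "smooth_map A ?N (\<lambda>q. \<psi> q (X q))"
  proof (rule smooth_map_cong[OF o, rotated])
    fix q assume "q \<in> ?N"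
    then have q: "q \<in> U" "q \<in> V" by auto
    have lin: "linear (\<lambda>w. \<psi> q (inv_into (fibre G q) (\<phi> q) w))"
    proof (rule linearI)
      fix w w' c
      note g = G.triv_inv_in[OF t(1) q(1)]
      have "inv_into (fibre G q) (\<phi> q) (w + w') =
          vplus G q (inv_into (fibre G q) (\<phi> q) w) (inv_into (fibre G q) (\<phi> q) w')"
        by (subst G.triv_inj[OF t(1) q(1), symmetric])
          (auto simp: G.triv_facts[OF t(1) q(1)] G.triv_inv[OF t(1) q(1)] g)
      then show "\<psi> q (inv_into (fibre G q) (\<phi> q) (w + w')) =
          \<psi> q (inv_into (fibre G q) (\<phi> q) w) + \<psi> q (inv_into (fibre G q) (\<phi> q) w')"
        using add g by (simp add: J.triv_facts[OF t'(1) q(2)] G_fibre)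
      have "inv_into (fibre G q) (\<phi> q) (c *\<^sub>R w) = vscale G q c (inv_into (fibre G q) (\<phi> q) w)"
        by (subst G.triv_inj[OF t(1) q(1), symmetric])
          (auto simp: G.triv_facts[OF t(1) q(1)] G.triv_inv[OF t(1) q(1)] g)
      then show "\<psi> q (inv_into (fibre G q) (\<phi> q) (c *\<^sub>R w)) = c *\<^sub>R \<psi> q (inv_into (fibre G q) (\<phi> q) w)"
        using scale g by (simp add: J.triv_facts[OF t'(1) q(2)] G_fibre)
    qed
    from frame_linear_expand[OF e lin, of "\<phi> q (X q)"]
    show "(\<Sum>i<n. l i (\<phi> q (X q)) *\<^sub>R \<psi> q (inv_into (fibre G q) (\<phi> q) (b i))) = \<psi> q (X q)"
      unfolding G.triv_inv_left[OF t(1) q(1) G.sec_in[OF X]] by (rule sym)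
  qed
  then show "\<exists>U \<phi> N. (U, \<phi>) \<in> triv J \<and> open N \<and> p \<in> N \<and> N \<subseteq> U \<and> smooth_map A N (\<lambda>q. \<phi> q (X q))"
    using t t' o by (intro exI[of _ V] exI[of _ \<psi>] exI[of _ ?N]) auto
qed

lemma G_bracket:
  assumes "X \<in> sections A G" "Y \<in> sections A G"
  shows "bracket G X Y \<in> sections A G" and "bracket G X Y = bracket J X Y"
  using subalgebroid_facts(3,4)[THEN bspec, OF assms(1), THEN bspec, OF assms(2)] by simp_all

text \<open>Transitivity gives a vector of \<open>G\<close> over each tangent vector, and a section
  passes through it. The anchor of \<open>G\<close> is that of \<open>J\<close>, which is the anchor
  of \<open>T\<close> after the tautological map.\<close>

lemma anchor_vec_surj:
  assumes c: "(V, \<kappa>) \<in> A" "m \<in> V"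
  obtains Y where "Y \<in> sections A G" "anchor_vec A T (V, \<kappa>) m (taut Y m) = v"
proof -
  have "dir_deriv A (V, \<kappa>) m v \<in> anchor G m ` fibre G m"
    using trans tangent_fibre[OF c] unfolding transitive_def by auto
  then obtain y where y: "y \<in> fibre G m" "anchor G m y = dir_deriv A (V, \<kappa>) m v" by auto
  obtain Y where Y: "Y \<in> sections A G" "Y m = y" using G.sec_through[OF y(1)] .
  have "anchor J m (Y m) = dir_deriv A (V, \<kappa>) m v" using subalgebroid_facts(5) y Y(2) by auto
  then have "anchor_vec A J (V, \<kappa>) m (Y m) = v" by (rule J.anchor_vecI[OF c])
  then show ?thesis using that Y(1) by (simp add: anchor_vec_J)
qed

lemma torsion_sec_eq:
  assumes "X \<in> sections A G" "Y \<in> sections A G"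
  shows "torsion_sec T G X Y = jet_torsion T J X Y"
  using G_bracket(2)[OF assms]
  by (simp add: fun_eq_iff torsion_sec_def jet_torsion_def sec_minus_def nabla_def taut_def tautological_form_def)

text \<open>\<open>torsion\<close> evaluates on sections picked by \<open>section_through\<close>;
  tensoriality (\<open>jet_torsion_cong\<close>) makes the choice immaterial. Along \<open>X\<close>
  and \<open>Y\<close> the torsion is therefore a smooth section, on which \<xi> can act.\<close>

lemma torsion_eq:
  assumes X: "X \<in> sections A G" and Y: "Y \<in> sections A G"
  shows "torsion A T G p (X p) (Y p) = jet_torsion T J X Y p"
proof -
  have st: "section_through A G p (Z p) \<in> sections A G \<and> section_through A G p (Z p) p = Z p"
    if "Z \<in> sections A G" for Z
    unfolding section_through_def by (rule someI[of "\<lambda>Y. Y \<in> sections A G \<and> Y p = Z p" Z]) (simp add: that)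
  obtain U \<phi> where t: "(U, \<phi>) \<in> triv T" "p \<in> U" using T.triv_at .
  obtain V \<kappa> where c: "(V, \<kappa>) \<in> A" "p \<in> V" using chart_at .
  show ?thesis
    unfolding torsion_def torsion_sec_eq[OF st[OF X, THEN conjunct1] st[OF Y, THEN conjunct1]]
    by (rule jet_torsion_cong[OF t c]) (use st[OF X] st[OF Y] G_sec X Y in auto)
qed

text \<open>With \<open>X = jet_rep \<xi>\<close>, the first term is the action of
  \<open>X m\<close>, and \<open>taut_bracket\<close> turns the second into the bracket of
  \<open>taut X\<close> with \<open>taut Y\<close>.\<close>

lemma act_one_form_eq:
  assumes \<xi>: "\<xi> \<in> jet_fibre A G m" and Y: "Y \<in> sections A G"
  shows "act_one_form T G m \<xi> tautological_form Y = spencer T (jet_rep \<xi>) (taut Y) m"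
proof -
  note X = jet_rep_fibre(1)[OF \<xi>]
  have "taut (bracket G (jet_rep \<xi>) Y) m = bracket T (taut (jet_rep \<xi>)) (taut Y) m"
    using G_bracket[OF X Y] taut_bracket[OF G_sec[OF X] G_sec[OF Y]] by simp
  then show ?thesis
    by (simp add: act_one_form_def spencer_def sec_minus_def nabla_def ad_def taut_def tautological_form_def
        jet_proj_def[of m \<xi>])
qed

lemma act_two_form_eq:
  assumes \<xi>: "\<xi> \<in> jet_fibre A G m" and Y: "Y \<in> sections A G" "Z \<in> sections A G"
  shows "act_two_form T G m \<xi> (torsion A T G) Y Z =
    vminus T m (vminus T m (nabla T (jet_rep \<xi>) (jet_torsion T J Y Z) m) (jet_torsion T J (bracket J (jet_rep \<xi>) Y) Z m))
      (jet_torsion T J Y (bracket J (jet_rep \<xi>) Z) m)"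
proof -
  note X = jet_rep_fibre(1)[OF \<xi>]
  note b = G_bracket[OF X Y(1)] G_bracket[OF X Y(2)]
  show ?thesis
    using torsion_eq[OF b(1) Y(2), of m] torsion_eq[OF Y(1) b(3), of m] b(2,4)
    by (simp add: act_two_form_def torsion_eq[OF Y] ad_def[of G] nabla_def jet_proj_def[of m \<xi>])
qed

lemma prolongation_eq:
  "prolongation A T B G = isotropy_one_form A T G tautological_form \<inter> isotropy_two_form A T G (torsion A T G)"
proof -
  have main: "(m, \<xi>) \<in> prolongation A T B G \<longleftrightarrow>
    (m, \<xi>) \<in> isotropy_one_form A T G tautological_form \<inter> isotropy_two_form A T G (torsion A T G)" for m \<xi>
  proof (cases "\<xi> \<in> jet_fibre A G m")
    case False
    then show ?thesis
      by (auto simp: prolongation_def isotropy_one_form_def jet_space_def)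
  next
    case True
    define X where "X = jet_rep \<xi>"
    have XG: "X \<in> sections A G" using jet_rep_fibre(1)[OF True] by (simp add: X_def)
    note X = G_sec[OF XG]
    obtain U \<phi> where t: "(U, \<phi>) \<in> triv T" "m \<in> U" using T.triv_at .
    obtain V \<kappa> where c: "(V, \<kappa>) \<in> A" "m \<in> V" using chart_at .
    define H where "H = holonomy_defect (V, \<kappa>) \<phi> X m"
    define D where "D = chart_deriv (V, \<kappa>) (holonomy_defect (V, \<kappa>) \<phi> X) m"
    have one: "(\<forall>Y\<in>sections A G. act_one_form T G m \<xi> tautological_form Y = vzero T m) \<longleftrightarrow> H = 0"
    proof -
      have iff: "act_one_form T G m \<xi> tautological_form Y = vzero T m \<longleftrightarrow>
          blinfun_apply H (anchor_vec A T (V, \<kappa>) m (taut Y m)) = 0" if Y: "Y \<in> sections A G" for Y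
      proof -
        note aY = taut_sec[OF G_sec[OF Y]]
        have "spencer T X (taut Y) m = vzero T m \<longleftrightarrow> \<phi> m (spencer T X (taut Y) m) = \<phi> m (vzero T m)"
          using T.triv_inj[OF t T.sec_in[OF spencer_sec[OF X aY]] T.zero_in] by simp
        then show ?thesis
          unfolding act_one_form_eq[OF True Y] X_def[symmetric] triv_spencer_defect[OF t c X aY]
            T.triv_facts(2)[OF t] H_def .
      qed
      show ?thesis
      proof
        assume a: "\<forall>Y\<in>sections A G. act_one_form T G m \<xi> tautological_form Y = vzero T m"
        show "H = 0"
        proof (rule blinfun_eqI)
          fix v
          obtain Y where "Y \<in> sections A G" "anchor_vec A T (V, \<kappa>) m (taut Y m) = v"
            using anchor_vec_surj[OF c] .
          then show "blinfun_apply H v = blinfun_apply 0 v" using a iff by auto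
        qed
      qed (simp add: iff)
    qed
    \<comment> \<open>Only where the defect vanishes does the action on the torsion reduce to the
      antisymmetric part of \<open>D\<close>, so the second condition is analysed relative to the
      first.\<close>
    have two: "(\<forall>Y\<in>sections A G. \<forall>Z\<in>sections A G. act_two_form T G m \<xi> (torsion A T G) Y Z = vzero T m) \<longleftrightarrow>
      (\<forall>a b. blinfun_apply (D a) b = blinfun_apply (D b) a)" if H: "H = 0"
    proof -
      have iff: "act_two_form T G m \<xi> (torsion A T G) Y Z = vzero T m \<longleftrightarrow>
        blinfun_apply (D (anchor_vec A T (V, \<kappa>) m (taut Y m))) (anchor_vec A T (V, \<kappa>) m (taut Z m))
        = blinfun_apply (D (anchor_vec A T (V, \<kappa>) m (taut Z m))) (anchor_vec A T (V, \<kappa>) m (taut Y m))"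
        if YG: "Y \<in> sections A G" "Z \<in> sections A G" for Y Z
      proof -
        note Y = G_sec[OF YG(1)] G_sec[OF YG(2)]
        let ?x = "nabla T X (jet_torsion T J Y Z) m" and ?y = "jet_torsion T J (bracket J X Y) Z m" and ?z = "jet_torsion T J Y (bracket J X Z) m"
        have i: "?x \<in> fibre T m" "?y \<in> fibre T m" "?z \<in> fibre T m"
          by (rule T.sec_in, intro nabla_sec jet_torsion_sec J.bracket_sec X Y)+
        have "vminus T m (vminus T m ?x ?y) ?z = vzero T m \<longleftrightarrow>
            \<phi> m (vminus T m (vminus T m ?x ?y) ?z) = \<phi> m (vzero T m)"
          using T.triv_inj[OF t T.minus_in[OF T.minus_in[OF i(1,2)] i(3)] T.zero_in] by simp
        also have "\<dots> \<longleftrightarrow> \<phi> m ?x - \<phi> m ?y - \<phi> m ?z = 0"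
          by (simp add: T.triv_minus[OF t] i T.triv_facts(2)[OF t])
        finally show ?thesis
          unfolding act_two_form_eq[OF True YG] X_def[symmetric]
            jet_torsion_derivative_defect[OF t c X Y H[unfolded H_def]] D_def by simp
      qed
      show ?thesis
      proof
        assume a: "\<forall>Y\<in>sections A G. \<forall>Z\<in>sections A G. act_two_form T G m \<xi> (torsion A T G) Y Z = vzero T m"
        show "\<forall>a b. blinfun_apply (D a) b = blinfun_apply (D b) a"
        proof (intro allI)
          fix v w
          obtain Y where Y: "Y \<in> sections A G" "anchor_vec A T (V, \<kappa>) m (taut Y m) = v"
            using anchor_vec_surj[OF c] .
          obtain Z where Z: "Z \<in> sections A G" "anchor_vec A T (V, \<kappa>) m (taut Z m) = w"
            using anchor_vec_surj[OF c] .
          show "blinfun_apply (D v) w = blinfun_apply (D w) v"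
            using a iff[OF Y(1) Z(1)] Y Z by auto
        qed
      qed (simp add: iff)
    qed
    \<comment> \<open>The question is now whether the jet of \<open>X\<close> among all sections of
      \<open>J\<close> is that of a holonomic section; \<open>G\<close> has dropped out.\<close>
    have "(m, \<xi>) \<in> prolongation A T B G \<longleftrightarrow> (\<exists>W\<in>sections A T. jet A J X m = jet A J (jet A T W) m)"
      using True by (auto simp: prolongation_def jet_space_def jet2_space_def X_def)
    also have "\<dots> \<longleftrightarrow> H = 0 \<and> (\<forall>a b. blinfun_apply (D a) b = blinfun_apply (D b) a)"
      unfolding H_def D_def by (rule holonomic_extension_iff[OF t c X])
    also have "\<dots> \<longleftrightarrow> (m, \<xi>) \<in> isotropy_one_form A T G tautological_form \<inter> isotropy_two_form A T G (torsion A T G)"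
      using True one two by (auto simp: isotropy_one_form_def isotropy_two_form_def jet_space_def)
    finally show ?thesis .
  qed
  then show ?thesis by (intro set_eqI) (simp only: split_paired_all main)
qed

end

theorem proposition8p3:
  fixes A :: "('m::{t2_space,second_countable_topology}, 'e::real_inner) chart set"
    and T :: "('m, 'v, 'r::real_inner) lie_algebroid"
    and B :: "('m \<Rightarrow> ('m \<Rightarrow> 'v) set) \<Rightarrow> ('m \<Rightarrow> ('m \<Rightarrow> 'v) set) \<Rightarrow> 'm \<Rightarrow> ('m \<Rightarrow> 'v) set"
    and G :: "('m, ('m \<Rightarrow> 'v) set, 'k::real_inner) lie_algebroid"
  assumes "smooth_manifold A"
    and "lie_algebroid A T"
    and "is_jet_bracket A T B"
    and "subalgebroid A G (jet_algebroid A T B)"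
    and "transitive A G"
  shows "prolongation A T B G =
           isotropy_one_form A T G tautological_form \<inter> isotropy_two_form A T G (torsion A T G)"
proof -
  interpret geometric_structure A T B G
    by unfold_locales (fact assms)+
  show ?thesis by (rule prolongation_eq)
qed

end
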